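(* Let $\nu>0$ be an even integer and consider the Multigrid Monte Carlo V-cycle ($\gamma_\ell=1$ on all levels) with $\nu_1=\nu_2=\nu/2$ smoothing steps, an exact sampler on level $\ell=0$, and the same symmetric invertible splitting matrix $M_\ell=M_\ell^\top$ for pre- and post-smoothing on every level $\ell\ge 1$. Assume the smoothing property $0<A_\ell\le M_\ell$ for all $\ell\ge1$, and the approximation property $$\|M_\ell^{1/2}(A_\ell^{-1}-I_{\ell-1}^\ell A_{\ell-1}^{-1}I_\ell^{\ell-1})M_\ell^{1/2}\|_2\le C_A\qquad\text{for all }\ell\ge1$$ with $C_A>0$ independent of $\ell$. For $L\ge1$ and $f_L\in\mathbb R^{n_L}$ let $(\theta_L^{(m)})_{m\ge0}$ be the chain $\theta_L^{(m+1)}=\mathrm{MGMC}_L(A_L,f_L,\theta_L^{(m)})$, where the initial sample $\theta_L^{(0)}$ is drawn from a distribution with $\|A_L^{1/2}\mathrm{Cov}(\theta_L^{(0)})A_L^{1/2}\|_2<C_0$ for some constant $C_0$ independent of $L$. Then $$\tau^{(\infty)}_{\mathrm{int},F_L}\le\frac{1+\|X_L\|_{A_L}}{1-\|X_L\|_{A_L}},$$ and there is a constant $C$ independent of $L$ such that for all $m\ge1$ $$\bigl|\tau^{(m)}_{\mathrm{int},F_L}-\tau^{(\infty)}_{\mathrm{int},F_L}\bigr|\le C\,\frac{\|X_L\|_{A_L}^{2m+1}}{(1-\|X_L\|_{A_L})(1-\|X_L\|_{A_L}^{2m})}.$$ If instead $\theta_L^{(0)}$ is drawn from the target distribution $\mathcal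 N(A_L^{-1}f_L,A_L^{-1})$, then $\tau^{(m)}_{\mathrm{int},F_L}=\tau^{(\infty)}_{\mathrm{int},F_L}$ for every $m\ge0$.
   Context: Hierarchy: for $\ell=0,1,2,\dots$ let $n_0<n_1<\dots$ be dimensions, $I_{\ell-1}^{\ell}\in\mathbb R^{n_\ell\times n_{\ell-1}}$ matrices of full column rank, $I_\ell^{\ell-1}=(I_{\ell-1}^\ell)^\top$, and $A_\ell\in\mathbb R^{n_\ell\times n_\ell}$ symmetric positive definite with $A_{\ell-1}=I_\ell^{\ell-1}A_\ell I_{\ell-1}^\ell$ for $\ell\ge1$. $A\le B$ means $B-A$ is positive semidefinite; $I$ without indices is the identity. Random smoother: $\mathrm{RandomSmoother}(A,M,f,\theta):=\theta+M^{-1}(f+\xi-A\theta)$ with a fresh $\xi\sim\mathcal N(0,M+M^\top-A)$, independent of everything else. MGMC update $\mathrm{MGMC}_\ell(A_\ell,f_\ell,\theta_\ell)$ (V-cycle, exact coarse sampler): if $\ell=0$, return a fresh sample from $\mathcal N(A_0^{-1}f_0,A_0^{-1})$. If $\ell\ge1$: (1) starting from $\theta_\ell$ apply $\nu_1$ times $\theta\mapsto\mathrm{RandomSmoother}(A_\ell,M_\ell,f_\ell,\theta)$, giving $\theta_{\ell,\nu_1}$; (2) set $f_{\ell-1}:=I_\ell^{\ell-1}(f_\ell-A_\ell\theta_{\ell,\nu_1})$, $\psi_{\ell-1}:=\mathrm{MGMC}_{\ell-1}(A_{\ell-1},f_{\ell-1},0)$, $\theta_{\ell,\nu_1+1}:=\theta_{\ell,\nu_1}+I_{\ell-1}^\ell\psi_{\ell-1}$;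 (3) starting from $\theta_{\ell,\nu_1+1}$ apply $\nu_2$ times the same random smoother and return the result. All random variables drawn are mutually independent and independent of the initial state, which is multivariate normal (possibly degenerate). Iteration matrix: with $S_\ell:=I-M_\ell^{-1}A_\ell$, set $X_0:=0$ and, for $\ell\ge1$, $$X_\ell:=S_\ell^{\nu_2}\bigl(I-I_{\ell-1}^\ell A_{\ell-1}^{-1}I_\ell^{\ell-1}A_\ell+I_{\ell-1}^\ell X_{\ell-1}A_{\ell-1}^{-1}I_\ell^{\ell-1}A_\ell\bigr)S_\ell^{\nu_1}.$$ $\|X\|_A:=\|A^{1/2}XA^{-1/2}\|_2$. Quantity of interest: $H$ is a real separable Hilbert space, $V_L\subset H$ an $n_L$-dimensional subspace with basis $\phi^L_1,\dots,\phi^L_{n_L}$, $\mathcal F(\phi)=\langle\phi,\chi\rangle_H$ for some $\chi\in H$, and $F_L\in\mathbb R^{n_L}$ has entries $(F_L)_j=\mathcal F(\phi_j^L)$; it is assumed that $F_L\neq0$. The integrated autocorrelation times are $$\tau^{(m)}_{\mathrm{int},F_L}:=1+2\sum_{s=1}^\infty\frac{\mathrm{Cov}(F_L^\top\theta_L^{(m+s)},F_L^\top\theta_L^{(m)})}{\mathrm{Cov}(F_L^\top\theta_L^{(m)},F_L^\top\theta_L^{(m)})},\qquad \tau^{(\infty)}_{\mathrm{int},F_L}:=1+2\sum_{s=1}^\infty\frac{F_L^\top X_L^sA_L^{-1}F_L}{F_L^\top A_L^{-1}F_L}.$$ *)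

theory Defs
  imports
    "HOL-Probability.Probability"
    "Jordan_Normal_Form.Gauss_Jordan_Elimination"
    "Jordan_Normal_Form.DL_Rank"
begin

unbundle no inner_syntax
unbundle no vec_syntax
hide_type (open) Finite_Cartesian_Product.vec
hide_const (open) Finite_Cartesian_Product.vec Finite_Cartesian_Product.vec_nth
  Finite_Cartesian_Product.row Finite_Cartesian_Product.column

section \<open>Real matrices\<close>

text \<open>Junk value if \<open>A\<close> is not invertible.\<close>
definition mat_inv :: "real mat \<Rightarrow> real mat" where
  "mat_inv A = the (mat_inverse A)"

definition sym_mat :: "nat \<Rightarrow> real mat \<Rightarrow> bool" where
  "sym_mat n A \<longleftrightarrow> A \<in> carrier_mat n n \<and> transpose_mat A = A"

definition psd_mat :: "nat \<Rightarrow> real mat \<Rightarrow> bool" where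
  "psd_mat n A \<longleftrightarrow> sym_mat n A \<and> (\<forall>v\<in>carrier_vec n. 0 \<le> v \<bullet> (A *\<^sub>v v))"

definition spd_mat :: "nat \<Rightarrow> real mat \<Rightarrow> bool" where
  "spd_mat n A \<longleftrightarrow> sym_mat n A \<and> (\<forall>v\<in>carrier_vec n. v \<noteq> 0\<^sub>v n \<longrightarrow> 0 < v \<bullet> (A *\<^sub>v v))"

text \<open>\<open>A \<le> B\<close> for matrices: \<open>B - A\<close> is positive semidefinite.\<close>
definition loewner_le :: "nat \<Rightarrow> real mat \<Rightarrow> real mat \<Rightarrow> bool" where
  "loewner_le n A B \<longleftrightarrow> A \<in> carrier_mat n n \<and> B \<in> carrier_mat n n \<and> psd_mat n (B - A)"

text \<open>The root \<open>A\<^sup>1\<^sup>/\<^sup>2\<close> of a positive semidefinite \<open>A\<close>; it is unique, so the choice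
  operator merely names it.\<close>
definition mat_sqrt :: "real mat \<Rightarrow> real mat" where
  "mat_sqrt A = (SOME B. psd_mat (dim_row A) B \<and> B * B = A)"

definition norm2_vec :: "real Matrix.vec \<Rightarrow> real" where
  "norm2_vec v = sqrt (v \<bullet> v)"

definition norm2_mat :: "real mat \<Rightarrow> real" where
  "norm2_mat B = (SUP v\<in>{v \<in> carrier_vec (dim_col B). norm2_vec v \<le> 1}. norm2_vec (B *\<^sub>v v))"

definition energy_norm :: "real mat \<Rightarrow> real mat \<Rightarrow> real" where
  "energy_norm A X = norm2_mat (mat_sqrt A * X * mat_inv (mat_sqrt A))"


section \<open>Random vectors\<close>

text \<open>\<open>carrier_vec n\<close> with its Borel sets, transported from the product space of the coordinates.\<close>
definition vec_borel :: "nat \<Rightarrow> real Matrix.vec measure" where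
  "vec_borel n = vimage_algebra (carrier_vec n) (\<lambda>v. \<lambda>i\<in>{..<n}. v $ i) (Pi\<^sub>M {..<n} (\<lambda>_. borel))"

definition cov :: "'w measure \<Rightarrow> ('w \<Rightarrow> real) \<Rightarrow> ('w \<Rightarrow> real) \<Rightarrow> real" where
  "cov Q X Y = integral\<^sup>L Q (\<lambda>w. (X w - integral\<^sup>L Q X) * (Y w - integral\<^sup>L Q Y))"

definition cov_mat :: "'w measure \<Rightarrow> nat \<Rightarrow> ('w \<Rightarrow> real Matrix.vec) \<Rightarrow> real mat" where
  "cov_mat Q n X = mat n n (\<lambda>(i, j). cov Q (\<lambda>w. X w $ i) (\<lambda>w. X w $ j))"

definition normal1 :: "real \<Rightarrow> real \<Rightarrow> real measure" where
  "normal1 \<mu> v = (if v = 0 then return borel \<mu> else density lborel (normal_density \<mu> (sqrt v)))"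

text \<open>\<open>X \<sim> N(\<mu>, \<Sigma>)\<close> under \<open>Q\<close>, with possibly singular \<open>\<Sigma>\<close>: every linear functional
  \<open>a\<^sup>T X\<close> has the (possibly degenerate) law \<open>N(a\<^sup>T \<mu>, a\<^sup>T \<Sigma> a)\<close>.\<close>
definition mv_normal ::
    "'w measure \<Rightarrow> nat \<Rightarrow> ('w \<Rightarrow> real Matrix.vec) \<Rightarrow> real Matrix.vec \<Rightarrow> real mat \<Rightarrow> bool" where
  "mv_normal Q n X \<mu> \<Sigma> \<longleftrightarrow>
     X \<in> measurable Q (vec_borel n) \<and> \<mu> \<in> carrier_vec n \<and> psd_mat n \<Sigma> \<and>
     (\<forall>a\<in>carrier_vec n. distr Q borel (\<lambda>w. a \<bullet> X w) = normal1 (a \<bullet> \<mu>) (a \<bullet> (\<Sigma> *\<^sub>v a)))"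


section \<open>Multigrid hierarchy and iteration matrix\<close>

text \<open>\<open>P l\<close> (for \<open>l \<ge> 1\<close>) is the prolongation from level \<open>l - 1\<close> to level \<open>l\<close>; the restriction
  is its transpose. \<open>P 0\<close> is irrelevant.\<close>
definition multigrid_hierarchy :: "(nat \<Rightarrow> nat) \<Rightarrow> (nat \<Rightarrow> real mat) \<Rightarrow> (nat \<Rightarrow> real mat) \<Rightarrow> bool" where
  "multigrid_hierarchy n A P \<longleftrightarrow>
     strict_mono n \<and>
     (\<forall>l. spd_mat (n l) (A l)) \<and>
     (\<forall>l\<ge>1. P l \<in> carrier_mat (n l) (n (l - 1)) \<and> vec_space.rank (n l) (P l) = n (l - 1) \<and>
        A (l - 1) = transpose_mat (P l) * A l * P l)"

definition smoother_mat :: "real mat \<Rightarrow> real mat \<Rightarrow> real mat" where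
  "smoother_mat A M = 1\<^sub>m (dim_row A) - mat_inv M * A"

primrec iteration_mat ::
    "(nat \<Rightarrow> real mat) \<Rightarrow> (nat \<Rightarrow> real mat) \<Rightarrow> (nat \<Rightarrow> real mat) \<Rightarrow> nat \<Rightarrow> nat \<Rightarrow> nat \<Rightarrow> real mat" where
  "iteration_mat A P M \<nu>1 \<nu>2 0 = 0\<^sub>m (dim_row (A 0)) (dim_row (A 0))"
| "iteration_mat A P M \<nu>1 \<nu>2 (Suc l) =
     (smoother_mat (A (Suc l)) (M (Suc l)) ^\<^sub>m \<nu>2) *
     (1\<^sub>m (dim_row (A (Suc l)))
       - P (Suc l) * mat_inv (A l) * transpose_mat (P (Suc l)) * A (Suc l)
       + P (Suc l) * iteration_mat A P M \<nu>1 \<nu>2 l * mat_inv (A l) * transpose_mat (P (Suc l)) * A (Suc l)) *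
     (smoother_mat (A (Suc l)) (M (Suc l)) ^\<^sub>m \<nu>1)"


section \<open>The Multigrid Monte Carlo chain\<close>

definition random_smoother ::
    "real mat \<Rightarrow> real mat \<Rightarrow> real Matrix.vec \<Rightarrow> real Matrix.vec \<Rightarrow> real Matrix.vec \<Rightarrow> real Matrix.vec" where
  "random_smoother A M f \<xi> \<theta> = \<theta> + mat_inv M *\<^sub>v (f + \<xi> - A *\<^sub>v \<theta>)"

primrec smooth_iter ::
    "real mat \<Rightarrow> real mat \<Rightarrow> real Matrix.vec \<Rightarrow> (nat \<Rightarrow> real Matrix.vec) \<Rightarrow> nat \<Rightarrow>
     real Matrix.vec \<Rightarrow> real Matrix.vec" where
  "smooth_iter A M f \<xi> 0 \<theta> = \<theta>"
| "smooth_iter A M f \<xi> (Suc k) \<theta> = random_smoother A M f (\<xi> k) (smooth_iter A M f \<xi> k \<theta>)"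

text \<open>One update as a function of the random draws it consumes. A V-cycle visits each level once:
  \<open>\<xi> l j\<close> is the noise of smoothing step \<open>j\<close> on level \<open>l\<close> (\<open>j < \<nu>1\<close> before, \<open>\<nu>1 \<le> j < \<nu>1 + \<nu>2\<close>
  after the coarse correction), and the coarse sample from \<open>N(A\<^sub>0\<^sup>-\<^sup>1 f, A\<^sub>0\<^sup>-\<^sup>1)\<close> is
  \<open>A\<^sub>0\<^sup>-\<^sup>1 f + \<zeta>\<close> with \<open>\<zeta> \<sim> N(0, A\<^sub>0\<^sup>-\<^sup>1)\<close>.\<close>
primrec mgmc ::
    "(nat \<Rightarrow> real mat) \<Rightarrow> (nat \<Rightarrow> real mat) \<Rightarrow> (nat \<Rightarrow> real mat) \<Rightarrow> nat \<Rightarrow> nat \<Rightarrow>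
     (nat \<Rightarrow> nat \<Rightarrow> real Matrix.vec) \<Rightarrow> real Matrix.vec \<Rightarrow> nat \<Rightarrow>
     real Matrix.vec \<Rightarrow> real Matrix.vec \<Rightarrow> real Matrix.vec" where
  "mgmc A P M \<nu>1 \<nu>2 \<xi> \<zeta> 0 f \<theta> = mat_inv (A 0) *\<^sub>v f + \<zeta>"
| "mgmc A P M \<nu>1 \<nu>2 \<xi> \<zeta> (Suc l) f \<theta> =
     (let \<theta>' = smooth_iter (A (Suc l)) (M (Suc l)) f (\<xi> (Suc l)) \<nu>1 \<theta>;
          f' = transpose_mat (P (Suc l)) *\<^sub>v (f - A (Suc l) *\<^sub>v \<theta>');
          \<psi> = mgmc A P M \<nu>1 \<nu>2 \<xi> \<zeta> l f' (0\<^sub>v (dim_row (A l)))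
      in smooth_iter (A (Suc l)) (M (Suc l)) f (\<lambda>j. \<xi> (Suc l) (\<nu>1 + j)) \<nu>2
           (\<theta>' + P (Suc l) *\<^sub>v \<psi>))"

text \<open>All random draws of a run: the initial state, and for each update \<open>m\<close> the coarse noise and
  the smoothing noises (indexed by update, level, step).\<close>
datatype draw = Initial | Coarse nat | Smooth nat nat nat

definition draws :: "nat \<Rightarrow> nat \<Rightarrow> draw set" where
  "draws L \<nu> = {Initial} \<union> range Coarse \<union> {Smooth m l j | m l j. 1 \<le> l \<and> l \<le> L \<and> j < \<nu>}"

primrec draw_dim :: "(nat \<Rightarrow> nat) \<Rightarrow> nat \<Rightarrow> draw \<Rightarrow> nat" where
  "draw_dim n L Initial = n L"
| "draw_dim n L (Coarse m) = n 0"
| "draw_dim n L (Smooth m l j) = n l"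

definition mgmc_draws ::
    "(nat \<Rightarrow> nat) \<Rightarrow> (nat \<Rightarrow> real mat) \<Rightarrow> (nat \<Rightarrow> real mat) \<Rightarrow> nat \<Rightarrow> nat \<Rightarrow>
     'w measure \<Rightarrow> (draw \<Rightarrow> 'w \<Rightarrow> real Matrix.vec) \<Rightarrow> bool" where
  "mgmc_draws n A M \<nu> L Q W \<longleftrightarrow>
     prob_space Q \<and>
     prob_space.indep_vars Q (\<lambda>d. vec_borel (draw_dim n L d)) W (draws L \<nu>) \<and>
     (\<exists>\<mu> \<Sigma>. mv_normal Q (n L) (W Initial) \<mu> \<Sigma>) \<and>
     (\<forall>m. mv_normal Q (n 0) (W (Coarse m)) (0\<^sub>v (n 0)) (mat_inv (A 0))) \<and>
     (\<forall>m. \<forall>l\<in>{1..L}. \<forall>j<\<nu>.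
        mv_normal Q (n l) (W (Smooth m l j)) (0\<^sub>v (n l)) (M l + transpose_mat (M l) - A l))"

primrec mgmc_chain ::
    "(nat \<Rightarrow> real mat) \<Rightarrow> (nat \<Rightarrow> real mat) \<Rightarrow> (nat \<Rightarrow> real mat) \<Rightarrow> nat \<Rightarrow> nat \<Rightarrow>
     (draw \<Rightarrow> 'w \<Rightarrow> real Matrix.vec) \<Rightarrow> nat \<Rightarrow> real Matrix.vec \<Rightarrow> nat \<Rightarrow> 'w \<Rightarrow> real Matrix.vec" where
  "mgmc_chain A P M \<nu>1 \<nu>2 W L f 0 = W Initial"
| "mgmc_chain A P M \<nu>1 \<nu>2 W L f (Suc m) =
     (\<lambda>w. mgmc A P M \<nu>1 \<nu>2 (\<lambda>l j. W (Smooth m l j) w) (W (Coarse m) w) L f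
            (mgmc_chain A P M \<nu>1 \<nu>2 W L f m w))"


section \<open>Quantity of interest and integrated autocorrelation times\<close>

definition indexed_basis :: "nat \<Rightarrow> (nat \<Rightarrow> 'h::real_vector) \<Rightarrow> 'h set \<Rightarrow> bool" where
  "indexed_basis d \<phi> V \<longleftrightarrow>
     inj_on \<phi> {..<d} \<and> independent (\<phi> ` {..<d}) \<and> span (\<phi> ` {..<d}) = V"

definition qoi_vec :: "nat \<Rightarrow> (nat \<Rightarrow> 'h::real_inner) \<Rightarrow> 'h \<Rightarrow> real Matrix.vec" where
  "qoi_vec d \<phi> \<chi> = Matrix.vec d (\<lambda>j. inner (\<phi> j) \<chi>)"

text \<open>Summands of the two autocorrelation series; the summation index \<open>s\<close> of the series
  starts at 1, whence \<open>Suc s\<close> in the sums.\<close>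
definition autocorr :: "'w measure \<Rightarrow> (nat \<Rightarrow> 'w \<Rightarrow> real) \<Rightarrow> nat \<Rightarrow> nat \<Rightarrow> real" where
  "autocorr Q Y m s = cov Q (Y (m + s)) (Y m) / cov Q (Y m) (Y m)"

definition iact :: "'w measure \<Rightarrow> (nat \<Rightarrow> 'w \<Rightarrow> real) \<Rightarrow> nat \<Rightarrow> real" where
  "iact Q Y m = 1 + 2 * (\<Sum>s. autocorr Q Y m (Suc s))"

definition autocorr_lim :: "real mat \<Rightarrow> real mat \<Rightarrow> real Matrix.vec \<Rightarrow> nat \<Rightarrow> real" where
  "autocorr_lim A X F s = (F \<bullet> ((X ^\<^sub>m s) *\<^sub>v (mat_inv A *\<^sub>v F))) / (F \<bullet> (mat_inv A *\<^sub>v F))"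

definition iact_lim :: "real mat \<Rightarrow> real mat \<Rightarrow> real Matrix.vec \<Rightarrow> real" where
  "iact_lim A X F = 1 + 2 * (\<Sum>s. autocorr_lim A X F (Suc s))"

text \<open>The autocorrelation time at time \<open>m\<close> is a genuine number: nonzero variance and
  convergent series.\<close>
definition iact_exists :: "'w measure \<Rightarrow> (nat \<Rightarrow> 'w \<Rightarrow> real) \<Rightarrow> nat \<Rightarrow> bool" where
  "iact_exists Q Y m \<longleftrightarrow> cov Q (Y m) (Y m) > 0 \<and> summable (\<lambda>s. autocorr Q Y m (Suc s))"

end

theory Submission
  imports Defs
begin

text \<open>One cycle is affine in the current state: it maps \<open>\<theta>\<close> to
  \<open>A\<^sup>-\<^sup>1 f + X (\<theta> - A\<^sup>-\<^sup>1 f)\<close> plus an independent noise whose covariance is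
  \<open>A\<^sup>-\<^sup>1 - X A\<^sup>-\<^sup>1 X\<^sup>T\<close>; this form of the noise is preserved under composition of the
  smoothing and coarse-correction steps. Hence, with \<open>\<Sigma>\<close> the initial covariance,
  the covariance at time \<open>m\<close> is \<open>A\<^sup>-\<^sup>1 + X\<^sup>m (\<Sigma> - A\<^sup>-\<^sup>1) (X\<^sup>T)\<^sup>m\<close>, and a lag \<open>s\<close>
  multiplies it by \<open>X\<^sup>s\<close>. Since \<open>X\<close> is self-adjoint for the energy inner product and
  strictly contracts the energy norm, the autocorrelations differ from their limits by a
  geometric sequence in the energy norm of \<open>X\<close>, while the variance at time \<open>m\<close> stays above
  \<open>1 - \<rho>\<^sup>2\<^sup>m\<close> times its limit because \<open>\<Sigma> \<ge> 0\<close>.\<close>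

section \<open>Real symmetric matrices\<close>

text \<open>An autocorrelation time depends on second moments only, so normality serves to supply
  covariances and independence to make cross covariances vanish. The smoothing noise has covariance
  \<open>M + M^T - A = M (A^{-1} - S A^{-1} S^T) M^T\<close>, which is why a smoothing step
  preserves \<open>A^{-1}\<close>; prolonged coarse noise does the same for the coarse correction
  because of the Galerkin relation. Strictness of the contraction comes from the smoother:
  \<open>A \<le> M\<close> makes each smoothing step lose energy, the coarse correction never gains
  any, and compactness of the unit sphere turns pointwise strictness into an energy norm below 1. As
  the bounds are expressed in that norm, only the prefactor has to be uniform in the level. It is
  \<open>4 * (C\<^sub>0 + 1)\<close>: C0 bounds the contribution of \<Sigma> to the deviation
  \<Sigma> - \<open>A^{-1}\<close>, 1 that of \<open>A^{-1}\<close>, and 4 is two error terms in a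
  difference of quotients times the factor 2 in front of the series. The energy norm is built on a
  root named by a choice operator; its existence rests on a spectral theorem proved by maximising
  Rayleigh quotients.\<close>

lemma real_mat_vec_linear:
  fixes A B :: "real mat" and u v w :: "real Matrix.vec"
  shows scalar_prod_add_left: "dim_vec u = dim_vec w \<Longrightarrow> dim_vec v = dim_vec w \<Longrightarrow> (u + v) \<bullet> w = u \<bullet> w + v \<bullet> w"
    and scalar_prod_add_right: "dim_vec u = dim_vec w \<Longrightarrow> dim_vec v = dim_vec w \<Longrightarrow> w \<bullet> (u + v) = w \<bullet> u + w \<bullet> v"
    and scalar_prod_minus_left: "dim_vec u = dim_vec w \<Longrightarrow> dim_vec v = dim_vec w \<Longrightarrow> (u - v) \<bullet> w = u \<bullet> w - v \<bullet> w"
    and scalar_prod_minus_right: "dim_vec u = dim_vec w \<Longrightarrow> dim_vec v = dim_vec w \<Longrightarrow> w \<bullet> (u - v) = w \<bullet> u - w \<bullet> v"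
    and mat_vec_add: "dim_vec u = dim_col A \<Longrightarrow> dim_vec v = dim_col A \<Longrightarrow> A *\<^sub>v (u + v) = A *\<^sub>v u + A *\<^sub>v v"
    and mat_vec_minus: "dim_vec u = dim_col A \<Longrightarrow> dim_vec v = dim_col A \<Longrightarrow> A *\<^sub>v (u - v) = A *\<^sub>v u - A *\<^sub>v v"
    and mat_vec_smult: "dim_vec u = dim_col A \<Longrightarrow> A *\<^sub>v (c \<cdot>\<^sub>v u) = c \<cdot>\<^sub>v (A *\<^sub>v u)"
    and mat_add_vec: "dim_row A = dim_row B \<Longrightarrow> dim_col A = dim_vec u \<Longrightarrow> dim_col B = dim_vec u \<Longrightarrow>
          (A + B) *\<^sub>v u = A *\<^sub>v u + B *\<^sub>v u"
    and mat_minus_vec: "dim_row A = dim_row B \<Longrightarrow> dim_col A = dim_vec u \<Longrightarrow> dim_col B = dim_vec u \<Longrightarrow>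
          (A - B) *\<^sub>v u = A *\<^sub>v u - B *\<^sub>v u"
    and mat_mult_vec: "dim_col A = dim_row B \<Longrightarrow> dim_col B = dim_vec u \<Longrightarrow> (A * B) *\<^sub>v u = A *\<^sub>v (B *\<^sub>v u)"
proof -
  \<comment> \<open>The carrier-set laws are specialised to the actual dimensions of the operands.
    Their side conditions become equations between \<open>dim_vec\<close>, \<open>dim_row\<close>
    and \<open>dim_col\<close>, which rewriting can settle where an ambient dimension would stay
    uninstantiated.\<close>
  let ?n = "dim_vec w" and ?c = "dim_col A" and ?r = "dim_row A"
  show "dim_vec u = dim_vec w \<Longrightarrow> dim_vec v = dim_vec w \<Longrightarrow> (u + v) \<bullet> w = u \<bullet> w + v \<bullet> w"
    by (rule add_scalar_prod_distrib[of _ ?n]) (auto intro: carrier_vecI)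
  show "dim_vec u = dim_vec w \<Longrightarrow> dim_vec v = dim_vec w \<Longrightarrow> w \<bullet> (u + v) = w \<bullet> u + w \<bullet> v"
    by (rule scalar_prod_add_distrib[of _ ?n]) (auto intro: carrier_vecI)
  show "dim_vec u = dim_vec w \<Longrightarrow> dim_vec v = dim_vec w \<Longrightarrow> (u - v) \<bullet> w = u \<bullet> w - v \<bullet> w"
    by (rule minus_scalar_prod_distrib[of _ ?n]) (auto intro: carrier_vecI)
  show "dim_vec u = dim_vec w \<Longrightarrow> dim_vec v = dim_vec w \<Longrightarrow> w \<bullet> (u - v) = w \<bullet> u - w \<bullet> v"
    by (rule scalar_prod_minus_distrib[of _ ?n]) (auto intro: carrier_vecI)
  show "dim_vec u = dim_col A \<Longrightarrow> dim_vec v = dim_col A \<Longrightarrow> A *\<^sub>v (u + v) = A *\<^sub>v u + A *\<^sub>v v"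
    by (rule mult_add_distrib_mat_vec[of _ ?r ?c]) (auto intro: carrier_vecI carrier_matI)
  show "dim_vec u = dim_col A \<Longrightarrow> dim_vec v = dim_col A \<Longrightarrow> A *\<^sub>v (u - v) = A *\<^sub>v u - A *\<^sub>v v"
    by (rule mult_minus_distrib_mat_vec[of _ ?r ?c]) (auto intro: carrier_vecI carrier_matI)
  show "dim_vec u = dim_col A \<Longrightarrow> A *\<^sub>v (c \<cdot>\<^sub>v u) = c \<cdot>\<^sub>v (A *\<^sub>v u)"
    by (rule mult_mat_vec[of _ ?r ?c]) (auto intro: carrier_vecI carrier_matI)
  show "dim_row A = dim_row B \<Longrightarrow> dim_col A = dim_vec u \<Longrightarrow> dim_col B = dim_vec u \<Longrightarrow>
          (A + B) *\<^sub>v u = A *\<^sub>v u + B *\<^sub>v u"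
    by (rule add_mult_distrib_mat_vec[of _ ?r ?c]) (auto intro: carrier_vecI carrier_matI)
  show "dim_row A = dim_row B \<Longrightarrow> dim_col A = dim_vec u \<Longrightarrow> dim_col B = dim_vec u \<Longrightarrow>
          (A - B) *\<^sub>v u = A *\<^sub>v u - B *\<^sub>v u"
    by (rule minus_mult_distrib_mat_vec[of _ ?r ?c]) (auto intro: carrier_vecI carrier_matI)
  show "dim_col A = dim_row B \<Longrightarrow> dim_col B = dim_vec u \<Longrightarrow> (A * B) *\<^sub>v u = A *\<^sub>v (B *\<^sub>v u)"
    by (rule assoc_mult_mat_vec[of _ ?r ?c _ "dim_col B"]) (auto intro: carrier_vecI carrier_matI)
qed

lemma scalar_prod_mat_transpose:
  "A \<in> carrier_mat n m \<Longrightarrow> u \<in> carrier_vec n \<Longrightarrow> v \<in> carrier_vec m \<Longrightarrow>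
    u \<bullet> (A *\<^sub>v v) = (transpose_mat A *\<^sub>v u) \<bullet> (v :: real Matrix.vec)"
  by (simp add: transpose_vec_mult_scalar)

lemma mat_vec_zero: "A \<in> carrier_mat n m \<Longrightarrow> A *\<^sub>v 0\<^sub>v m = (0\<^sub>v n :: real Matrix.vec)"
  by (auto intro!: eq_vecI)

lemma sym_mat_scalar_prod:
  "sym_mat n A \<Longrightarrow> u \<in> carrier_vec n \<Longrightarrow> v \<in> carrier_vec n \<Longrightarrow> (A *\<^sub>v u) \<bullet> v = u \<bullet> (A *\<^sub>v v)"
  unfolding sym_mat_def using scalar_prod_mat_transpose[of A n n u v] by auto

lemma scalar_prod_self_nonneg: "0 \<le> v \<bullet> (v :: real Matrix.vec)"
  unfolding scalar_prod_def by (intro sum_nonneg) auto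

lemma scalar_prod_self_eq_0:
  "v \<in> carrier_vec n \<Longrightarrow> v \<bullet> (v :: real Matrix.vec) = 0 \<Longrightarrow> v = 0\<^sub>v n"
  unfolding scalar_prod_def
  by (subst (asm) sum_nonneg_eq_0_iff) (auto intro!: eq_vecI)

lemma vec_eq_if_scalar_prod_eq:
  fixes x y :: "real Matrix.vec"
  assumes "x \<in> carrier_vec n" "y \<in> carrier_vec n" "\<And>v. v \<in> carrier_vec n \<Longrightarrow> x \<bullet> v = y \<bullet> v"
  shows "x = y"
proof (rule eq_vecI)
  show "dim_vec x = dim_vec y" using assms by simp
  fix i assume "i < dim_vec y"
  then have "i < n" using assms by simp
  then show "x $ i = y $ i" using assms(3)[of "unit_vec n i"] assms(1,2) by (simp add: scalar_prod_right_unit)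
qed

lemma real_vec_Cauchy_Schwarz:
  fixes u v :: "real Matrix.vec"
  assumes "dim_vec u = dim_vec v"
  shows "\<bar>u \<bullet> v\<bar> \<le> sqrt (u \<bullet> u) * sqrt (v \<bullet> v)"
proof -
  have "(u \<bullet> v)\<^sup>2 \<le> (u \<bullet> u) * (v \<bullet> v)"
    unfolding scalar_prod_def using assms
    Cauchy_Schwarz_ineq_sum[of "\<lambda>i. u $ i" "\<lambda>i. v $ i" "{0..<dim_vec v}"]
    by (simp add: power2_eq_square)
  then have "sqrt ((u \<bullet> v)\<^sup>2) \<le> sqrt ((u \<bullet> u) * (v \<bullet> v))" by (rule real_sqrt_le_mono)
  then show ?thesis by (simp add: real_sqrt_mult)
qed

subsection \<open>Spectral theorem and square roots\<close>

text \<open>Padding the k rows with zero rows gives a singular square matrix, since its transpose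
  kills \<open>unit_vec n k\<close>. Any nonzero kernel vector is orthogonal to all the given
  rows.\<close>

lemma exists_orthogonal_vec:
  fixes v :: "nat \<Rightarrow> real Matrix.vec"
  assumes "k < n" and v: "\<And>i. i < k \<Longrightarrow> v i \<in> carrier_vec n"
  obtains x where "x \<in> carrier_vec n" "x \<noteq> 0\<^sub>v n" "\<And>i. i < k \<Longrightarrow> v i \<bullet> x = 0"
proof -
  define B where "B = Matrix.mat n n (\<lambda>(i, j). if i < k then v i $ j else 0)"
  have B: "B \<in> carrier_mat n n" by (simp add: B_def)
  have "transpose_mat B *\<^sub>v unit_vec n k = 0\<^sub>v n" using \<open>k < n\<close> by (auto simp: B_def intro!: eq_vecI)
  moreover have "unit_vec n k \<noteq> (0\<^sub>v n :: real Matrix.vec)" using \<open>k < n\<close>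
    by (metis index_unit_vec(1) index_zero_vec(1) zero_neq_one)
  ultimately have "det (transpose_mat B) = 0" using B
    by (subst det_0_iff_vec_prod_zero_field[of _ n]) (auto intro!: exI[of _ "unit_vec n k"])
  then have "det B = 0" using det_transpose[OF B] by simp
  then obtain x where x: "x \<in> carrier_vec n" "x \<noteq> 0\<^sub>v n" "B *\<^sub>v x = 0\<^sub>v n"
    using det_0_iff_vec_prod_zero_field[OF B] by auto
  have "v i \<bullet> x = 0" if "i < k" for i
  proof -
    have "row B i = v i" using that \<open>k < n\<close> v[OF that] by (auto simp: B_def intro!: eq_vecI)
    then have "v i \<bullet> x = (B *\<^sub>v x) $ i" using that \<open>k < n\<close> B by simp
    then show ?thesis using x that \<open>k < n\<close> by simp
  qed
  then show ?thesis using that x by blast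
qed

text \<open>The quadratic form attains its maximum on the compact unit sphere of the orthogonal
  complement of \<open>W\<close>, and homogeneity extends the inequality to the whole complement.
  The vector \<open>x\<close> witnesses that this sphere is nonempty.\<close>

lemma rayleigh_quotient_max:
  fixes A :: "real mat"
  assumes A: "A \<in> carrier_mat n n" and W: "W \<subseteq> carrier_vec n"
    and x: "x \<in> carrier_vec n" "x \<noteq> 0\<^sub>v n" "\<forall>w\<in>W. w \<bullet> x = 0"
  obtains v where "v \<in> carrier_vec n" "v \<bullet> v = 1" "\<forall>w\<in>W. w \<bullet> v = 0"
    "\<And>u. u \<in> carrier_vec n \<Longrightarrow> \<forall>w\<in>W. w \<bullet> u = 0 \<Longrightarrow> u \<bullet> (A *\<^sub>v u) \<le> (v \<bullet> (A *\<^sub>v v)) * (u \<bullet> u)"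
proof -
  \<comment> \<open>Vectors are transported to functions on the naturals that vanish from index n
    on: there the product topology applies and polynomial expressions in the coordinates are
    continuous.\<close>
  define K where "K = {y::nat \<Rightarrow> real. (\<forall>i\<ge>n. y i = 0) \<and> (\<Sum>i\<in>{0..<n}. y i * y i) = 1 \<and>
    (\<forall>w\<in>W. (\<Sum>i\<in>{0..<n}. w $ i * y i) = 0)}"
  define q where "q y = (\<Sum>i\<in>{0..<n}. y i * (\<Sum>j\<in>{0..<n}. A $$ (i,j) * y j))" for y
  let ?V = "\<lambda>y. Matrix.vec n y"
  have V: "?V (\<lambda>i. if i < n then u $ i else 0) = u" if "u \<in> carrier_vec n" for u :: "real Matrix.vec"
    using that by (auto intro!: eq_vecI)
  have VV: "?V y \<bullet> ?V y = (\<Sum>i\<in>{0..<n}. y i * y i)" for y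
    by (auto simp: scalar_prod_def)
  have wV: "w \<bullet> ?V y = (\<Sum>i\<in>{0..<n}. w $ i * y i)" for w y
    by (auto simp: scalar_prod_def)
  have qV: "?V y \<bullet> (A *\<^sub>v ?V y) = q y" for y
    using A by (auto simp: scalar_prod_def q_def intro!: sum.cong)
  have KV: "y \<in> K \<longleftrightarrow> (\<forall>i\<ge>n. y i = 0) \<and> ?V y \<bullet> ?V y = 1 \<and> (\<forall>w\<in>W. w \<bullet> ?V y = 0)" for y
    by (simp add: K_def VV wV)
  have "K = (\<Inter>i\<in>{n..}. {y. y i = 0}) \<inter> {y. (\<Sum>i\<in>{0..<n}. y i * y i) = 1} \<inter>
    (\<Inter>w\<in>W. {y. (\<Sum>i\<in>{0..<n}. w $ i * y i) = 0})" by (auto simp: K_def)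
  also have "closed \<dots>"
    by (intro closed_Int closed_INT ballI closed_Collect_eq continuous_on_sum continuous_on_mult
        continuous_on_const continuous_on_product_coordinates)
  finally have "closed K" .
  \<comment> \<open>Tychonoff: a unit vector has all coordinates in [-1, 1], so \<open>K\<close> is
    a closed subset of a compact cube.\<close>
  moreover have "compact (PiE UNIV (\<lambda>_::nat. {-1..1::real}))"
    using compactin_PiE[of "\<lambda>_. euclidean" UNIV "\<lambda>_::nat. {-1..1::real}"]
    by (simp add: euclidean_product_topology)
  moreover have "K \<subseteq> PiE UNIV (\<lambda>_. {-1..1})"
  proof
    fix y assume y: "y \<in> K"
    have "\<bar>y i\<bar> \<le> 1" for i
    proof (cases "i < n")
      case True
      then have "y i * y i \<le> (\<Sum>i\<in>{0..<n}. y i * y i)" by (intro member_le_sum) auto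
      then have "(y i)\<^sup>2 \<le> 1" using y by (simp add: K_def power2_eq_square)
      then show ?thesis by (simp add: abs_square_le_1)
    qed (use y in \<open>auto simp: K_def\<close>)
    then show "y \<in> PiE UNIV (\<lambda>_. {-1..1})" by (auto simp: abs_le_iff minus_le_iff)
  qed
  ultimately have "compact K" using compact_Int_closed by (metis inf.absorb_iff2)
  \<comment> \<open>Normalisation: a nonzero vector of the complement is a positive multiple of a
    point of \<open>K\<close>. Applied to \<open>x\<close> it shows \<open>K\<close> nonempty;
    applied to a general \<open>u\<close> it rescales the maximum on the sphere.\<close>
  have norm: "\<exists>c y. c > 0 \<and> u = c \<cdot>\<^sub>v ?V y \<and> y \<in> K \<and> c * c = u \<bullet> u"
    if u: "u \<in> carrier_vec n" "u \<noteq> 0\<^sub>v n" "\<forall>w\<in>W. w \<bullet> u = 0" for u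
  proof -
    have "u \<bullet> u > 0" using u scalar_prod_self_nonneg[of u] scalar_prod_self_eq_0[of u n]
      by (metis less_eq_real_def)
    define c where "c = sqrt (u \<bullet> u)"
    have c: "c > 0" "c * c = u \<bullet> u" using \<open>u \<bullet> u > 0\<close> by (auto simp: c_def)
    define y where "y i = (if i < n then u $ i / c else 0)" for i
    have yu: "?V y = (1 / c) \<cdot>\<^sub>v u" using u by (auto simp: y_def intro!: eq_vecI)
    have "?V y \<bullet> ?V y = 1" unfolding yu using u c \<open>u \<bullet> u > 0\<close>
      by (simp add: field_simps)
    moreover have "w \<bullet> ?V y = 0" if "w \<in> W" for w
      unfolding yu using u that W by (subst scalar_prod_smult_distrib[of _ n]) auto
    moreover have "u = c \<cdot>\<^sub>v ?V y" unfolding yu using c u by (auto intro!: eq_vecI)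
    ultimately show ?thesis using c unfolding KV by (intro exI[of _ c] exI[of _ y]) (auto simp: y_def)
  qed
  have "K \<noteq> {}" using norm[OF x] by auto
  moreover have "continuous_on K q" unfolding q_def
    by (intro continuous_on_sum continuous_on_mult
        continuous_on_const continuous_on_product_coordinates continuous_on_subset[OF continuous_on_product_coordinates]) auto
  ultimately obtain y where y: "y \<in> K" "\<And>z. z \<in> K \<Longrightarrow> q z \<le> q y"
    using continuous_attains_sup[OF \<open>compact K\<close>] by metis
  show ?thesis
  proof (rule that)
    show "?V y \<in> carrier_vec n" by simp
    show "?V y \<bullet> ?V y = 1" "\<forall>w\<in>W. w \<bullet> ?V y = 0" using y unfolding KV by auto
    fix u assume u: "u \<in> carrier_vec n" "\<forall>w\<in>W. w \<bullet> u = 0"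
    show "u \<bullet> (A *\<^sub>v u) \<le> (?V y \<bullet> (A *\<^sub>v ?V y)) * (u \<bullet> u)"
    proof (cases "u = 0\<^sub>v n")
      case True
      then show ?thesis using A by simp
    next
      case False
      then obtain c z where cz: "c > 0" "u = c \<cdot>\<^sub>v ?V z" "z \<in> K" "c * c = u \<bullet> u"
        using norm u by metis
      have "u \<bullet> (A *\<^sub>v u) = (c * c) * q z" unfolding cz(2) using A
        by (simp add: mat_vec_smult qV[symmetric] scalar_prod_smult_distrib[of _ n] smult_scalar_prod_distrib[of _ n])
      also have "\<dots> \<le> (c * c) * q y" using y(2)[OF cz(3)] cz(1) by (intro mult_left_mono) auto
      finally show ?thesis by (simp add: cz(4) qV mult.commute)
    qed
  qed
qed

text \<open>First-order optimality without derivatives: near t = 0 a linear term beats every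
  quadratic one, so it has to vanish.\<close>

lemma quadratic_dominates_linear:
  fixes a c :: real
  assumes "\<And>t. t * a \<le> t\<^sup>2 * c" "0 \<le> a"
  shows "a = 0"
proof (rule ccontr)
  assume "a \<noteq> 0"
  then have a: "a > 0" using assms(2) by simp
  show False
  proof (cases "c \<le> 0")
    case True
    then show False using assms(1)[of 1] a by simp
  next
    case False
    \<comment> \<open>At this t the left side is a^2 / (2 c) and the right side only half of
      that.\<close>
    then show False using assms(1)[of "a / (2 * c)"] a by (simp add: power2_eq_square field_simps)
  qed
qed

text \<open>A maximiser \<open>u\<close> of the Rayleigh quotient on the complement of the
  eigenvectors already found is itself an eigenvector. Its residual \<open>w\<close> lies in that
  complement, so \<open>u\<close> may be perturbed along \<open>w\<close>, and maximality then
  forces \<open>w\<close> to vanish.\<close>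

lemma orthonormal_eigenvectors:
  assumes "sym_mat n A" and "k \<le> n"
  shows "\<exists>v ev. (\<forall>i<k. v i \<in> carrier_vec n \<and> A *\<^sub>v v i = ev i \<cdot>\<^sub>v v i) \<and>
    (\<forall>i<k. \<forall>j<k. v i \<bullet> v j = (if i = j then 1 else 0::real))"
  using \<open>k \<le> n\<close>
proof (induction k)
  case (Suc k)
  then obtain v ev where v: "\<And>i. i < k \<Longrightarrow> v i \<in> carrier_vec n"
    and Av: "\<And>i. i < k \<Longrightarrow> A *\<^sub>v v i = ev i \<cdot>\<^sub>v v i"
    and on: "\<And>i j. i < k \<Longrightarrow> j < k \<Longrightarrow> v i \<bullet> v j = (if i = j then 1 else 0)"
  proof -
    have "k \<le> n" using Suc.prems by simp
    from Suc.IH[OF this] obtain v ev where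
      "(\<forall>i<k. v i \<in> carrier_vec n \<and> A *\<^sub>v v i = ev i \<cdot>\<^sub>v v i) \<and>
       (\<forall>i<k. \<forall>j<k. v i \<bullet> v j = (if i = j then 1 else 0::real))" by (elim exE)
    then show thesis by (intro that[of v ev]) simp_all
  qed
  have A: "A \<in> carrier_mat n n" using assms by (simp add: sym_mat_def)
  let ?W = "v ` {..<k}"
  obtain x where x: "x \<in> carrier_vec n" "x \<noteq> 0\<^sub>v n" "\<And>i. i < k \<Longrightarrow> v i \<bullet> x = 0"
    using exists_orthogonal_vec[of k n v] Suc v by auto
  obtain u where u: "u \<in> carrier_vec n" "u \<bullet> u = 1" "\<forall>w\<in>?W. w \<bullet> u = 0"
    and umax: "\<And>y. y \<in> carrier_vec n \<Longrightarrow> \<forall>w\<in>?W. w \<bullet> y = 0 \<Longrightarrow> y \<bullet> (A *\<^sub>v y) \<le> (u \<bullet> (A *\<^sub>v u)) * (y \<bullet> y)"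
    proof (rule rayleigh_quotient_max[OF A, of ?W x])
    show "?W \<subseteq> carrier_vec n" "\<forall>w\<in>?W. w \<bullet> x = 0" using v x by auto
  qed (use x in auto)
  define l where "l = u \<bullet> (A *\<^sub>v u)"
  define w where "w = A *\<^sub>v u - l \<cdot>\<^sub>v u"
  have wc: "w \<in> carrier_vec n" using u A by (simp add: w_def)
  have Au: "A *\<^sub>v u = w + l \<cdot>\<^sub>v u" using u A by (auto simp: w_def intro!: eq_vecI)
  have uw: "u \<bullet> w = 0" using u A by (simp add: w_def scalar_prod_minus_right l_def)
  \<comment> \<open>By symmetry A moves onto the eigenvector \<open>v i\<close>, which only rescales
    it; hence the complement is invariant under A and contains the residual.\<close>
  have vw: "v i \<bullet> w = 0" if "i < k" for i
  proof -
    have "v i \<bullet> (A *\<^sub>v u) = (ev i \<cdot>\<^sub>v v i) \<bullet> u"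
      using sym_mat_scalar_prod[OF assms(1) v[OF that] u(1)] Av[OF that] by simp
    then show ?thesis using u v[OF that] that A by (simp add: w_def scalar_prod_minus_right)
  qed
  \<comment> \<open>For y = u + t w the quadratic form is l + 2 t (w . w) + t^2 (w . A w), while
    maximality bounds it by l (1 + t^2 (w . w)). Cancelling l and halving gives the coefficient in
    the rule.\<close>
  have "w \<bullet> w = 0"
  proof (rule quadratic_dominates_linear[of _ "(l * (w \<bullet> w) - w \<bullet> (A *\<^sub>v w)) / 2"])
    fix t :: real
    let ?y = "u + t \<cdot>\<^sub>v w"
    have yc: "?y \<in> carrier_vec n" using u wc by simp
    have "v i \<bullet> ?y = 0" if "i < k" for i
      using that u vw[OF that] wc scalar_prod_add_distrib[OF v[OF that] u(1), of "t \<cdot>\<^sub>v w"]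
        scalar_prod_smult_distrib[OF v[OF that] wc, of t] by simp
    then have "\<forall>z\<in>?W. z \<bullet> ?y = 0" by blast
    from umax[OF yc this] have le: "?y \<bullet> (A *\<^sub>v ?y) \<le> l * (?y \<bullet> ?y)" by (simp add: l_def)
    have wu: "w \<bullet> u = 0" using uw comm_scalar_prod[OF u(1) wc] by simp
    have yy: "?y \<bullet> ?y = 1 + t\<^sup>2 * (w \<bullet> w)"
      using u wc uw wu by (simp add: scalar_prod_add_right scalar_prod_add_left power2_eq_square)
    have uAw: "u \<bullet> (A *\<^sub>v w) = w \<bullet> w"
      using sym_mat_scalar_prod[OF assms(1) u(1) wc] u wc uw
      by (simp add: Au scalar_prod_add_left)
    have wAu: "w \<bullet> (A *\<^sub>v u) = w \<bullet> w" using u wc wu by (simp add: Au scalar_prod_add_right)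
    have "?y \<bullet> (A *\<^sub>v ?y) = l + 2 * t * (w \<bullet> w) + t\<^sup>2 * (w \<bullet> (A *\<^sub>v w))"
      using u wc A by (simp add: mat_vec_add mat_vec_smult scalar_prod_add_right scalar_prod_add_left
          power2_eq_square uAw wAu l_def algebra_simps)
    then show "t * (w \<bullet> w) \<le> t\<^sup>2 * ((l * (w \<bullet> w) - w \<bullet> (A *\<^sub>v w)) / 2)"
      using le yy by (simp add: algebra_simps)
  qed (rule scalar_prod_self_nonneg)
  then have "w = 0\<^sub>v n" using scalar_prod_self_eq_0[OF wc] by simp
  then have Au: "A *\<^sub>v u = l \<cdot>\<^sub>v u" using Au u by simp
  have uv: "u \<bullet> v i = 0" "v i \<bullet> u = 0" if "i < k" for i
    using u that comm_scalar_prod[OF u(1) v[OF that]] by auto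
  show ?case
    by (rule exI[of _ "v(k := u)"], rule exI[of _ "ev(k := l)"])
      (use v u Av Au on uv in \<open>auto simp: less_Suc_eq\<close>)
qed simp

lemma spectral_theorem:
  assumes "sym_mat n A"
  obtains U d where "U \<in> carrier_mat n n" "transpose_mat U * U = 1\<^sub>m n" "U * transpose_mat U = 1\<^sub>m n"
    "A = U * Matrix.mat n n (\<lambda>(i, j). if i = j then d i else 0) * transpose_mat U"
proof -
  have A: "A \<in> carrier_mat n n" using assms by (simp add: sym_mat_def)
  obtain v d where v: "\<And>i. i < n \<Longrightarrow> v i \<in> carrier_vec n"
    and Av: "\<And>i. i < n \<Longrightarrow> A *\<^sub>v v i = d i \<cdot>\<^sub>v v i"
    and on: "\<And>i j. i < n \<Longrightarrow> j < n \<Longrightarrow> v i \<bullet> v j = (if i = j then 1 else 0)"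
    using orthonormal_eigenvectors[OF assms order_refl] by blast
  define U where "U = Matrix.mat n n (\<lambda>(i, j). v j $ i)"
  let ?D = "Matrix.mat n n (\<lambda>(i, j). if i = j then d i else 0)"
  have U: "U \<in> carrier_mat n n" by (simp add: U_def)
  have col: "col U j = v j" if "j < n" for j
    using that v[OF that] by (auto simp: U_def intro!: eq_vecI)
  have UU: "transpose_mat U * U = 1\<^sub>m n" using U on col by (auto intro!: eq_matI)
  have UU': "U * transpose_mat U = 1\<^sub>m n"
    using mat_mult_left_right_inverse[OF _ U UU] U by simp
  have AU: "A * U = U * ?D"
  proof (rule eq_matI)
    fix i j assume "i < dim_row (U * ?D)" "j < dim_col (U * ?D)"
    then have ij: "i < n" "j < n" using U by auto
    have "(A * U) $$ (i, j) = (A *\<^sub>v v j) $ i" using ij A U col by simp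
    also have "\<dots> = d j * U $$ (i, j)" using ij v[of j] Av[of j] by (simp add: U_def)
    also have "\<dots> = (\<Sum>k\<in>{0..<n}. U $$ (i, k) * (if k = j then d k else 0))"
      using ij by (subst sum.remove[of _ j]) auto
    also have "\<dots> = (U * ?D) $$ (i, j)" using ij U by (auto simp: scalar_prod_def intro!: sum.cong)
    finally show "(A * U) $$ (i, j) = (U * ?D) $$ (i, j)" .
  qed (use A U in auto)
  have "A = A * (U * transpose_mat U)" using A UU' by simp
  also have "\<dots> = (A * U) * transpose_mat U" using A U by (simp add: assoc_mult_mat[of A n n U n _ n])
  finally have "A = U * ?D * transpose_mat U" unfolding AU .
  then show ?thesis using that U UU UU' by blast
qed


section \<open>Inverses, positive definite matrices and their square roots\<close>

lemma mat_inv: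
  assumes "A \<in> carrier_mat n n" "det A \<noteq> 0"
  shows mat_inv_carrier: "mat_inv A \<in> carrier_mat n n"
    and mat_inv_right: "A * mat_inv A = 1\<^sub>m n" and mat_inv_left: "mat_inv A * A = 1\<^sub>m n"
proof -
  obtain B where "mat_inverse A = Some B"
    using mat_inverse(1)[OF assms(1)] det_non_zero_imp_unit[OF assms] by fastforce
  then show "mat_inv A \<in> carrier_mat n n" "A * mat_inv A = 1\<^sub>m n" "mat_inv A * A = 1\<^sub>m n"
    using mat_inverse(2)[OF assms(1)] by (auto simp: mat_inv_def)
qed

lemma mat_inv_vec:
  assumes "A \<in> carrier_mat n n" "det A \<noteq> 0" "v \<in> carrier_vec n"
  shows mat_inv_vec_right: "A *\<^sub>v (mat_inv A *\<^sub>v v) = v" and mat_inv_vec_left: "mat_inv A *\<^sub>v (A *\<^sub>v v) = v"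
  using mat_inv[OF assms(1,2)] assms
  by (metis assoc_mult_mat_vec one_mult_mat_vec)+

lemma mat_inv_sym:
  assumes "sym_mat n A" "det A \<noteq> 0"
  shows "sym_mat n (mat_inv A)"
proof -
  let ?B = "mat_inv A"
  have A: "A \<in> carrier_mat n n" "transpose_mat A = A" using assms by (auto simp: sym_mat_def)
  note B = mat_inv[OF A(1) assms(2)]
  have "transpose_mat ?B * A = 1\<^sub>m n"
    using transpose_mult[OF A(1) B(1)] B(2) A(2) by simp
  moreover have "transpose_mat ?B = (transpose_mat ?B * A) * ?B"
    using B A by (simp add: assoc_mult_mat[of _ n n _ n _ n] right_mult_one_mat[of _ n n])
  ultimately have "transpose_mat ?B = ?B" using B by simp
  then show ?thesis using B by (simp add: sym_mat_def)
qed

lemma spd_matD: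
  assumes "spd_mat n A"
  shows spd_mat_carrier: "A \<in> carrier_mat n n" and spd_mat_sym: "sym_mat n A"
    and spd_mat_pos: "v \<in> carrier_vec n \<Longrightarrow> v \<noteq> 0\<^sub>v n \<Longrightarrow> 0 < v \<bullet> (A *\<^sub>v v)"
    and spd_mat_nonneg: "v \<in> carrier_vec n \<Longrightarrow> 0 \<le> v \<bullet> (A *\<^sub>v v)"
    and spd_mat_psd: "psd_mat n A"
    and spd_mat_det: "det A \<noteq> 0"
proof -
  show A: "A \<in> carrier_mat n n" and S: "sym_mat n A" using assms by (auto simp: spd_mat_def sym_mat_def)
  show pos: "0 < v \<bullet> (A *\<^sub>v v)" if "v \<in> carrier_vec n" "v \<noteq> 0\<^sub>v n" for v
    using assms that by (auto simp: spd_mat_def)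
  show nn: "0 \<le> v \<bullet> (A *\<^sub>v v)" if "v \<in> carrier_vec n" for v
    using pos[OF that] A by (cases "v = 0\<^sub>v n") auto
  show "psd_mat n A" using S nn by (auto simp: psd_mat_def)
  show "det A \<noteq> 0" using pos det_0_iff_vec_prod_zero_field[OF A] by fastforce
qed

text \<open>Roots are taken of the eigenvalues, which are nonnegative because they are the values of
  the quadratic form at the columns of \<open>U\<close>. With existence settled, the choice in
  \<open>mat_sqrt\<close> denotes an actual root.\<close>

lemma psd_mat_sqrt_exists:
  assumes "psd_mat n A"
  shows "\<exists>R. psd_mat n R \<and> R * R = A"
proof -
  have S: "sym_mat n A" and nn: "\<And>v. v \<in> carrier_vec n \<Longrightarrow> 0 \<le> v \<bullet> (A *\<^sub>v v)"
    using assms by (auto simp: psd_mat_def)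
  let ?D = "\<lambda>d. Matrix.mat n n (\<lambda>(i, j). if i = j then d i else (0::real))"
  obtain U d where U: "U \<in> carrier_mat n n" "transpose_mat U * U = 1\<^sub>m n" "U * transpose_mat U = 1\<^sub>m n"
    and AU: "A = U * ?D d * transpose_mat U"
    by (rule spectral_theorem[OF S])
  let ?T = "transpose_mat U"
  have T: "?T \<in> carrier_mat n n" using U by simp
  have Dc: "?D e \<in> carrier_mat n n" for e by simp
  have form: "v \<bullet> ((U * ?D e * ?T) *\<^sub>v v) = (?T *\<^sub>v v) \<bullet> (?D e *\<^sub>v (?T *\<^sub>v v))"
    if "v \<in> carrier_vec n" for v e
    using that U T scalar_prod_mat_transpose[OF U(1) that mult_mat_vec_carrier[OF Dc[of e] mult_mat_vec_carrier[OF T that]]]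
    by (simp add: mat_mult_vec)
  have quad: "w \<bullet> (?D e *\<^sub>v w) = (\<Sum>i\<in>{0..<n}. e i * (w $ i)\<^sup>2)" if w: "w \<in> carrier_vec n" for w e
  proof -
    have "(?D e *\<^sub>v w) $ i = e i * w $ i" if "i < n" for i
    proof -
      have "(?D e *\<^sub>v w) $ i = (\<Sum>j\<in>{0..<n}. (if i = j then e i else 0) * w $ j)"
        using that w by (auto simp: scalar_prod_def intro!: sum.cong)
      also have "\<dots> = e i * w $ i" using that by (subst sum.remove[of _ i]) auto
      finally show ?thesis .
    qed
    then show ?thesis using w by (auto simp: scalar_prod_def power2_eq_square intro!: sum.cong)
  qed
  have d: "0 \<le> d i" if "i < n" for i
  proof -
    let ?e = "unit_vec n i"
    have "?T *\<^sub>v (U *\<^sub>v ?e) = ?e" using U T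
      by (metis assoc_mult_mat_vec one_mult_mat_vec unit_vec_carrier)
    then have "(U *\<^sub>v ?e) \<bullet> (A *\<^sub>v (U *\<^sub>v ?e)) = (\<Sum>j\<in>{0..<n}. d j * (?e $ j)\<^sup>2)"
      unfolding AU using U form[of "U *\<^sub>v ?e" d] quad[of ?e d] by simp
    also have "\<dots> = d i" using that by (subst sum.remove[of _ i]) auto
    finally show ?thesis using nn[of "U *\<^sub>v ?e"] U by simp
  qed
  define R where "R = U * ?D (\<lambda>i. sqrt (d i)) * ?T"
  have R: "R \<in> carrier_mat n n" using U by (intro carrier_matI) (auto simp: R_def)
  have DT: "transpose_mat (?D e) = ?D e" for e by (auto intro!: eq_matI)
  have "transpose_mat R = transpose_mat ?T * (transpose_mat (?D (\<lambda>i. sqrt (d i))) * ?T)"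
    unfolding R_def using U(1) T Dc[of "\<lambda>i. sqrt (d i)"]
    by (subst transpose_mult[of _ n n _ n], simp_all add: transpose_mult[of _ n n _ n])
  also have "\<dots> = R" unfolding R_def DT using U(1) T Dc by (simp add: assoc_mult_mat[of _ n n _ n _ n])
  finally have "transpose_mat R = R" .
  moreover have "0 \<le> v \<bullet> (R *\<^sub>v v)" if "v \<in> carrier_vec n" for v
    unfolding R_def using that U d by (subst form) (auto simp: quad intro!: sum_nonneg)
  moreover have "R * R = A"
  proof -
    let ?Q = "?D (\<lambda>i. sqrt (d i))"
    have QQ: "?Q * ?Q = ?D d"
    proof (rule eq_matI)
      fix i j assume "i < dim_row (?D d)" "j < dim_col (?D d)"
      then have ij: "i < n" "j < n" by auto
      then have "(?Q * ?Q) $$ (i, j) = (\<Sum>k\<in>{0..<n}. (if i = k then sqrt (d i) else 0) * (if k = j then sqrt (d k) else 0))"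
        by (auto simp: scalar_prod_def intro!: sum.cong)
      also have "\<dots> = (if i = j then d i else 0)" using ij d by (subst sum.remove[of _ i]) (auto intro!: sum.neutral)
      finally show "(?Q * ?Q) $$ (i, j) = ?D d $$ (i, j)" using ij by simp
    qed auto
    have Q: "?Q \<in> carrier_mat n n" and QT: "?Q * ?T \<in> carrier_mat n n"
      using T Dc by (intro mult_carrier_mat[of _ n n] | simp)+
    have RU: "R = U * (?Q * ?T)" unfolding R_def using assoc_mult_mat[OF U(1) Q T] .
    have "?T * (U * (?Q * ?T)) = ?Q * ?T"
      using assoc_mult_mat[OF T U(1) QT, symmetric] U(2) QT by simp
    then have "(?Q * ?T) * (U * (?Q * ?T)) = ?Q * (?Q * ?T)"
      using assoc_mult_mat[OF Q T, of "U * (?Q * ?T)" n] U(1) QT mult_carrier_mat[OF U(1) QT] by simp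
    also have "\<dots> = (?Q * ?Q) * ?T" using assoc_mult_mat[OF Q Q T] by simp
    finally have "R * R = U * ((?Q * ?Q) * ?T)"
      unfolding RU using assoc_mult_mat[OF U(1) QT mult_carrier_mat[OF U(1) QT]] by simp
    also have "\<dots> = A" unfolding QQ AU using U T by (simp add: assoc_mult_mat[of _ n n _ n _ n])
    finally show ?thesis .
  qed
  ultimately show ?thesis using R by (auto simp: psd_mat_def sym_mat_def)
qed

lemma mat_sqrt:
  assumes "psd_mat n A"
  shows mat_sqrt_psd: "psd_mat n (mat_sqrt A)" and mat_sqrt_square: "mat_sqrt A * mat_sqrt A = A"
proof -
  have "dim_row A = n" using assms by (auto simp: psd_mat_def sym_mat_def)
  then show "psd_mat n (mat_sqrt A)" "mat_sqrt A * mat_sqrt A = A"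
    using someI_ex[OF psd_mat_sqrt_exists[OF assms]] by (auto simp: mat_sqrt_def)
qed

subsection \<open>Operator and energy norms\<close>

lemma norm2_vec_nonneg: "0 \<le> norm2_vec v"
  by (simp add: norm2_vec_def scalar_prod_self_nonneg)

lemma norm2_vec_smult: "norm2_vec (c \<cdot>\<^sub>v v) = \<bar>c\<bar> * norm2_vec v"
  by (simp add: norm2_vec_def mult.assoc[symmetric] real_sqrt_mult)

text \<open>Cauchy-Schwarz row by row gives the Frobenius norm as a crude bound. Its purpose is to
  make the supremum in \<open>norm2_mat\<close> one over a bounded set, without which its value
  would carry no information.\<close>

lemma norm2_mat_vec_Frobenius:
  fixes B :: "real mat"
  assumes "dim_vec v = dim_col B"
  shows "norm2_vec (B *\<^sub>v v) \<le> sqrt (\<Sum>i\<in>{0..<dim_row B}. row B i \<bullet> row B i) * norm2_vec v"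
proof -
  have "(B *\<^sub>v v) \<bullet> (B *\<^sub>v v) = (\<Sum>i\<in>{0..<dim_row B}. (row B i \<bullet> v)\<^sup>2)"
    by (auto simp: scalar_prod_def[of "B *\<^sub>v v"] power2_eq_square)
  also have "\<dots> \<le> (\<Sum>i\<in>{0..<dim_row B}. (row B i \<bullet> row B i) * (v \<bullet> v))"
  proof (rule sum_mono)
    fix i
    have "\<bar>row B i \<bullet> v\<bar> \<le> sqrt (row B i \<bullet> row B i) * sqrt (v \<bullet> v)"
      using assms by (intro real_vec_Cauchy_Schwarz) simp
    then have "\<bar>row B i \<bullet> v\<bar>\<^sup>2 \<le> (sqrt (row B i \<bullet> row B i) * sqrt (v \<bullet> v))\<^sup>2"
      by (intro power_mono) auto
    then show "(row B i \<bullet> v)\<^sup>2 \<le> (row B i \<bullet> row B i) * (v \<bullet> v)"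
      by (simp add: power_mult_distrib scalar_prod_self_nonneg)
  qed
  also have "\<dots> = (\<Sum>i\<in>{0..<dim_row B}. row B i \<bullet> row B i) * (v \<bullet> v)" by (simp add: sum_distrib_right)
  finally show ?thesis unfolding norm2_vec_def by (simp add: real_sqrt_mult[symmetric])
qed

lemma norm2_mat_vec_bdd_above:
  "bdd_above ((\<lambda>v. norm2_vec (B *\<^sub>v v)) ` {v \<in> carrier_vec (dim_col B). norm2_vec v \<le> 1})"
proof (rule bdd_aboveI2)
  fix v assume v: "v \<in> {v \<in> carrier_vec (dim_col B). norm2_vec v \<le> 1}"
  let ?c = "sqrt (\<Sum>i\<in>{0..<dim_row B}. row B i \<bullet> row B i)"
  have "norm2_vec (B *\<^sub>v v) \<le> ?c * norm2_vec v" using v by (intro norm2_mat_vec_Frobenius) auto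
  also have "\<dots> \<le> ?c * 1" using v by (intro mult_left_mono) (auto intro!: sum_nonneg scalar_prod_self_nonneg)
  finally show "norm2_vec (B *\<^sub>v v) \<le> ?c" by simp
qed

lemma norm2_mat_nonneg: "0 \<le> norm2_mat B"
proof -
  have "norm2_vec (B *\<^sub>v 0\<^sub>v (dim_col B)) \<le> norm2_mat B" unfolding norm2_mat_def
    by (rule cSUP_upper[OF _ norm2_mat_vec_bdd_above]) (auto simp: norm2_vec_def)
  then show ?thesis using norm2_vec_nonneg order_trans by blast
qed

lemma norm2_mat_vec_le:
  assumes "v \<in> carrier_vec (dim_col B)"
  shows "norm2_vec (B *\<^sub>v v) \<le> norm2_mat B * norm2_vec v"
proof (cases "norm2_vec v = 0")
  \<comment> \<open>A vector of norm zero cannot be normalised; the Frobenius bound shows that its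
    image has norm at most zero as well.\<close>
  case True
  then show ?thesis using norm2_mat_vec_Frobenius[of v B] assms by simp
next
  case False
  then have pos: "norm2_vec v > 0" using norm2_vec_nonneg[of v] by simp
  let ?u = "(1 / norm2_vec v) \<cdot>\<^sub>v v"
  have "norm2_vec (B *\<^sub>v ?u) \<le> norm2_mat B" unfolding norm2_mat_def
    using assms pos by (intro cSUP_upper[OF _ norm2_mat_vec_bdd_above]) (auto simp: norm2_vec_smult)
  then show ?thesis using assms pos by (simp add: mat_vec_smult norm2_vec_smult field_simps)
qed

text \<open>Pointwise strict contraction alone would only give a supremum of at most 1. Here the
  quotient of squared norms is a Rayleigh quotient of \<open>T^T T\<close>, so its maximum is
  attained at some unit vector, and strictness at that vector bounds the whole supremum away from
  1.\<close>

lemma norm2_mat_less_1: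
  assumes T: "T \<in> carrier_mat n n" and "0 < n"
    and contr: "\<And>v. v \<in> carrier_vec n \<Longrightarrow> v \<noteq> 0\<^sub>v n \<Longrightarrow> (T *\<^sub>v v) \<bullet> (T *\<^sub>v v) < v \<bullet> v"
  shows "norm2_mat T < 1"
proof -
  let ?B = "transpose_mat T * T"
  have BT: "u \<bullet> (?B *\<^sub>v u) = (T *\<^sub>v u) \<bullet> (T *\<^sub>v u)" if "u \<in> carrier_vec n" for u
    using that T scalar_prod_mat_transpose[of "transpose_mat T" n n u "T *\<^sub>v u"] by (simp add: mat_mult_vec)
  have e: "unit_vec n 0 \<noteq> (0\<^sub>v n :: real Matrix.vec)" using \<open>0 < n\<close>
    by (metis index_unit_vec(1) index_zero_vec(1) zero_neq_one)
  obtain v where v: "v \<in> carrier_vec n" "v \<bullet> v = 1"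
    and max: "\<And>u. u \<in> carrier_vec n \<Longrightarrow> u \<bullet> (?B *\<^sub>v u) \<le> (v \<bullet> (?B *\<^sub>v v)) * (u \<bullet> u)"
    using rayleigh_quotient_max[of ?B n "{}" "unit_vec n 0"] T e by auto
  define q where "q = (T *\<^sub>v v) \<bullet> (T *\<^sub>v v)"
  have "v \<noteq> 0\<^sub>v n" using v by auto
  then have q: "0 \<le> q" "q < 1" using contr[OF v(1)] v by (auto simp: q_def scalar_prod_self_nonneg)
  have "norm2_mat T \<le> sqrt q" unfolding norm2_mat_def
  proof (rule cSUP_least)
    have "0\<^sub>v (dim_col T) \<in> {v \<in> carrier_vec (dim_col T). norm2_vec v \<le> 1}" by (simp add: norm2_vec_def)
    then show "{v \<in> carrier_vec (dim_col T). norm2_vec v \<le> 1} \<noteq> {}" by blast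
    fix u assume "u \<in> {v \<in> carrier_vec (dim_col T). norm2_vec v \<le> 1}"
    then have u: "u \<in> carrier_vec n" "norm2_vec u \<le> 1" using T by auto
    have "(T *\<^sub>v u) \<bullet> (T *\<^sub>v u) \<le> q * (u \<bullet> u)" using max[OF u(1)] BT[OF u(1)] BT[OF v(1)] by (simp add: q_def)
    also have "\<dots> \<le> q * 1" using u(2) q by (intro mult_left_mono) (auto simp: norm2_vec_def)
    finally show "norm2_vec (T *\<^sub>v u) \<le> sqrt q" by (simp add: norm2_vec_def)
  qed
  also have "\<dots> < 1" using q by simp
  finally show ?thesis .
qed

definition energy_vec :: "real mat \<Rightarrow> real Matrix.vec \<Rightarrow> real" where
  "energy_vec A v = sqrt (v \<bullet> (A *\<^sub>v v))"

text \<open>Being symmetric with square A, the root is an isometry from the energy inner product to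
  the Euclidean one. It carries Cauchy-Schwarz and operator norm bounds over to energies.\<close>

lemma energy_vec_eq:
  assumes "psd_mat n A" "u \<in> carrier_vec n" "v \<in> carrier_vec n"
  shows mat_sqrt_scalar_prod: "u \<bullet> (A *\<^sub>v v) = (mat_sqrt A *\<^sub>v u) \<bullet> (mat_sqrt A *\<^sub>v v)"
    and energy_vec_mat_sqrt: "energy_vec A v = norm2_vec (mat_sqrt A *\<^sub>v v)"
proof -
  let ?R = "mat_sqrt A"
  have R: "sym_mat n ?R" "?R \<in> carrier_mat n n" "?R * ?R = A"
    using mat_sqrt[OF assms(1)] by (auto simp: psd_mat_def sym_mat_def)
  have *: "u \<bullet> (A *\<^sub>v v) = (?R *\<^sub>v u) \<bullet> (?R *\<^sub>v v)" if "u \<in> carrier_vec n" for u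
    using sym_mat_scalar_prod[OF R(1) that, of "?R *\<^sub>v v"] R assms
    by (metis assoc_mult_mat_vec mult_mat_vec_carrier)
  then show "u \<bullet> (A *\<^sub>v v) = (?R *\<^sub>v u) \<bullet> (?R *\<^sub>v v)" using assms by simp
  show "energy_vec A v = norm2_vec (?R *\<^sub>v v)" using *[OF assms(3)] by (simp add: energy_vec_def norm2_vec_def)
qed

lemma energy_Cauchy_Schwarz:
  assumes "psd_mat n A" "u \<in> carrier_vec n" "v \<in> carrier_vec n"
  shows "\<bar>u \<bullet> (A *\<^sub>v v)\<bar> \<le> energy_vec A u * energy_vec A v"
  unfolding mat_sqrt_scalar_prod[OF assms] energy_vec_mat_sqrt[OF assms(1,3,3)] energy_vec_mat_sqrt[OF assms(1,2,2)]
  unfolding norm2_vec_def by (rule real_vec_Cauchy_Schwarz) (use assms in simp)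

lemma mat_sqrt_det:
  assumes "spd_mat n A"
  shows "det (mat_sqrt A) \<noteq> 0"
proof -
  have "mat_sqrt A \<in> carrier_mat n n" using mat_sqrt[OF spd_mat_psd[OF assms]] by (auto simp: psd_mat_def sym_mat_def)
  then show ?thesis using det_mult[of "mat_sqrt A" n "mat_sqrt A"] mat_sqrt_square[OF spd_mat_psd[OF assms]]
      spd_mat_det[OF assms] by auto
qed

text \<open>With R the root of A, the matrix R X R^{-1} that defines the energy norm is evaluated at
  the vector R v.\<close>

lemma energy_norm_vec_le:
  assumes A: "spd_mat n A" and X: "X \<in> carrier_mat n n" and v: "v \<in> carrier_vec n"
  shows "energy_vec A (X *\<^sub>v v) \<le> energy_norm A X * energy_vec A v"
proof -
  let ?R = "mat_sqrt A"
  have R: "?R \<in> carrier_mat n n" using mat_sqrt[OF spd_mat_psd[OF A]] by (auto simp: psd_mat_def sym_mat_def)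
  note d = mat_sqrt_det[OF A] and S = mat_inv[OF R mat_sqrt_det[OF A]]
  have "(?R * X * mat_inv ?R) *\<^sub>v (?R *\<^sub>v v) = ?R *\<^sub>v (X *\<^sub>v v)"
    using R X S v mat_inv_vec_left[OF R d v] by (simp add: mat_mult_vec)
  moreover have "norm2_vec ((?R * X * mat_inv ?R) *\<^sub>v (?R *\<^sub>v v)) \<le> energy_norm A X * norm2_vec (?R *\<^sub>v v)"
    unfolding energy_norm_def using R X S v by (intro norm2_mat_vec_le) simp
  ultimately show ?thesis using energy_vec_mat_sqrt[OF spd_mat_psd[OF A]] X v by simp
qed

lemma energy_norm_less_1:
  assumes A: "spd_mat n A" and X: "X \<in> carrier_mat n n" and n: "0 < n"
    and contr: "\<And>v. v \<in> carrier_vec n \<Longrightarrow> v \<noteq> 0\<^sub>v n \<Longrightarrow> energy_vec A (X *\<^sub>v v) < energy_vec A v"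
  shows "energy_norm A X < 1"
  unfolding energy_norm_def
proof (rule norm2_mat_less_1[OF _ n])
  let ?R = "mat_sqrt A"
  have R: "?R \<in> carrier_mat n n" using mat_sqrt[OF spd_mat_psd[OF A]] by (auto simp: psd_mat_def sym_mat_def)
  note d = mat_sqrt_det[OF A] and S = mat_inv[OF R mat_sqrt_det[OF A]]
  show "?R * X * mat_inv ?R \<in> carrier_mat n n" using R X S by simp
  fix v :: "real Matrix.vec" assume v: "v \<in> carrier_vec n" "v \<noteq> 0\<^sub>v n"
  let ?w = "mat_inv ?R *\<^sub>v v"
  have w: "?w \<in> carrier_vec n" using S v by simp
  have Rw: "?R *\<^sub>v ?w = v" using mat_inv_vec_right[OF R d v(1)] .
  then have "?w \<noteq> 0\<^sub>v n" using v mat_vec_zero[OF R] by metis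
  from contr[OF w this] have "norm2_vec (?R *\<^sub>v (X *\<^sub>v ?w)) < norm2_vec v"
    using energy_vec_mat_sqrt[OF spd_mat_psd[OF A]] X w Rw by simp
  moreover have "(?R * X * mat_inv ?R) *\<^sub>v v = ?R *\<^sub>v (X *\<^sub>v ?w)"
    using R X S v by (simp add: mat_mult_vec)
  ultimately show "((?R * X * mat_inv ?R) *\<^sub>v v) \<bullet> ((?R * X * mat_inv ?R) *\<^sub>v v) < v \<bullet> v"
    by (simp add: norm2_vec_def)
qed

text \<open>Writing A = R R moves one root to each side of \<open>S\<close>. With the initial
  covariance for \<open>S\<close>, this turns the assumed norm bound into an estimate of covariances
  of functionals A x, the form in which the iterated quantity of interest appears.\<close>

lemma norm2_mat_sqrt_conj_bound:
  assumes A: "psd_mat n A" and S: "S \<in> carrier_mat n n" and x: "x \<in> carrier_vec n" and y: "y \<in> carrier_vec n"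
  shows "\<bar>(A *\<^sub>v x) \<bullet> (S *\<^sub>v (A *\<^sub>v y))\<bar>
    \<le> norm2_mat (mat_sqrt A * S * mat_sqrt A) * energy_vec A x * energy_vec A y"
proof -
  let ?R = "mat_sqrt A"
  have R: "sym_mat n ?R" "?R \<in> carrier_mat n n" using mat_sqrt[OF A] by (auto simp: psd_mat_def sym_mat_def)
  have RR: "A *\<^sub>v z = ?R *\<^sub>v (?R *\<^sub>v z)" if "z \<in> carrier_vec n" for z
    using mat_sqrt_square[OF A] R that by (metis assoc_mult_mat_vec)
  have "(A *\<^sub>v x) \<bullet> (S *\<^sub>v (A *\<^sub>v y)) = (?R *\<^sub>v x) \<bullet> ((?R * S * ?R) *\<^sub>v (?R *\<^sub>v y))"
    unfolding RR[OF x] RR[OF y] using R S x y by (subst sym_mat_scalar_prod[OF R(1)]) (auto simp: mat_mult_vec)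
  also have "\<bar>\<dots>\<bar> \<le> norm2_vec (?R *\<^sub>v x) * norm2_vec ((?R * S * ?R) *\<^sub>v (?R *\<^sub>v y))"
    unfolding norm2_vec_def using R S by (intro real_vec_Cauchy_Schwarz) simp
  also have "\<dots> \<le> norm2_vec (?R *\<^sub>v x) * (norm2_mat (?R * S * ?R) * norm2_vec (?R *\<^sub>v y))"
    using R S y by (intro mult_left_mono norm2_mat_vec_le norm2_vec_nonneg) simp
  finally show ?thesis using energy_vec_mat_sqrt[OF A] x y by (simp add: mult_ac)
qed

section \<open>Second-order calculus of random vectors\<close>

definition sq_integrable :: "'w measure \<Rightarrow> ('w \<Rightarrow> real) \<Rightarrow> bool" where
  "sq_integrable Q U \<longleftrightarrow> U \<in> borel_measurable Q \<and> integrable Q (\<lambda>w. (U w)\<^sup>2)"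

lemma sq_integrable_mult:
  assumes "sq_integrable Q U" "sq_integrable Q V"
  shows "integrable Q (\<lambda>w. U w * V w)"
proof (rule Bochner_Integration.integrable_bound)
  show "integrable Q (\<lambda>w. (U w)\<^sup>2 + (V w)\<^sup>2)" using assms by (auto simp: sq_integrable_def)
  show "(\<lambda>w. U w * V w) \<in> borel_measurable Q" using assms by (auto simp: sq_integrable_def)
  have "\<bar>x * y\<bar> \<le> x\<^sup>2 + y\<^sup>2" for x y :: real
  proof -
    have "2 * (\<bar>x\<bar> * \<bar>y\<bar>) \<le> \<bar>x\<bar>\<^sup>2 + \<bar>y\<bar>\<^sup>2"
      using sum_squares_bound[of "\<bar>x\<bar>" "\<bar>y\<bar>"] by (simp add: mult.assoc)
    moreover have "0 \<le> \<bar>x\<bar> * \<bar>y\<bar>" by simp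
    ultimately have "\<bar>x\<bar> * \<bar>y\<bar> \<le> x\<^sup>2 + y\<^sup>2" unfolding power2_abs by linarith
    then show ?thesis by (simp only: abs_mult)
  qed
  then show "AE w in Q. norm (U w * V w) \<le> norm ((U w)\<^sup>2 + (V w)\<^sup>2)"
    by (auto intro!: AE_I2)
qed

context prob_space
begin

lemma sq_integrable_const: "sq_integrable M (\<lambda>_. c)"
  by (simp add: sq_integrable_def)

lemma sq_integrable_integrable: "sq_integrable M U \<Longrightarrow> integrable M U"
  using sq_integrable_mult[of M U "\<lambda>_. 1"] sq_integrable_const[of 1] by simp

lemma sq_integrable_add:
  assumes "sq_integrable M U" "sq_integrable M V"
  shows "sq_integrable M (\<lambda>w. U w + V w)"
proof -
  have "(U w + V w)\<^sup>2 = (U w)\<^sup>2 + (V w)\<^sup>2 + 2 * (U w * V w)" for w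
    by (simp add: power2_eq_square algebra_simps)
  then show ?thesis using assms sq_integrable_mult[OF assms] by (auto simp: sq_integrable_def)
qed

lemma cov_eq:
  assumes "sq_integrable M U" "sq_integrable M V"
  shows "cov M U V = expectation (\<lambda>w. U w * V w) - expectation U * expectation V"
proof -
  note i = sq_integrable_mult[OF assms] sq_integrable_integrable[OF assms(1)] sq_integrable_integrable[OF assms(2)]
  have "cov M U V = expectation (\<lambda>w. U w * V w - expectation U * V w - expectation V * U w + expectation U * expectation V)"
    unfolding cov_def by (rule Bochner_Integration.integral_cong) (auto simp: algebra_simps)
  also have "\<dots> = expectation (\<lambda>w. U w * V w) - expectation U * expectation V"
    using i by (simp add: prob_space)
  finally show ?thesis .
qed

lemma cov_commute: "cov M U V = cov M V U"
  unfolding cov_def by (simp add: mult.commute)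

lemma cov_cong: "(\<And>w. w \<in> space M \<Longrightarrow> U w = U' w) \<Longrightarrow> (\<And>w. w \<in> space M \<Longrightarrow> V w = V' w) \<Longrightarrow> cov M U V = cov M U' V'"
proof -
  assume *: "\<And>w. w \<in> space M \<Longrightarrow> U w = U' w" "\<And>w. w \<in> space M \<Longrightarrow> V w = V' w"
  have "expectation U = expectation U'" "expectation V = expectation V'"
    using * by (auto intro!: Bochner_Integration.integral_cong)
  then show ?thesis unfolding cov_def using * by (intro Bochner_Integration.integral_cong) auto
qed

lemma cov_const: "cov M (\<lambda>_. c) V = 0"
  by (simp add: cov_def prob_space)

lemma cov_const_right: "cov M V (\<lambda>_. c) = 0"
  using cov_const cov_commute by metis

lemma cov_add_left:
  assumes "sq_integrable M U" "sq_integrable M V" "sq_integrable M T"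
  shows "cov M (\<lambda>w. U w + V w) T = cov M U T + cov M V T"
  using assms sq_integrable_add[OF assms(1,2)] sq_integrable_mult[OF assms(1,3)] sq_integrable_mult[OF assms(2,3)]
    sq_integrable_integrable[OF assms(1)] sq_integrable_integrable[OF assms(2)]
  by (simp add: cov_eq algebra_simps)

lemma cov_add_right:
  assumes "sq_integrable M U" "sq_integrable M V" "sq_integrable M T"
  shows "cov M T (\<lambda>w. U w + V w) = cov M T U + cov M T V"
  using cov_add_left[OF assms] by (simp add: cov_commute)

text \<open>A zero variance stands for a point mass, so then U equals its mean almost surely;
  otherwise the moments are read off the normal density.\<close>

lemma normal1_moments:
  assumes U: "U \<in> borel_measurable M" and D: "distr M borel U = normal1 \<mu> v" and "0 \<le> v"
  shows "sq_integrable M U" "cov M U U = v"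
proof -
  have "sq_integrable M U \<and> expectation U = \<mu> \<and> cov M U U = v"
  proof (cases "v = 0")
    case True
    then have D: "distr M borel U = return borel \<mu>" using D unfolding normal1_def by simp
    have "AE x in distr M borel U. x = \<mu>" unfolding D by (simp add: AE_return)
    then have ae: "AE w in M. U w = \<mu>" using U by (simp add: AE_distr_iff)
    have E: "expectation U = \<mu>" using integral_cong_AE[of U M "\<lambda>_. \<mu>"] U ae by (simp add: prob_space)
    have "integrable M (\<lambda>w. (U w)\<^sup>2) = integrable M (\<lambda>_. \<mu>\<^sup>2)"
      using U ae by (intro integrable_cong_AE) auto
    then have "sq_integrable M U" using U by (simp add: sq_integrable_def)
    moreover have "cov M U U = expectation (\<lambda>_. 0)" unfolding cov_def E
      using U ae by (intro integral_cong_AE) auto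
    ultimately show ?thesis using E True by simp
  next
    case False
    then have s: "0 < sqrt v" using \<open>0 \<le> v\<close> by simp
    have D: "distributed M lborel U (normal_density \<mu> (sqrt v))"
      using D False U by (auto simp: distributed_def normal1_def cong: distr_cong)
    have E: "expectation U = \<mu>" using normal_distributed_expectation[OF s D] .
    have V: "cov M U U = v" using normal_distributed_variance[OF s D] \<open>0 \<le> v\<close>
      by (simp add: cov_def power2_eq_square)
    have "integrable lborel (\<lambda>x. normal_density \<mu> (sqrt v) x * (x - \<mu>)\<^sup>2)"
      using integrable_normal_moment[OF s, of \<mu> 2] .
    moreover have "integrable lborel (\<lambda>x. 2 * \<mu> * (normal_density \<mu> (sqrt v) x * x))"
      using integrable_normal_moment_nz_1[OF s] by simp
    moreover have "integrable lborel (\<lambda>x. \<mu>\<^sup>2 * normal_density \<mu> (sqrt v) x)"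
      using integrable_normal_density[OF s] by simp
    \<comment> \<open>The raw second moment comes from the centred one through x^2 = (x - \<mu>)^2 +
      2 \<mu> x - \<mu>^2.\<close>
    ultimately have "integrable lborel (\<lambda>x. normal_density \<mu> (sqrt v) x * (x - \<mu>)\<^sup>2 +
       2 * \<mu> * (normal_density \<mu> (sqrt v) x * x) - \<mu>\<^sup>2 * normal_density \<mu> (sqrt v) x)" by simp
    then have "integrable lborel (\<lambda>x. normal_density \<mu> (sqrt v) x * x\<^sup>2)"
      by (simp add: power2_eq_square algebra_simps)
    then have "integrable M (\<lambda>w. (U w)\<^sup>2)"
      by (subst distributed_integrable[OF D, symmetric]) auto
    then show ?thesis using E V U by (simp add: sq_integrable_def)
  qed
  then show "sq_integrable M U" "cov M U U = v" by auto
qed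

end

section \<open>Normal random vectors and their linear functionals\<close>

lemma space_vec_borel: "space (vec_borel n) = carrier_vec n"
  by (simp add: vec_borel_def)

lemma measurable_scalar_prod_vec_borel:
  assumes "a \<in> carrier_vec n"
  shows "(\<lambda>v. a \<bullet> v) \<in> borel_measurable (vec_borel n)"
proof -
  have f: "(\<lambda>v. \<lambda>i\<in>{..<n}. v $ i) \<in> vec_borel n \<rightarrow>\<^sub>M Pi\<^sub>M {..<n} (\<lambda>_. borel :: real measure)"
    unfolding vec_borel_def by (rule measurable_vimage_algebra1) (simp add: space_PiM PiE_def)
  have "(\<lambda>v. (\<lambda>i\<in>{..<n}. v $ i) i) \<in> borel_measurable (vec_borel n)" if "i < n" for i
    using measurable_compose[OF f measurable_component_singleton[of i]] that by simp
  then have c: "(\<lambda>v. v $ i) \<in> borel_measurable (vec_borel n)" if "i < n" for i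
    using that by simp
  have "(\<lambda>v. \<Sum>i\<in>{0..<n}. a $ i * v $ i) \<in> borel_measurable (vec_borel n)"
    by (intro borel_measurable_sum borel_measurable_times borel_measurable_const c) auto
  then show ?thesis
    by (subst measurable_cong[where g = "\<lambda>v. \<Sum>i\<in>{0..<n}. a $ i * v $ i"])
      (auto simp: space_vec_borel scalar_prod_def)
qed

context prob_space
begin

lemma mv_normal_carrier: "mv_normal M n X \<mu> \<Sigma> \<Longrightarrow> w \<in> space M \<Longrightarrow> X w \<in> carrier_vec n"
  unfolding mv_normal_def using measurable_space[of X M "vec_borel n" w] by (auto simp: space_vec_borel)

lemma mv_normal_sq_integrable:
  assumes "mv_normal M n X \<mu> \<Sigma>" "a \<in> carrier_vec n"
  shows "sq_integrable M (\<lambda>w. a \<bullet> X w)" "cov M (\<lambda>w. a \<bullet> X w) (\<lambda>w. a \<bullet> X w) = a \<bullet> (\<Sigma> *\<^sub>v a)"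
proof -
  have "X \<in> M \<rightarrow>\<^sub>M vec_borel n" using assms(1) unfolding mv_normal_def by blast
  from measurable_compose[OF this measurable_scalar_prod_vec_borel[OF assms(2)]]
  have m: "(\<lambda>w. a \<bullet> X w) \<in> borel_measurable M" .
  have "distr M borel (\<lambda>w. a \<bullet> X w) = normal1 (a \<bullet> \<mu>) (a \<bullet> (\<Sigma> *\<^sub>v a))" "0 \<le> a \<bullet> (\<Sigma> *\<^sub>v a)"
    using assms unfolding mv_normal_def psd_mat_def by blast+
  from normal1_moments[OF m this]
  show "sq_integrable M (\<lambda>w. a \<bullet> X w)" "cov M (\<lambda>w. a \<bullet> X w) (\<lambda>w. a \<bullet> X w) = a \<bullet> (\<Sigma> *\<^sub>v a)" .
qed

text \<open>By polarization, from the variances of the one-dimensional marginals.\<close>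
lemma mv_normal_cov:
  assumes X: "mv_normal M n X \<mu> \<Sigma>" and a: "a \<in> carrier_vec n" and b: "b \<in> carrier_vec n"
  shows "cov M (\<lambda>w. a \<bullet> X w) (\<lambda>w. b \<bullet> X w) = a \<bullet> (\<Sigma> *\<^sub>v b)"
proof -
  let ?U = "\<lambda>w. a \<bullet> X w" and ?V = "\<lambda>w. b \<bullet> X w"
  have S: "sym_mat n \<Sigma>" "\<Sigma> \<in> carrier_mat n n" using X by (auto simp: mv_normal_def psd_mat_def sym_mat_def)
  note U = mv_normal_sq_integrable[OF X a] and V = mv_normal_sq_integrable[OF X b]
  have "cov M (\<lambda>w. (a + b) \<bullet> X w) (\<lambda>w. (a + b) \<bullet> X w) = (a + b) \<bullet> (\<Sigma> *\<^sub>v (a + b))"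
    using mv_normal_sq_integrable[OF X, of "a + b"] a b by simp
  also have "cov M (\<lambda>w. (a + b) \<bullet> X w) (\<lambda>w. (a + b) \<bullet> X w) = cov M (\<lambda>w. ?U w + ?V w) (\<lambda>w. ?U w + ?V w)"
    using a b mv_normal_carrier[OF X] by (intro cov_cong add_scalar_prod_distrib[of _ n]) auto
  also have "\<dots> = cov M ?U ?U + 2 * cov M ?U ?V + cov M ?V ?V"
    using U V sq_integrable_add[OF U(1) V(1)]
    by (simp add: cov_add_left cov_add_right cov_commute[of ?V ?U])
  also have "(a + b) \<bullet> (\<Sigma> *\<^sub>v (a + b)) = a \<bullet> (\<Sigma> *\<^sub>v a) + 2 * (a \<bullet> (\<Sigma> *\<^sub>v b)) + b \<bullet> (\<Sigma> *\<^sub>v b)"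
  proof -
    have "b \<bullet> (\<Sigma> *\<^sub>v a) = a \<bullet> (\<Sigma> *\<^sub>v b)"
      using sym_mat_scalar_prod[OF S(1) b a] comm_scalar_prod[of "\<Sigma> *\<^sub>v b" n a] S a b by simp
    then show ?thesis using S a b by (simp add: scalar_prod_add_left scalar_prod_add_right mat_vec_add)
  qed
  finally show ?thesis using U V by simp
qed

text \<open>Links the two descriptions of the initial state: the norm hypothesis speaks of the
  entrywise covariance matrix, while the chain is analysed with the parameter \<Sigma> of the normal
  law.\<close>

lemma mv_normal_cov_mat:
  assumes X: "mv_normal M n X \<mu> \<Sigma>"
  shows "cov_mat M n X = \<Sigma>"
proof (rule eq_matI)
  have S: "\<Sigma> \<in> carrier_mat n n" using X by (auto simp: mv_normal_def psd_mat_def sym_mat_def)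
  show "dim_row (cov_mat M n X) = dim_row \<Sigma>" "dim_col (cov_mat M n X) = dim_col \<Sigma>" using S by (auto simp: cov_mat_def)
  fix i j assume "i < dim_row \<Sigma>" "j < dim_col \<Sigma>"
  then have ij: "i < n" "j < n" using S by auto
  have "cov M (\<lambda>w. X w $ i) (\<lambda>w. X w $ j) = cov M (\<lambda>w. unit_vec n i \<bullet> X w) (\<lambda>w. unit_vec n j \<bullet> X w)"
    using ij mv_normal_carrier[OF X] by (intro cov_cong) (auto simp: scalar_prod_left_unit)
  also have "\<dots> = unit_vec n i \<bullet> (\<Sigma> *\<^sub>v unit_vec n j)" using mv_normal_cov[OF X] by simp
  also have "\<dots> = \<Sigma> $$ (i, j)" using ij S by (simp add: scalar_prod_left_unit scalar_prod_right_unit)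
  finally show "cov_mat M n X $$ (i, j) = \<Sigma> $$ (i, j)" using ij by (simp add: cov_mat_def)
qed

end

text \<open>The second-order content of jointly independent normal draws. Covariances are taken
  between linear functionals, so draws of different dimensions can be treated uniformly.\<close>

locale uncorrelated_vectors = prob_space M for M :: "'w measure" +
  fixes W :: "'d \<Rightarrow> 'w \<Rightarrow> real Matrix.vec" and dim :: "'d \<Rightarrow> nat" and I :: "'d set"
  assumes W_carrier: "d \<in> I \<Longrightarrow> w \<in> space M \<Longrightarrow> W d w \<in> carrier_vec (dim d)"
    and W_sq_integrable: "d \<in> I \<Longrightarrow> a \<in> carrier_vec (dim d) \<Longrightarrow> sq_integrable M (\<lambda>w. a \<bullet> W d w)"
    and W_uncorrelated: "d \<in> I \<Longrightarrow> e \<in> I \<Longrightarrow> d \<noteq> e \<Longrightarrow> a \<in> carrier_vec (dim d) \<Longrightarrow> b \<in> carrier_vec (dim e) \<Longrightarrow>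
          cov M (\<lambda>w. a \<bullet> W d w) (\<lambda>w. b \<bullet> W e w) = 0"
begin

text \<open>Records which draws a random variable may depend on, in a form suited to rule induction
  with bilinearity of the covariance. The rule \<open>congr\<close> admits identities that hold only
  on the sample space, where the draws are known to have the right dimension.\<close>

inductive affine_in :: "'d set \<Rightarrow> ('w \<Rightarrow> real) \<Rightarrow> bool" for D where
  const: "affine_in D (\<lambda>_. c)"
| vector: "d \<in> D \<Longrightarrow> d \<in> I \<Longrightarrow> a \<in> carrier_vec (dim d) \<Longrightarrow> affine_in D (\<lambda>w. a \<bullet> W d w)"
| add: "affine_in D U \<Longrightarrow> affine_in D V \<Longrightarrow> affine_in D (\<lambda>w. U w + V w)"
| congr: "affine_in D U \<Longrightarrow> (\<And>w. w \<in> space M \<Longrightarrow> V w = U w) \<Longrightarrow> affine_in D V"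

lemma sq_integrable_cong_space:
  assumes "sq_integrable M U" "\<And>w. w \<in> space M \<Longrightarrow> V w = U w"
  shows "sq_integrable M V"
proof -
  have "V \<in> borel_measurable M \<longleftrightarrow> U \<in> borel_measurable M" using assms(2) by (intro measurable_cong) auto
  moreover have "integrable M (\<lambda>w. (V w)\<^sup>2) \<longleftrightarrow> integrable M (\<lambda>w. (U w)\<^sup>2)"
    using assms(2) by (intro Bochner_Integration.integrable_cong) auto
  ultimately show ?thesis using assms(1) by (simp add: sq_integrable_def)
qed

lemma affine_in_sq_integrable: "affine_in D U \<Longrightarrow> sq_integrable M U"
proof (induction rule: affine_in.induct)
  case (congr U V)
  then show ?case using sq_integrable_cong_space by blast
qed (auto intro: sq_integrable_const W_sq_integrable sq_integrable_add)

lemma affine_in_mono: "affine_in D U \<Longrightarrow> D \<subseteq> D' \<Longrightarrow> affine_in D' U"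
  by (induction rule: affine_in.induct) (auto intro: affine_in.intros)

text \<open>Bilinearity, by one induction for each argument, reduces the covariance to pairs of
  draws with different indices and to constants; all of these contribute zero.\<close>

lemma affine_in_uncorrelated:
  assumes "affine_in D U" "affine_in E V" "D \<inter> E = {}"
  shows "cov M U V = 0"
proof -
  have *: "cov M (\<lambda>w. a \<bullet> W d w) V = 0" if "affine_in E V" "d \<in> D" "d \<in> I" "a \<in> carrier_vec (dim d)" for d a V
    using that(1)
  proof (induction rule: affine_in.induct)
    case (const c)
    then show ?case using cov_const cov_commute by metis
  next
    case (vector e b)
    then show ?case using that assms(3) by (intro W_uncorrelated) auto
  next
    case (add U V)
    then show ?case using affine_in_sq_integrable W_sq_integrable that by (simp add: cov_add_right)
  next
    case (congr U V)
    then show ?case using cov_cong[of "\<lambda>w. a \<bullet> W d w" "\<lambda>w. a \<bullet> W d w" V U] by simp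
  qed
  show ?thesis using assms(1)
  proof (induction rule: affine_in.induct)
    case (const c)
    then show ?case by (rule cov_const)
  next
    case (vector d a)
    then show ?case using * assms by blast
  next
    case (add U1 U2)
    then show ?case using affine_in_sq_integrable assms(2) by (simp add: cov_add_left)
  next
    case (congr U U')
    then show ?case using cov_cong[of U' U V V] by simp
  qed
qed

text \<open>Affinity is tested by functionals: a matrix then acts through its transpose on the
  functional, and no coefficient matrices of the individual draws have to be tracked.\<close>

definition affine_vec_in :: "'d set \<Rightarrow> nat \<Rightarrow> ('w \<Rightarrow> real Matrix.vec) \<Rightarrow> bool" where
  "affine_vec_in D n Z \<longleftrightarrow> (\<forall>w\<in>space M. Z w \<in> carrier_vec n) \<and> (\<forall>a\<in>carrier_vec n. affine_in D (\<lambda>w. a \<bullet> Z w))"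

lemma affine_vec_in_const: "c \<in> carrier_vec n \<Longrightarrow> affine_vec_in D n (\<lambda>_. c)"
  by (auto simp: affine_vec_in_def intro: affine_in.intros)

lemma affine_vec_in_vector: "d \<in> D \<Longrightarrow> d \<in> I \<Longrightarrow> affine_vec_in D (dim d) (W d)"
  by (auto simp: affine_vec_in_def intro: affine_in.intros W_carrier)

lemma affine_vec_in_mono: "affine_vec_in D n Z \<Longrightarrow> D \<subseteq> D' \<Longrightarrow> affine_vec_in D' n Z"
  by (auto simp: affine_vec_in_def intro: affine_in_mono)

lemma affine_vec_in_cong:
  "affine_vec_in D n Z \<Longrightarrow> (\<And>w. w \<in> space M \<Longrightarrow> Z' w = Z w) \<Longrightarrow> affine_vec_in D n Z'"
  unfolding affine_vec_in_def by (auto intro: affine_in.congr)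

lemma affine_vec_in_add:
  assumes "affine_vec_in D n Z" "affine_vec_in D n Z'"
  shows "affine_vec_in D n (\<lambda>w. Z w + Z' w)"
proof -
  have "affine_in D (\<lambda>w. a \<bullet> (Z w + Z' w))" if "a \<in> carrier_vec n" for a
  proof (rule affine_in.congr)
    show "affine_in D (\<lambda>w. a \<bullet> Z w + a \<bullet> Z' w)" using assms that by (intro affine_in.add) (auto simp: affine_vec_in_def)
    show "a \<bullet> (Z w + Z' w) = a \<bullet> Z w + a \<bullet> Z' w" if w: "w \<in> space M" for w
      using assms w \<open>a \<in> carrier_vec n\<close> by (auto simp: affine_vec_in_def scalar_prod_add_distrib[of _ n])
  qed
  then show ?thesis using assms by (auto simp: affine_vec_in_def)
qed

lemma affine_vec_in_mat:
  assumes "affine_vec_in D n Z" "B \<in> carrier_mat m n"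
  shows "affine_vec_in D m (\<lambda>w. B *\<^sub>v Z w)"
proof -
  have "affine_in D (\<lambda>w. a \<bullet> (B *\<^sub>v Z w))" if "a \<in> carrier_vec m" for a
  proof (rule affine_in.congr)
    show "affine_in D (\<lambda>w. (transpose_mat B *\<^sub>v a) \<bullet> Z w)" using assms that by (auto simp: affine_vec_in_def)
    show "a \<bullet> (B *\<^sub>v Z w) = (transpose_mat B *\<^sub>v a) \<bullet> Z w" if w: "w \<in> space M" for w
      using assms w \<open>a \<in> carrier_vec m\<close> by (intro scalar_prod_mat_transpose) (auto simp: affine_vec_in_def)
  qed
  then show ?thesis using assms by (auto simp: affine_vec_in_def)
qed

end

section \<open>The multigrid iteration matrix\<close>

lemma pow_mat_Suc_left:
  assumes "(X :: real mat) \<in> carrier_mat n n"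
  shows "X ^\<^sub>m Suc k = X * X ^\<^sub>m k"
proof (induction k)
  case (Suc k)
  have "X ^\<^sub>m Suc (Suc k) = (X * X ^\<^sub>m k) * X" using Suc by simp
  also have "\<dots> = X * (X ^\<^sub>m k * X)" using assms by (intro assoc_mult_mat[of _ n n _ n _ n]) auto
  finally show ?case by simp
qed (use assms in simp)

lemma pow_mat_vec_Suc:
  assumes "(X :: real mat) \<in> carrier_mat n n" "v \<in> carrier_vec n"
  shows pow_mat_vec_Suc_left: "X ^\<^sub>m Suc k *\<^sub>v v = X *\<^sub>v (X ^\<^sub>m k *\<^sub>v v)"
    and pow_mat_vec_Suc_right: "X ^\<^sub>m Suc k *\<^sub>v v = X ^\<^sub>m k *\<^sub>v (X *\<^sub>v v)"
proof -
  show "X ^\<^sub>m Suc k *\<^sub>v v = X *\<^sub>v (X ^\<^sub>m k *\<^sub>v v)"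
    unfolding pow_mat_Suc_left[OF assms(1)] using assms by (intro assoc_mult_mat_vec[of _ n n _ n]) auto
  show "X ^\<^sub>m Suc k *\<^sub>v v = X ^\<^sub>m k *\<^sub>v (X *\<^sub>v v)"
    unfolding pow_mat.simps using assms by (intro assoc_mult_mat_vec[of _ n n _ n]) auto
qed

definition self_adjoint :: "nat \<Rightarrow> real mat \<Rightarrow> real mat \<Rightarrow> bool" where
  "self_adjoint n A X \<longleftrightarrow> (\<forall>u\<in>carrier_vec n. \<forall>v\<in>carrier_vec n. (X *\<^sub>v u) \<bullet> (A *\<^sub>v v) = u \<bullet> (A *\<^sub>v (X *\<^sub>v v)))"

text \<open>Stated with squared energies, as is the strict version below, so that the recursion over
  levels involves quadratic forms and no roots.\<close>

definition nonexpansive :: "nat \<Rightarrow> real mat \<Rightarrow> real mat \<Rightarrow> bool" where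
  "nonexpansive n A X \<longleftrightarrow> (\<forall>v\<in>carrier_vec n. (X *\<^sub>v v) \<bullet> (A *\<^sub>v (X *\<^sub>v v)) \<le> v \<bullet> (A *\<^sub>v v))"

definition contractive :: "nat \<Rightarrow> real mat \<Rightarrow> real mat \<Rightarrow> bool" where
  "contractive n A X \<longleftrightarrow>
     (\<forall>v\<in>carrier_vec n. v \<noteq> 0\<^sub>v n \<longrightarrow> (X *\<^sub>v v) \<bullet> (A *\<^sub>v (X *\<^sub>v v)) < v \<bullet> (A *\<^sub>v v))"

lemma contractive_imp_nonexpansive:
  assumes "A \<in> carrier_mat n n" "X \<in> carrier_mat n n" "contractive n A X"
  shows "nonexpansive n A X"
  unfolding nonexpansive_def
proof
  fix v :: "real Matrix.vec" assume v: "v \<in> carrier_vec n"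
  show "(X *\<^sub>v v) \<bullet> (A *\<^sub>v (X *\<^sub>v v)) \<le> v \<bullet> (A *\<^sub>v v)"
  proof (cases "v = 0\<^sub>v n")
    case True
    then show ?thesis using assms by (simp add: mat_vec_zero[of _ n n])
  next
    case False
    then show ?thesis using assms(3) v unfolding contractive_def by (meson less_imp_le)
  qed
qed

lemma self_adjoint_pow:
  assumes "A \<in> carrier_mat n n" "X \<in> carrier_mat n n" "self_adjoint n A X"
  shows "self_adjoint n A (X ^\<^sub>m k)"
proof (induction k)
  case 0
  then show ?case using assms by (simp add: self_adjoint_def)
next
  case (Suc k)
  show ?case unfolding self_adjoint_def
  proof (intro ballI)
    fix u v :: "real Matrix.vec" assume uv: "u \<in> carrier_vec n" "v \<in> carrier_vec n"
    have c: "X ^\<^sub>m k *\<^sub>v (X *\<^sub>v u) \<in> carrier_vec n" "X *\<^sub>v u \<in> carrier_vec n" "X ^\<^sub>m k *\<^sub>v v \<in> carrier_vec n"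
      using uv assms by (auto intro: mult_mat_vec_carrier[of _ n n])
    have "(X ^\<^sub>m Suc k *\<^sub>v u) \<bullet> (A *\<^sub>v v) = (X *\<^sub>v u) \<bullet> (A *\<^sub>v (X ^\<^sub>m k *\<^sub>v v))"
      unfolding pow_mat_vec_Suc_right[OF assms(2) uv(1)] using Suc c uv by (simp add: self_adjoint_def)
    also have "\<dots> = u \<bullet> (A *\<^sub>v (X *\<^sub>v (X ^\<^sub>m k *\<^sub>v v)))" using assms(3) c uv by (simp add: self_adjoint_def)
    finally show "(X ^\<^sub>m Suc k *\<^sub>v u) \<bullet> (A *\<^sub>v v) = u \<bullet> (A *\<^sub>v (X ^\<^sub>m Suc k *\<^sub>v v))"
      unfolding pow_mat_vec_Suc_left[OF assms(2) uv(2)] .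
  qed
qed

lemma nonexpansive_pow:
  assumes "A \<in> carrier_mat n n" "X \<in> carrier_mat n n" "nonexpansive n A X"
  shows "nonexpansive n A (X ^\<^sub>m k)"
proof (induction k)
  case 0
  then show ?case using assms by (simp add: nonexpansive_def)
next
  case (Suc k)
  show ?case unfolding nonexpansive_def
  proof
    fix v :: "real Matrix.vec" assume v: "v \<in> carrier_vec n"
    have c: "X ^\<^sub>m k *\<^sub>v v \<in> carrier_vec n" using v assms by (auto intro: mult_mat_vec_carrier[of _ n n])
    show "(X ^\<^sub>m Suc k *\<^sub>v v) \<bullet> (A *\<^sub>v (X ^\<^sub>m Suc k *\<^sub>v v)) \<le> v \<bullet> (A *\<^sub>v v)"
      unfolding pow_mat_vec_Suc_left[OF assms(2) v] using Suc assms(3) c v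
      unfolding nonexpansive_def by (meson order_trans)
  qed
qed

lemma contractive_pow_Suc:
  assumes "A \<in> carrier_mat n n" "X \<in> carrier_mat n n" "contractive n A X"
  shows "contractive n A (X ^\<^sub>m Suc k)"
  unfolding contractive_def
proof (intro ballI impI)
  fix v :: "real Matrix.vec" assume v: "v \<in> carrier_vec n" "v \<noteq> 0\<^sub>v n"
  have c: "X *\<^sub>v v \<in> carrier_vec n" using v assms by (auto intro: mult_mat_vec_carrier[of _ n n])
  have "nonexpansive n A (X ^\<^sub>m k)" using nonexpansive_pow contractive_imp_nonexpansive assms by blast
  then have "(X ^\<^sub>m k *\<^sub>v (X *\<^sub>v v)) \<bullet> (A *\<^sub>v (X ^\<^sub>m k *\<^sub>v (X *\<^sub>v v))) \<le> (X *\<^sub>v v) \<bullet> (A *\<^sub>v (X *\<^sub>v v))"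
    using c by (simp add: nonexpansive_def)
  also have "\<dots> < v \<bullet> (A *\<^sub>v v)" using assms(3) v by (simp add: contractive_def)
  finally show "(X ^\<^sub>m Suc k *\<^sub>v v) \<bullet> (A *\<^sub>v (X ^\<^sub>m Suc k *\<^sub>v v)) < v \<bullet> (A *\<^sub>v v)"
    unfolding pow_mat_vec_Suc_right[OF assms(2) v(1)] .
qed

section \<open>A single level: the smoother as an affine iteration\<close>

locale smoother =
  fixes n :: nat and A M :: "real mat"
  assumes spd: "spd_mat n A" and M_sym: "sym_mat n M" and M_det: "det M \<noteq> 0"
begin

abbreviation "S \<equiv> smoother_mat A M"

lemma A_carrier [simp]: "A \<in> carrier_mat n n" and A_sym: "sym_mat n A" and A_det: "det A \<noteq> 0"
  and M_carrier [simp]: "M \<in> carrier_mat n n"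
  using spd_mat_carrier[OF spd] spd_mat_sym[OF spd] spd_mat_det[OF spd] M_sym by (auto simp: sym_mat_def)

lemma Ai_carrier [simp]: "mat_inv A \<in> carrier_mat n n" and Mi_carrier [simp]: "mat_inv M \<in> carrier_mat n n"
  using mat_inv_carrier A_det M_det A_carrier M_carrier by blast+

lemma S_carrier [simp]: "S \<in> carrier_mat n n"
  unfolding smoother_mat_def by (intro carrier_matI) (use carrier_matD[OF A_carrier] carrier_matD[OF Mi_carrier] in auto)

lemma dims [simp]: "dim_row A = n" "dim_col A = n" "dim_row M = n" "dim_col M = n"
  "dim_row (mat_inv A) = n" "dim_col (mat_inv A) = n" "dim_row (mat_inv M) = n" "dim_col (mat_inv M) = n"
  "dim_row S = n" "dim_col S = n"
  using A_carrier M_carrier Ai_carrier Mi_carrier S_carrier unfolding carrier_mat_def by simp_all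

lemma S_vec: "v \<in> carrier_vec n \<Longrightarrow> S *\<^sub>v v = v - mat_inv M *\<^sub>v (A *\<^sub>v v)"
  unfolding smoother_mat_def by (simp add: mat_minus_vec mat_mult_vec)

text \<open>The product A S = A - A M^{-1} A is symmetric because A and M are.\<close>

lemma self_adjoint_S: "self_adjoint n A S"
  unfolding self_adjoint_def
proof (intro ballI)
  fix u v :: "real Matrix.vec" assume uv: "u \<in> carrier_vec n" "v \<in> carrier_vec n"
  let ?N = "mat_inv M"
  have c: "A *\<^sub>v u \<in> carrier_vec n" "A *\<^sub>v v \<in> carrier_vec n" "?N *\<^sub>v (A *\<^sub>v u) \<in> carrier_vec n" "?N *\<^sub>v (A *\<^sub>v v) \<in> carrier_vec n"
    using uv by (auto intro!: mult_mat_vec_carrier[of _ n n])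
  have "(?N *\<^sub>v (A *\<^sub>v u)) \<bullet> (A *\<^sub>v v) = (A *\<^sub>v u) \<bullet> (?N *\<^sub>v (A *\<^sub>v v))"
    using sym_mat_scalar_prod[OF mat_inv_sym[OF M_sym M_det] c(1,2)] .
  also have "\<dots> = u \<bullet> (A *\<^sub>v (?N *\<^sub>v (A *\<^sub>v v)))" using sym_mat_scalar_prod[OF A_sym uv(1) c(4)] .
  finally show "(S *\<^sub>v u) \<bullet> (A *\<^sub>v v) = u \<bullet> (A *\<^sub>v (S *\<^sub>v v))"
    using uv by (simp add: S_vec mat_vec_minus scalar_prod_minus_left scalar_prod_minus_right)
qed

text \<open>With p = M^{-1} A v the energy lost is 2 (p . A v) - p . A p. From
  \<open>A \<le> M\<close> and M p = A v one gets p . A p \<le> p . A v, so the loss is at least p .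
  A p, which is positive for v nonzero.\<close>

lemma contractive_S:
  assumes le: "loewner_le n A M"
  shows "contractive n A S"
  unfolding contractive_def
proof (intro ballI impI)
  fix v :: "real Matrix.vec" assume v: "v \<in> carrier_vec n" "v \<noteq> 0\<^sub>v n"
  define p where "p = mat_inv M *\<^sub>v (A *\<^sub>v v)"
  have Av: "A *\<^sub>v v \<in> carrier_vec n" using v by (auto intro!: mult_mat_vec_carrier[of _ n n])
  have p: "p \<in> carrier_vec n" unfolding p_def using Av by (auto intro!: mult_mat_vec_carrier[of _ n n])
  have Mp: "M *\<^sub>v p = A *\<^sub>v v" unfolding p_def using mat_inv_vec_right[OF M_carrier M_det Av] .
  have "p \<noteq> 0\<^sub>v n"
  proof
    assume "p = 0\<^sub>v n"
    then have "A *\<^sub>v v = 0\<^sub>v n" using Mp mat_vec_zero[OF M_carrier] by metis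
    then have "v \<bullet> (A *\<^sub>v v) = 0" using v by simp
    then show False using spd_mat_pos[OF spd v] by simp
  qed
  then have pos: "0 < p \<bullet> (A *\<^sub>v p)" using spd_mat_pos[OF spd p] by simp
  have "0 \<le> p \<bullet> ((M - A) *\<^sub>v p)" using le p by (simp add: loewner_le_def psd_mat_def)
  then have le: "p \<bullet> (A *\<^sub>v p) \<le> p \<bullet> (A *\<^sub>v v)" using p Mp by (simp add: mat_minus_vec scalar_prod_minus_right)
  have vAp: "v \<bullet> (A *\<^sub>v p) = p \<bullet> (A *\<^sub>v v)"
    using sym_mat_scalar_prod[OF A_sym v(1) p] comm_scalar_prod[OF Av p] by simp
  have Sv: "S *\<^sub>v v = v - p" using S_vec[OF v(1)] by (simp add: p_def)
  have "(S *\<^sub>v v) \<bullet> (A *\<^sub>v (S *\<^sub>v v)) = v \<bullet> (A *\<^sub>v v) - 2 * (p \<bullet> (A *\<^sub>v v)) + p \<bullet> (A *\<^sub>v p)"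
    unfolding Sv using v p by (simp add: mat_vec_minus scalar_prod_minus_left scalar_prod_minus_right vAp)
  then show "(S *\<^sub>v v) \<bullet> (A *\<^sub>v (S *\<^sub>v v)) < v \<bullet> (A *\<^sub>v v)" using le pos by linarith
qed

text \<open>Without noise A^{-1} f is a fixed point, so the deviation from it is multiplied by S and
  the noise enters through M^{-1}.\<close>

lemma random_smoother_eq:
  assumes f: "f \<in> carrier_vec n" and x: "\<xi> \<in> carrier_vec n" and t: "\<theta> \<in> carrier_vec n"
  shows "random_smoother A M f \<xi> \<theta>
    = mat_inv A *\<^sub>v f + S *\<^sub>v (\<theta> - mat_inv A *\<^sub>v f) + mat_inv M *\<^sub>v \<xi>"
proof -
  define u where "u = mat_inv A *\<^sub>v f"
  have u: "u \<in> carrier_vec n" unfolding u_def using f by (auto intro!: mult_mat_vec_carrier[of _ n n])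
  have f': "f = A *\<^sub>v u" unfolding u_def using mat_inv_vec_right[OF A_carrier A_det f] by simp
  let ?N = "mat_inv M"
  have c: "?N *\<^sub>v \<xi> \<in> carrier_vec n" "?N *\<^sub>v (A *\<^sub>v u) \<in> carrier_vec n" "?N *\<^sub>v (A *\<^sub>v \<theta>) \<in> carrier_vec n"
    using u x t by (auto intro!: mult_mat_vec_carrier[of _ n n])
  have "S *\<^sub>v (\<theta> - u) = (\<theta> - u) - (?N *\<^sub>v (A *\<^sub>v \<theta>) - ?N *\<^sub>v (A *\<^sub>v u))"
    using u t by (subst S_vec) (auto simp: mat_vec_minus)
  moreover have "random_smoother A M f \<xi> \<theta> = \<theta> + (?N *\<^sub>v (A *\<^sub>v u) + ?N *\<^sub>v \<xi> - ?N *\<^sub>v (A *\<^sub>v \<theta>))"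
    unfolding random_smoother_def f' using u x t by (simp add: mat_vec_minus mat_vec_add)
  ultimately show ?thesis unfolding u_def[symmetric] using u t c
    by (intro eq_vecI) (simp_all del: index_mult_mat_vec)
qed

lemma smooth_iter_carrier:
  assumes "f \<in> carrier_vec n" "\<theta> \<in> carrier_vec n" "\<And>j. j < k \<Longrightarrow> \<xi> j \<in> carrier_vec n"
  shows "smooth_iter A M f \<xi> k \<theta> \<in> carrier_vec n"
  using assms(3)
proof (induction k)
  case (Suc k)
  then show ?case using assms(1) unfolding smooth_iter.simps random_smoother_def
    by (intro add_carrier_vec mult_mat_vec_carrier[of _ n n] minus_carrier_vec) auto
qed (use assms in simp)

text \<open>Running the smoother with zero right-hand side and zero start isolates the accumulated
  noise. Since the fixed point is then zero, this noise follows a linear recursion.\<close>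

lemma smooth_iter_0_Suc:
  assumes "\<And>j. j < Suc k \<Longrightarrow> \<xi> j \<in> carrier_vec n"
  shows "smooth_iter A M (0\<^sub>v n) \<xi> (Suc k) (0\<^sub>v n) = S *\<^sub>v smooth_iter A M (0\<^sub>v n) \<xi> k (0\<^sub>v n) + mat_inv M *\<^sub>v \<xi> k"
proof -
  have c: "smooth_iter A M (0\<^sub>v n) \<xi> k (0\<^sub>v n) \<in> carrier_vec n" using assms by (intro smooth_iter_carrier) auto
  then have "S *\<^sub>v smooth_iter A M (0\<^sub>v n) \<xi> k (0\<^sub>v n) \<in> carrier_vec n" by (auto intro!: mult_mat_vec_carrier[of _ n n])
  then show ?thesis using assms[of k] c
    by (simp add: random_smoother_eq mat_vec_zero[OF Ai_carrier])
qed

lemma smooth_iter_eq: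
  assumes f: "f \<in> carrier_vec n" and t: "\<theta> \<in> carrier_vec n" and x: "\<And>j. j < k \<Longrightarrow> \<xi> j \<in> carrier_vec n"
  shows "smooth_iter A M f \<xi> k \<theta>
    = mat_inv A *\<^sub>v f + S ^\<^sub>m k *\<^sub>v (\<theta> - mat_inv A *\<^sub>v f) + smooth_iter A M (0\<^sub>v n) \<xi> k (0\<^sub>v n)"
proof -
  define u where "u = mat_inv A *\<^sub>v f"
  have u: "u \<in> carrier_vec n" unfolding u_def using f by (auto intro!: mult_mat_vec_carrier[of _ n n])
  show ?thesis unfolding u_def[symmetric] using x
  proof (induction k)
    case 0
    then show ?case using t u by (auto intro!: eq_vecI)
  next
    case (Suc k)
    let ?E = "smooth_iter A M (0\<^sub>v n) \<xi> k (0\<^sub>v n)" and ?d = "S ^\<^sub>m k *\<^sub>v (\<theta> - u)"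
    have E: "?E \<in> carrier_vec n" using Suc.prems by (intro smooth_iter_carrier) auto
    have d: "?d \<in> carrier_vec n" using t u by (auto intro!: mult_mat_vec_carrier[of _ n n])
    have x: "\<xi> k \<in> carrier_vec n" using Suc.prems by simp
    have c: "S *\<^sub>v ?d \<in> carrier_vec n" "S *\<^sub>v ?E \<in> carrier_vec n" "mat_inv M *\<^sub>v \<xi> k \<in> carrier_vec n"
      using E d x by (auto intro!: mult_mat_vec_carrier[of _ n n])
    have eq: "u + ?d + ?E - u = ?d + ?E" using u d E by (intro eq_vecI) (simp_all del: index_mult_mat_vec)
    have "smooth_iter A M f \<xi> (Suc k) \<theta> = random_smoother A M f (\<xi> k) (u + ?d + ?E)"
      using Suc by simp
    also have "\<dots> = u + S *\<^sub>v (?d + ?E) + mat_inv M *\<^sub>v \<xi> k"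
      using random_smoother_eq[OF f x, of "u + ?d + ?E"] u d E unfolding u_def[symmetric] eq by simp
    also have "S *\<^sub>v (?d + ?E) = S *\<^sub>v ?d + S *\<^sub>v ?E" using d E by (simp add: mat_vec_add)
    also have "u + (S *\<^sub>v ?d + S *\<^sub>v ?E) + mat_inv M *\<^sub>v \<xi> k = u + S *\<^sub>v ?d + (S *\<^sub>v ?E + mat_inv M *\<^sub>v \<xi> k)"
      using u c by (intro eq_vecI) (simp_all del: index_mult_mat_vec)
    also have "S *\<^sub>v ?d = S ^\<^sub>m Suc k *\<^sub>v (\<theta> - u)"
      using pow_mat_vec_Suc_left[OF S_carrier, of "\<theta> - u" k] t u by simp
    also have "S *\<^sub>v ?E + mat_inv M *\<^sub>v \<xi> k = smooth_iter A M (0\<^sub>v n) \<xi> (Suc k) (0\<^sub>v n)"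
      using smooth_iter_0_Suc[of k \<xi>] Suc.prems by simp
    finally show ?case .
  qed
qed

end

section \<open>The hierarchy and the energy behaviour of its iteration matrix\<close>

locale multigrid =
  fixes n :: "nat \<Rightarrow> nat" and A P M :: "nat \<Rightarrow> real mat" and \<nu>1 \<nu>2 :: nat
  assumes smoother: "smoother (n (Suc l)) (A (Suc l)) (M (Suc l))"
    and A_spd: "spd_mat (n l) (A l)"
    and P_carrier: "P (Suc l) \<in> carrier_mat (n (Suc l)) (n l)"
    and galerkin: "A l = transpose_mat (P (Suc l)) * A (Suc l) * P (Suc l)"
begin

abbreviation "X \<equiv> iteration_mat A P M \<nu>1 \<nu>2"
abbreviation "S l \<equiv> smoother_mat (A l) (M l)"
abbreviation "Ai l \<equiv> mat_inv (A l)"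

text \<open>The middle factor of the cycle, I - P (I - X) A_c^{-1} P^T A with A_c the coarse matrix:
  the error propagation of an inexact coarse correction.\<close>

definition B :: "nat \<Rightarrow> real mat" where
  "B l = 1\<^sub>m (dim_row (A (Suc l)))
       - P (Suc l) * Ai l * transpose_mat (P (Suc l)) * A (Suc l)
       + P (Suc l) * X l * Ai l * transpose_mat (P (Suc l)) * A (Suc l)"

lemma X_Suc: "X (Suc l) = S (Suc l) ^\<^sub>m \<nu>2 * B l * S (Suc l) ^\<^sub>m \<nu>1"
  by (simp add: B_def)

lemma A_carrier [simp]: "A l \<in> carrier_mat (n l) (n l)" and A_sym: "sym_mat (n l) (A l)" and A_det: "det (A l) \<noteq> 0"
  using spd_mat_carrier[OF A_spd] spd_mat_sym[OF A_spd] spd_mat_det[OF A_spd] by auto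

lemma Ai_carrier [simp]: "Ai l \<in> carrier_mat (n l) (n l)"
  using mat_inv_carrier[OF A_carrier A_det] .

lemma S_carrier [simp]: "S (Suc l) \<in> carrier_mat (n (Suc l)) (n (Suc l))"
  using smoother.S_carrier[OF smoother] .

lemma dims [simp]: "dim_row (A l) = n l" "dim_col (A l) = n l" "dim_row (Ai l) = n l" "dim_col (Ai l) = n l"
  "dim_row (P (Suc l)) = n (Suc l)" "dim_col (P (Suc l)) = n l" "dim_row (S (Suc l)) = n (Suc l)" "dim_col (S (Suc l)) = n (Suc l)"
  using A_carrier[of l] Ai_carrier[of l] P_carrier[of l] S_carrier[of l] unfolding carrier_mat_def by simp_all

lemma X_dims [simp]: "dim_row (X l) = n l" "dim_col (X l) = n l"
proof -
  have "dim_row (X l) = n l \<and> dim_col (X l) = n l"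
    by (cases l) auto
  then show "dim_row (X l) = n l" "dim_col (X l) = n l" by auto
qed

lemma X_carrier [simp]: "X l \<in> carrier_mat (n l) (n l)" and B_carrier [simp]: "B l \<in> carrier_mat (n (Suc l)) (n (Suc l))"
  by (intro carrier_matI; simp add: B_def)+

lemma X_0_vec: "v \<in> carrier_vec (n 0) \<Longrightarrow> X 0 *\<^sub>v v = 0\<^sub>v (n 0)"
  by (intro eq_vecI) auto

lemma vec_carriers:
  "v \<in> carrier_vec (n l) \<Longrightarrow> A l *\<^sub>v v \<in> carrier_vec (n l)"
  "v \<in> carrier_vec (n l) \<Longrightarrow> Ai l *\<^sub>v v \<in> carrier_vec (n l)"
  "v \<in> carrier_vec (n l) \<Longrightarrow> X l *\<^sub>v v \<in> carrier_vec (n l)"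
  "v \<in> carrier_vec (n l) \<Longrightarrow> transpose_mat (X l) *\<^sub>v v \<in> carrier_vec (n l)"
  "u \<in> carrier_vec (n (Suc l)) \<Longrightarrow> transpose_mat (P (Suc l)) *\<^sub>v u \<in> carrier_vec (n l)"
  "v \<in> carrier_vec (n l) \<Longrightarrow> P (Suc l) *\<^sub>v v \<in> carrier_vec (n (Suc l))"
  "u \<in> carrier_vec (n (Suc l)) \<Longrightarrow> S (Suc l) *\<^sub>v u \<in> carrier_vec (n (Suc l))"
  "u \<in> carrier_vec (n (Suc l)) \<Longrightarrow> S (Suc l) ^\<^sub>m k *\<^sub>v u \<in> carrier_vec (n (Suc l))"
  "u \<in> carrier_vec (n (Suc l)) \<Longrightarrow> B l *\<^sub>v u \<in> carrier_vec (n (Suc l))"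
  by (auto intro!: carrier_vecI simp: B_def)

text \<open>Coarse coordinates of the energy-orthogonal projection of v onto the range of the
  prolongation; by the Galerkin relation \<open>Ai l\<close> inverts the coarse Gram matrix.\<close>

definition coarse :: "nat \<Rightarrow> real Matrix.vec \<Rightarrow> real Matrix.vec" where
  "coarse l v = Ai l *\<^sub>v (transpose_mat (P (Suc l)) *\<^sub>v (A (Suc l) *\<^sub>v v))"

lemma coarse_carrier: "v \<in> carrier_vec (n (Suc l)) \<Longrightarrow> coarse l v \<in> carrier_vec (n l)"
  unfolding coarse_def by (intro vec_carriers)

lemma B_vec:
  "v \<in> carrier_vec (n (Suc l)) \<Longrightarrow> B l *\<^sub>v v = v - P (Suc l) *\<^sub>v coarse l v + P (Suc l) *\<^sub>v (X l *\<^sub>v coarse l v)"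
  unfolding B_def coarse_def by (simp add: mat_add_vec mat_minus_vec mat_mult_vec)

lemma galerkin_vec:
  "v \<in> carrier_vec (n l) \<Longrightarrow> transpose_mat (P (Suc l)) *\<^sub>v (A (Suc l) *\<^sub>v (P (Suc l) *\<^sub>v v)) = A l *\<^sub>v v"
  unfolding galerkin[of l] by (simp add: mat_mult_vec)

lemma restrict_eq:
  assumes "v \<in> carrier_vec (n (Suc l))"
  shows "transpose_mat (P (Suc l)) *\<^sub>v (A (Suc l) *\<^sub>v v) = A l *\<^sub>v coarse l v"
  unfolding coarse_def using assms
  by (subst mat_inv_vec_right[OF A_carrier A_det]) (auto intro!: vec_carriers)

text \<open>Restriction of A v is the coarse matrix applied to \<open>coarse l v\<close>. Hence
  \<open>coarse l\<close> is adjoint to the prolongation between the energy inner products of the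
  two levels.\<close>

lemma prolong_scalar_prod:
  assumes "w \<in> carrier_vec (n l)" "v \<in> carrier_vec (n (Suc l))"
  shows "(P (Suc l) *\<^sub>v w) \<bullet> (A (Suc l) *\<^sub>v v) = w \<bullet> (A l *\<^sub>v coarse l v)"
    and "v \<bullet> (A (Suc l) *\<^sub>v (P (Suc l) *\<^sub>v w)) = (coarse l v) \<bullet> (A l *\<^sub>v w)"
proof -
  have c: "A (Suc l) *\<^sub>v v \<in> carrier_vec (n (Suc l))" "P (Suc l) *\<^sub>v w \<in> carrier_vec (n (Suc l))"
    "coarse l v \<in> carrier_vec (n l)" "A l *\<^sub>v coarse l v \<in> carrier_vec (n l)"
    using assms by (auto intro!: vec_carriers coarse_carrier)
  have "(P (Suc l) *\<^sub>v w) \<bullet> (A (Suc l) *\<^sub>v v) = (A (Suc l) *\<^sub>v v) \<bullet> (P (Suc l) *\<^sub>v w)"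
    using c by (intro comm_scalar_prod[of _ "n (Suc l)"]) auto
  also have "\<dots> = (transpose_mat (P (Suc l)) *\<^sub>v (A (Suc l) *\<^sub>v v)) \<bullet> w"
    using scalar_prod_mat_transpose[OF P_carrier c(1) assms(1)] .
  also have "\<dots> = (A l *\<^sub>v coarse l v) \<bullet> w" using restrict_eq[OF assms(2)] by simp
  finally have *: "(P (Suc l) *\<^sub>v w) \<bullet> (A (Suc l) *\<^sub>v v) = (A l *\<^sub>v coarse l v) \<bullet> w" .
  then show "(P (Suc l) *\<^sub>v w) \<bullet> (A (Suc l) *\<^sub>v v) = w \<bullet> (A l *\<^sub>v coarse l v)"
    using comm_scalar_prod[OF c(4) assms(1)] by simp
  have "v \<bullet> (A (Suc l) *\<^sub>v (P (Suc l) *\<^sub>v w)) = (A (Suc l) *\<^sub>v v) \<bullet> (P (Suc l) *\<^sub>v w)"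
    using sym_mat_scalar_prod[OF A_sym assms(2) c(2)] by simp
  also have "\<dots> = (P (Suc l) *\<^sub>v w) \<bullet> (A (Suc l) *\<^sub>v v)"
    using c by (intro comm_scalar_prod[of _ "n (Suc l)"]) auto
  finally show "v \<bullet> (A (Suc l) *\<^sub>v (P (Suc l) *\<^sub>v w)) = (coarse l v) \<bullet> (A l *\<^sub>v w)"
    using * sym_mat_scalar_prod[OF A_sym c(3) assms(1)] by simp
qed

text \<open>In energy terms the correction is P (I - X) P*, where the adjoint P* is
  \<open>coarse l\<close>, so self-adjointness passes from the coarse X to B.\<close>

lemma self_adjoint_B:
  assumes "self_adjoint (n l) (A l) (X l)"
  shows "self_adjoint (n (Suc l)) (A (Suc l)) (B l)"
  unfolding self_adjoint_def
proof (intro ballI)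
  fix u v :: "real Matrix.vec" assume uv: "u \<in> carrier_vec (n (Suc l))" "v \<in> carrier_vec (n (Suc l))"
  note c = coarse_carrier[OF uv(1)] coarse_carrier[OF uv(2)]
  note cX = vec_carriers(3)[OF c(1)] vec_carriers(3)[OF c(2)]
  have "(X l *\<^sub>v coarse l u) \<bullet> (A l *\<^sub>v coarse l v) = coarse l u \<bullet> (A l *\<^sub>v (X l *\<^sub>v coarse l v))"
    using assms c by (simp add: self_adjoint_def)
  then show "(B l *\<^sub>v u) \<bullet> (A (Suc l) *\<^sub>v v) = u \<bullet> (A (Suc l) *\<^sub>v (B l *\<^sub>v v))"
    unfolding B_vec[OF uv(1)] B_vec[OF uv(2)] using uv
    by (simp add: mat_vec_minus mat_vec_add scalar_prod_minus_left scalar_prod_minus_right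
        scalar_prod_add_left scalar_prod_add_right prolong_scalar_prod c cX)
qed

text \<open>The coarse correction acts on the coarse component of the energy-orthogonal splitting only.\<close>
lemma nonexpansive_B:
  assumes "nonexpansive (n l) (A l) (X l)"
  shows "nonexpansive (n (Suc l)) (A (Suc l)) (B l)"
  unfolding nonexpansive_def
proof
  fix v :: "real Matrix.vec" assume v: "v \<in> carrier_vec (n (Suc l))"
  let ?w = "coarse l v" and ?P = "P (Suc l)" and ?A = "A (Suc l)"
  have w: "?w \<in> carrier_vec (n l)" using coarse_carrier[OF v] .
  define z where "z = ?w - X l *\<^sub>v ?w"
  have z: "z \<in> carrier_vec (n l)" unfolding z_def using w vec_carriers(3)[OF w] by simp
  have Pz: "?P *\<^sub>v z \<in> carrier_vec (n (Suc l))" using vec_carriers(6)[OF z] .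
  have Bv: "B l *\<^sub>v v = v - ?P *\<^sub>v z" unfolding B_vec[OF v] z_def using v w vec_carriers(3)[OF w]
    by (intro eq_vecI) (simp_all add: mat_vec_minus del: index_mult_mat_vec)
  have Xw: "X l *\<^sub>v ?w = ?w - z" unfolding z_def using w vec_carriers(3)[OF w]
    by (intro eq_vecI) (simp_all del: index_mult_mat_vec)
  have zz: "(?P *\<^sub>v z) \<bullet> (?A *\<^sub>v (?P *\<^sub>v z)) = z \<bullet> (A l *\<^sub>v z)"
    using prolong_scalar_prod(1)[OF z Pz] restrict_eq[OF Pz] galerkin_vec[OF z] by simp
  have sym: "?w \<bullet> (A l *\<^sub>v z) = z \<bullet> (A l *\<^sub>v ?w)"
    using sym_mat_scalar_prod[OF A_sym w z] comm_scalar_prod[OF vec_carriers(1)[OF w] z] by simp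
  \<comment> \<open>Replacing v by B v changes the fine energy by -2 (z . A_l w) + z . A_l z.
    Replacing w by X w changes the coarse energy by exactly the same amount, so the coarse
    hypothesis decides its sign.\<close>
  have "(B l *\<^sub>v v) \<bullet> (?A *\<^sub>v (B l *\<^sub>v v)) = v \<bullet> (?A *\<^sub>v v) - 2 * (z \<bullet> (A l *\<^sub>v ?w)) + z \<bullet> (A l *\<^sub>v z)"
  proof -
    have "(B l *\<^sub>v v) \<bullet> (?A *\<^sub>v (B l *\<^sub>v v)) = v \<bullet> (?A *\<^sub>v v) - v \<bullet> (?A *\<^sub>v (?P *\<^sub>v z))
        - ((?P *\<^sub>v z) \<bullet> (?A *\<^sub>v v) - (?P *\<^sub>v z) \<bullet> (?A *\<^sub>v (?P *\<^sub>v z)))"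
      unfolding Bv using v z Pz by (simp add: mat_vec_minus scalar_prod_minus_left scalar_prod_minus_right)
    then show ?thesis unfolding zz prolong_scalar_prod(1)[OF z v] prolong_scalar_prod(2)[OF z v] sym by simp
  qed
  also have "(X l *\<^sub>v ?w) \<bullet> (A l *\<^sub>v (X l *\<^sub>v ?w)) = ?w \<bullet> (A l *\<^sub>v ?w) - 2 * (z \<bullet> (A l *\<^sub>v ?w)) + z \<bullet> (A l *\<^sub>v z)"
    unfolding Xw using w z by (simp add: mat_vec_minus scalar_prod_minus_left scalar_prod_minus_right sym)
  then have "- 2 * (z \<bullet> (A l *\<^sub>v ?w)) + z \<bullet> (A l *\<^sub>v z) \<le> 0"
    using assms w unfolding nonexpansive_def by fastforce
  then have "v \<bullet> (?A *\<^sub>v v) - 2 * (z \<bullet> (A l *\<^sub>v ?w)) + z \<bullet> (A l *\<^sub>v z) \<le> v \<bullet> (?A *\<^sub>v v)" by simp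
  finally show "(B l *\<^sub>v v) \<bullet> (?A *\<^sub>v (B l *\<^sub>v v)) \<le> v \<bullet> (?A *\<^sub>v v)" .
qed

lemma X_Suc_vec:
  "v \<in> carrier_vec (n (Suc l)) \<Longrightarrow> X (Suc l) *\<^sub>v v = S (Suc l) ^\<^sub>m \<nu>2 *\<^sub>v (B l *\<^sub>v (S (Suc l) ^\<^sub>m \<nu>1 *\<^sub>v v))"
  unfolding X_Suc using carrier_matD[OF B_carrier[of l]]
  by (simp add: mat_mult_vec)

text \<open>Equal numbers of pre- and post-smoothing steps make the product S^k B S^k a palindrome
  of self-adjoint factors.\<close>

lemma self_adjoint_X:
  assumes "\<nu>1 = \<nu>2"
  shows "self_adjoint (n l) (A l) (X l)"
proof (induction l)
  case 0
  show ?case unfolding self_adjoint_def by (simp add: X_0_vec mat_vec_zero[OF A_carrier] vec_carriers(1)[of _ 0] del: iteration_mat.simps)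
next
  case (Suc l)
  have S: "self_adjoint (n (Suc l)) (A (Suc l)) (S (Suc l) ^\<^sub>m k)" for k
    using self_adjoint_pow[OF A_carrier S_carrier smoother.self_adjoint_S[OF smoother]] .
  note B = self_adjoint_B[OF Suc]
  show ?case unfolding self_adjoint_def
  proof (intro ballI)
    fix u v :: "real Matrix.vec" assume uv: "u \<in> carrier_vec (n (Suc l))" "v \<in> carrier_vec (n (Suc l))"
    let ?Sk = "S (Suc l) ^\<^sub>m \<nu>1"
    have eq: "S (Suc l) ^\<^sub>m \<nu>2 = ?Sk" using assms by simp
    have c: "?Sk *\<^sub>v v \<in> carrier_vec (n (Suc l))" "?Sk *\<^sub>v u \<in> carrier_vec (n (Suc l))"
      "B l *\<^sub>v (?Sk *\<^sub>v u) \<in> carrier_vec (n (Suc l))" "B l *\<^sub>v (?Sk *\<^sub>v v) \<in> carrier_vec (n (Suc l))"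
      using uv by (auto intro!: vec_carriers)
    show "(X (Suc l) *\<^sub>v u) \<bullet> (A (Suc l) *\<^sub>v v) = u \<bullet> (A (Suc l) *\<^sub>v (X (Suc l) *\<^sub>v v))"
      unfolding X_Suc_vec[OF uv(1)] X_Suc_vec[OF uv(2)] eq
      using S[of \<nu>1] B c uv unfolding self_adjoint_def by (simp del: iteration_mat.simps)
  qed
qed

text \<open>Pre-smoothing is strict as soon as there is one step, while B and post-smoothing do not
  increase the energy. The induction over levels carries nonexpansiveness only: B fixes every vector
  energy-orthogonal to the range of the prolongation, so strictness has to come from smoothing on
  the same level.\<close>

lemma X_nonexpansive:
  assumes le: "\<And>l. loewner_le (n (Suc l)) (A (Suc l)) (M (Suc l))"
  shows nonexpansive_X: "nonexpansive (n l) (A l) (X l)"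
    and contractive_X_Suc: "0 < \<nu>1 \<Longrightarrow> contractive (n (Suc l)) (A (Suc l)) (X (Suc l))"
proof -
  have S: "contractive (n (Suc l)) (A (Suc l)) (S (Suc l))" for l
    using smoother.contractive_S[OF smoother le] .
  have Sk: "nonexpansive (n (Suc l)) (A (Suc l)) (S (Suc l) ^\<^sub>m k)" for k l
    using nonexpansive_pow[OF A_carrier S_carrier contractive_imp_nonexpansive[OF A_carrier S_carrier S]] .
  have step: "(X (Suc l) *\<^sub>v v) \<bullet> (A (Suc l) *\<^sub>v (X (Suc l) *\<^sub>v v))
      \<le> (S (Suc l) ^\<^sub>m \<nu>1 *\<^sub>v v) \<bullet> (A (Suc l) *\<^sub>v (S (Suc l) ^\<^sub>m \<nu>1 *\<^sub>v v))"
    if "nonexpansive (n l) (A l) (X l)" and v: "v \<in> carrier_vec (n (Suc l))" for l v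
  proof -
    have "B l *\<^sub>v (S (Suc l) ^\<^sub>m \<nu>1 *\<^sub>v v) \<in> carrier_vec (n (Suc l))" "S (Suc l) ^\<^sub>m \<nu>1 *\<^sub>v v \<in> carrier_vec (n (Suc l))"
      using v by (auto intro!: vec_carriers)
    then show ?thesis unfolding X_Suc_vec[OF v]
      using Sk[of l \<nu>2] nonexpansive_B[OF that(1)] unfolding nonexpansive_def by (meson order_trans)
  qed
  show X: "nonexpansive (n l) (A l) (X l)" for l
  proof (induction l)
    case 0
    show ?case unfolding nonexpansive_def using spd_mat_nonneg[OF A_spd, of _ 0]
      by (simp add: X_0_vec mat_vec_zero[OF A_carrier] del: iteration_mat.simps)
  next
    case (Suc l)
    show ?case unfolding nonexpansive_def
    proof
      fix v :: "real Matrix.vec" assume v: "v \<in> carrier_vec (n (Suc l))"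
      show "(X (Suc l) *\<^sub>v v) \<bullet> (A (Suc l) *\<^sub>v (X (Suc l) *\<^sub>v v)) \<le> v \<bullet> (A (Suc l) *\<^sub>v v)"
        using step[OF Suc v] Sk[of l \<nu>1] v unfolding nonexpansive_def by (meson order_trans)
    qed
  qed
  show "contractive (n (Suc l)) (A (Suc l)) (X (Suc l))" if "0 < \<nu>1"
    unfolding contractive_def
  proof (intro ballI impI)
    fix v :: "real Matrix.vec" assume v: "v \<in> carrier_vec (n (Suc l))" "v \<noteq> 0\<^sub>v (n (Suc l))"
    have "contractive (n (Suc l)) (A (Suc l)) (S (Suc l) ^\<^sub>m \<nu>1)"
      using contractive_pow_Suc[OF A_carrier S_carrier S, of l "\<nu>1 - 1"] that by simp
    then show "(X (Suc l) *\<^sub>v v) \<bullet> (A (Suc l) *\<^sub>v (X (Suc l) *\<^sub>v v)) < v \<bullet> (A (Suc l) *\<^sub>v v)"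
      using step[OF X v(1)] v unfolding contractive_def by (meson le_less_trans)
  qed
qed

section \<open>The cycle as an affine map with additive noise\<close>

definition admissible_noise :: "(nat \<Rightarrow> nat \<Rightarrow> real Matrix.vec) \<Rightarrow> real Matrix.vec \<Rightarrow> nat \<Rightarrow> bool" where
  "admissible_noise \<xi> \<zeta> l \<longleftrightarrow> \<zeta> \<in> carrier_vec (n 0) \<and>
     (\<forall>l'. 1 \<le> l' \<longrightarrow> l' \<le> l \<longrightarrow> (\<forall>j<\<nu>1 + \<nu>2. \<xi> l' j \<in> carrier_vec (n l')))"

abbreviation cycle :: "(nat \<Rightarrow> nat \<Rightarrow> real Matrix.vec) \<Rightarrow> real Matrix.vec \<Rightarrow> nat \<Rightarrow> real Matrix.vec \<Rightarrow> real Matrix.vec \<Rightarrow> real Matrix.vec" where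
  "cycle \<xi> \<zeta> l \<equiv> mgmc A P M \<nu>1 \<nu>2 \<xi> \<zeta> l"

abbreviation cycle_noise :: "(nat \<Rightarrow> nat \<Rightarrow> real Matrix.vec) \<Rightarrow> real Matrix.vec \<Rightarrow> nat \<Rightarrow> real Matrix.vec" where
  "cycle_noise \<xi> \<zeta> l \<equiv> cycle \<xi> \<zeta> l (0\<^sub>v (n l)) (0\<^sub>v (n l))"

abbreviation smoothing_noise :: "nat \<Rightarrow> nat \<Rightarrow> (nat \<Rightarrow> real Matrix.vec) \<Rightarrow> real Matrix.vec" where
  "smoothing_noise l k \<xi> \<equiv> smooth_iter (A l) (M l) (0\<^sub>v (n l)) \<xi> k (0\<^sub>v (n l))"

text \<open>After pre-smoothing the state is the exact solution plus an error y, and the coarse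
  problem has exact solution -w for w the coarse component of y. The coarse cycle therefore returns
  -w + X w plus noise, and adding its prolongation turns y into B y. The noise is displayed
  explicitly so that setting all data to zero can later identify it with
  \<open>cycle_noise\<close>.\<close>

lemma cycle_Suc_affine:
  assumes IH: "\<And>f \<theta>. f \<in> carrier_vec (n l) \<Longrightarrow> \<theta> \<in> carrier_vec (n l) \<Longrightarrow>
      cycle \<xi> \<zeta> l f \<theta> = Ai l *\<^sub>v f + X l *\<^sub>v (\<theta> - Ai l *\<^sub>v f) + cycle_noise \<xi> \<zeta> l"
    and N: "cycle_noise \<xi> \<zeta> l \<in> carrier_vec (n l)"
    and \<xi>: "\<And>j. j < \<nu>1 + \<nu>2 \<Longrightarrow> \<xi> (Suc l) j \<in> carrier_vec (n (Suc l))"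
    and f: "f \<in> carrier_vec (n (Suc l))" and \<theta>: "\<theta> \<in> carrier_vec (n (Suc l))"
  shows "cycle \<xi> \<zeta> (Suc l) f \<theta> = Ai (Suc l) *\<^sub>v f + X (Suc l) *\<^sub>v (\<theta> - Ai (Suc l) *\<^sub>v f) +
    (S (Suc l) ^\<^sub>m \<nu>2 *\<^sub>v (B l *\<^sub>v smoothing_noise (Suc l) \<nu>1 (\<xi> (Suc l)) + P (Suc l) *\<^sub>v cycle_noise \<xi> \<zeta> l)
      + smoothing_noise (Suc l) \<nu>2 (\<lambda>j. \<xi> (Suc l) (\<nu>1 + j)))"
proof -
  interpret sm: smoother "n (Suc l)" "A (Suc l)" "M (Suc l)" by (rule smoother)
  let ?n = "n (Suc l)" and ?A = "A (Suc l)" and ?P = "P (Suc l)" and ?N = "cycle_noise \<xi> \<zeta> l"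
  let ?E1 = "smoothing_noise (Suc l) \<nu>1 (\<xi> (Suc l))" and ?E2 = "smoothing_noise (Suc l) \<nu>2 (\<lambda>j. \<xi> (Suc l) (\<nu>1 + j))"
  define u where "u = Ai (Suc l) *\<^sub>v f"
  have u: "u \<in> carrier_vec ?n" unfolding u_def using f by (rule vec_carriers)
  have f': "f = ?A *\<^sub>v u" unfolding u_def using mat_inv_vec_right[OF A_carrier A_det f] by simp
  have E1: "?E1 \<in> carrier_vec ?n" and E2: "?E2 \<in> carrier_vec ?n" using \<xi> by (auto intro!: sm.smooth_iter_carrier)
  define d where "d = S (Suc l) ^\<^sub>m \<nu>1 *\<^sub>v (\<theta> - u)"
  have d: "d \<in> carrier_vec ?n" unfolding d_def using u \<theta> by (intro vec_carriers) auto
  have t1: "smooth_iter ?A (M (Suc l)) f (\<xi> (Suc l)) \<nu>1 \<theta> = u + d + ?E1"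
    using sm.smooth_iter_eq[OF f \<theta>, of \<nu>1 "\<xi> (Suc l)"] \<xi> by (simp add: u_def d_def)
  define y where "y = d + ?E1"
  have y: "y \<in> carrier_vec ?n" unfolding y_def using d E1 by simp
  define w where "w = coarse l y"
  have w: "w \<in> carrier_vec (n l)" unfolding w_def using coarse_carrier[OF y] .
  have yc: "?A *\<^sub>v y \<in> carrier_vec ?n" using y by (rule vec_carriers)
  have Aw: "A l *\<^sub>v w \<in> carrier_vec (n l)" using w by (rule vec_carriers)
  have Xw: "X l *\<^sub>v w \<in> carrier_vec (n l)" using w by (rule vec_carriers)
  have t1': "smooth_iter ?A (M (Suc l)) f (\<xi> (Suc l)) \<nu>1 \<theta> = u + y"
    unfolding t1 y_def using u d E1 by (intro assoc_add_vec)
  define f1 where "f1 = transpose_mat ?P *\<^sub>v (f - ?A *\<^sub>v (u + y))"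
  have f1: "f1 = 0\<^sub>v (n l) - A l *\<^sub>v w"
  proof -
    have "f - ?A *\<^sub>v (u + y) = 0\<^sub>v ?n - ?A *\<^sub>v y"
      unfolding f' using u y yc vec_carriers(1)[OF u]
      by (intro eq_vecI) (simp_all add: mat_vec_add del: index_mult_mat_vec)
    moreover have "transpose_mat ?P *\<^sub>v (0\<^sub>v ?n - ?A *\<^sub>v y) = transpose_mat ?P *\<^sub>v 0\<^sub>v ?n - transpose_mat ?P *\<^sub>v (?A *\<^sub>v y)"
      using yc by (intro mat_vec_minus) auto
    moreover have "transpose_mat ?P *\<^sub>v 0\<^sub>v ?n = 0\<^sub>v (n l)"
      using P_carrier by (intro mat_vec_zero) simp
    ultimately show ?thesis unfolding f1_def w_def restrict_eq[OF y, symmetric] by simp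
  qed
  have Aif1: "Ai l *\<^sub>v f1 = 0\<^sub>v (n l) - w"
  proof -
    have "Ai l *\<^sub>v f1 = Ai l *\<^sub>v 0\<^sub>v (n l) - Ai l *\<^sub>v (A l *\<^sub>v w)"
      unfolding f1 using Aw by (intro mat_vec_minus) auto
    then show ?thesis unfolding mat_inv_vec_left[OF A_carrier A_det w] mat_vec_zero[OF Ai_carrier] .
  qed
  \<comment> \<open>The coarse cycle starts from zero, so its initial deviation from the exact
    coarse solution -w is w itself.\<close>
  have "cycle \<xi> \<zeta> l f1 (0\<^sub>v (n l)) = (0\<^sub>v (n l) - w) + X l *\<^sub>v (0\<^sub>v (n l) - (0\<^sub>v (n l) - w)) + ?N"
    using IH[of f1 "0\<^sub>v (n l)"] Aw unfolding Aif1 by (simp add: f1)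
  also have "0\<^sub>v (n l) - (0\<^sub>v (n l) - w) = w" using w by (intro eq_vecI) auto
  finally have psi: "cycle \<xi> \<zeta> l f1 (0\<^sub>v (n l)) = (0\<^sub>v (n l) - w) + X l *\<^sub>v w + ?N" .
  have c: "?P *\<^sub>v w \<in> carrier_vec ?n" "?P *\<^sub>v (X l *\<^sub>v w) \<in> carrier_vec ?n" "?P *\<^sub>v ?N \<in> carrier_vec ?n"
    using w Xw N by (auto intro!: vec_carriers)
  have Ppsi: "?P *\<^sub>v ((0\<^sub>v (n l) - w) + X l *\<^sub>v w + ?N) = 0\<^sub>v ?n - ?P *\<^sub>v w + ?P *\<^sub>v (X l *\<^sub>v w) + ?P *\<^sub>v ?N"
  proof -
    have "?P *\<^sub>v ((0\<^sub>v (n l) - w) + X l *\<^sub>v w + ?N) = ?P *\<^sub>v (0\<^sub>v (n l) - w) + ?P *\<^sub>v (X l *\<^sub>v w) + ?P *\<^sub>v ?N"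
      using carrier_vecD[OF w] carrier_vecD[OF Xw] carrier_vecD[OF N] by (subst mat_vec_add; simp add: mat_vec_add)
    moreover have "?P *\<^sub>v (0\<^sub>v (n l) - w) = ?P *\<^sub>v 0\<^sub>v (n l) - ?P *\<^sub>v w" using w by (intro mat_vec_minus) auto
    ultimately show ?thesis using mat_vec_zero[OF P_carrier[of l]] by simp
  qed
  have Bc: "B l *\<^sub>v d \<in> carrier_vec ?n" "B l *\<^sub>v ?E1 \<in> carrier_vec ?n" using d E1 by (auto intro!: vec_carriers)
  have t2: "u + y + ?P *\<^sub>v ((0\<^sub>v (n l) - w) + X l *\<^sub>v w + ?N) = u + (B l *\<^sub>v y + ?P *\<^sub>v ?N)"
    unfolding Ppsi B_vec[OF y] w_def[symmetric] using u y c
    by (intro eq_vecI) (simp_all del: index_mult_mat_vec)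
  define z where "z = B l *\<^sub>v y + ?P *\<^sub>v ?N"
  have z: "z \<in> carrier_vec ?n" unfolding z_def using c vec_carriers(9)[OF y] by simp
  have zu: "u + z - u = z" using u z by (intro eq_vecI) (simp_all del: index_mult_mat_vec)
  have "cycle \<xi> \<zeta> (Suc l) f \<theta>
      = smooth_iter ?A (M (Suc l)) f (\<lambda>j. \<xi> (Suc l) (\<nu>1 + j)) \<nu>2 (u + y + ?P *\<^sub>v cycle \<xi> \<zeta> l f1 (0\<^sub>v (n l)))"
    by (simp add: Let_def t1' f1_def)
  also have "\<dots> = smooth_iter ?A (M (Suc l)) f (\<lambda>j. \<xi> (Suc l) (\<nu>1 + j)) \<nu>2 (u + z)"
    unfolding psi t2 z_def ..
  also have "\<dots> = u + S (Suc l) ^\<^sub>m \<nu>2 *\<^sub>v z + ?E2"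
    using sm.smooth_iter_eq[OF f, of "u + z" \<nu>2 "\<lambda>j. \<xi> (Suc l) (\<nu>1 + j)"] \<xi> u z zu unfolding u_def[symmetric] by simp
  also have "z = B l *\<^sub>v d + (B l *\<^sub>v ?E1 + ?P *\<^sub>v ?N)"
    unfolding z_def y_def using d E1 Bc c carrier_matD[OF B_carrier[of l]]
    by (simp add: mat_vec_add assoc_add_vec[of _ ?n])
  also have "S (Suc l) ^\<^sub>m \<nu>2 *\<^sub>v \<dots> = X (Suc l) *\<^sub>v (\<theta> - u) + S (Suc l) ^\<^sub>m \<nu>2 *\<^sub>v (B l *\<^sub>v ?E1 + ?P *\<^sub>v ?N)"
  proof -
    have "X (Suc l) *\<^sub>v (\<theta> - u) = S (Suc l) ^\<^sub>m \<nu>2 *\<^sub>v (B l *\<^sub>v d)"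
      unfolding d_def using u \<theta> by (intro X_Suc_vec) simp
    moreover have "S (Suc l) ^\<^sub>m \<nu>2 *\<^sub>v (B l *\<^sub>v d + (B l *\<^sub>v ?E1 + ?P *\<^sub>v ?N))
        = S (Suc l) ^\<^sub>m \<nu>2 *\<^sub>v (B l *\<^sub>v d) + S (Suc l) ^\<^sub>m \<nu>2 *\<^sub>v (B l *\<^sub>v ?E1 + ?P *\<^sub>v ?N)"
      using Bc c by (intro mult_add_distrib_mat_vec[of _ ?n ?n] pow_carrier_mat add_carrier_vec S_carrier)
    ultimately show ?thesis by simp
  qed
  also have "u + (X (Suc l) *\<^sub>v (\<theta> - u) + S (Suc l) ^\<^sub>m \<nu>2 *\<^sub>v (B l *\<^sub>v ?E1 + ?P *\<^sub>v ?N)) + ?E2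
      = u + X (Suc l) *\<^sub>v (\<theta> - u) + (S (Suc l) ^\<^sub>m \<nu>2 *\<^sub>v (B l *\<^sub>v ?E1 + ?P *\<^sub>v ?N) + ?E2)"
  proof -
    have "X (Suc l) *\<^sub>v (\<theta> - u) \<in> carrier_vec ?n" "S (Suc l) ^\<^sub>m \<nu>2 *\<^sub>v (B l *\<^sub>v ?E1 + ?P *\<^sub>v ?N) \<in> carrier_vec ?n"
      using vec_carriers(3)[OF minus_carrier_vec[OF \<theta> u]] vec_carriers(8)[OF add_carrier_vec[OF Bc(2) c(3)]] by blast+
    then show ?thesis using u E2 by (simp add: assoc_add_vec[of _ ?n] del: iteration_mat.simps)
  qed
  finally show ?thesis unfolding u_def .
qed

text \<open>Dimension and affine form are proved together, since the step to the next level uses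
  both for the coarse cycle.\<close>

lemma cycle_affine_carrier:
  assumes "admissible_noise \<xi> \<zeta> l"
  shows "cycle_noise \<xi> \<zeta> l \<in> carrier_vec (n l) \<and> (\<forall>f\<in>carrier_vec (n l). \<forall>\<theta>\<in>carrier_vec (n l).
    cycle \<xi> \<zeta> l f \<theta> = Ai l *\<^sub>v f + X l *\<^sub>v (\<theta> - Ai l *\<^sub>v f) + cycle_noise \<xi> \<zeta> l)"
  using assms
proof (induction l)
  case 0
  have Z: "\<zeta> \<in> carrier_vec (n 0)" using 0 by (simp add: admissible_noise_def)
  have *: "X 0 *\<^sub>v (\<theta> - Ai 0 *\<^sub>v f) = 0\<^sub>v (n 0)" if "f \<in> carrier_vec (n 0)" "\<theta> \<in> carrier_vec (n 0)" for f \<theta>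
    using that vec_carriers(2)[of f 0] by (intro X_0_vec) simp
  show ?case using Z * vec_carriers(2)[of _ 0]
    by (auto simp: mat_vec_zero[OF Ai_carrier] simp del: iteration_mat.simps)
next
  case (Suc l)
  have adm: "admissible_noise \<xi> \<zeta> l" using Suc.prems by (auto simp: admissible_noise_def)
  have \<xi>: "\<And>j. j < \<nu>1 + \<nu>2 \<Longrightarrow> \<xi> (Suc l) j \<in> carrier_vec (n (Suc l))"
    using Suc.prems by (auto simp: admissible_noise_def)
  interpret sm: smoother "n (Suc l)" "A (Suc l)" "M (Suc l)" by (rule smoother)
  let ?E1 = "smoothing_noise (Suc l) \<nu>1 (\<xi> (Suc l))" and ?E2 = "smoothing_noise (Suc l) \<nu>2 (\<lambda>j. \<xi> (Suc l) (\<nu>1 + j))"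
  let ?R = "S (Suc l) ^\<^sub>m \<nu>2 *\<^sub>v (B l *\<^sub>v ?E1 + P (Suc l) *\<^sub>v cycle_noise \<xi> \<zeta> l) + ?E2"
  have E: "?E1 \<in> carrier_vec (n (Suc l))" "?E2 \<in> carrier_vec (n (Suc l))" using \<xi> by (auto intro!: sm.smooth_iter_carrier)
  have R: "?R \<in> carrier_vec (n (Suc l))" using E conjunct1[OF Suc.IH[OF adm]]
    by (intro add_carrier_vec vec_carriers(8) vec_carriers(9) vec_carriers(6)) auto
  have *: "cycle \<xi> \<zeta> (Suc l) f \<theta> = Ai (Suc l) *\<^sub>v f + X (Suc l) *\<^sub>v (\<theta> - Ai (Suc l) *\<^sub>v f) + ?R"
    if "f \<in> carrier_vec (n (Suc l))" "\<theta> \<in> carrier_vec (n (Suc l))" for f \<theta>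
    using Suc.IH[OF adm] by (intro cycle_Suc_affine that \<xi>) blast+
  have "cycle_noise \<xi> \<zeta> (Suc l) = ?R"
    using *[of "0\<^sub>v (n (Suc l))" "0\<^sub>v (n (Suc l))"] R
    by (simp add: mat_vec_zero[OF Ai_carrier] mat_vec_zero[OF X_carrier] del: iteration_mat.simps mgmc.simps)
  then show ?case using * R by (intro conjI ballI) (simp_all only:)
qed

lemma
  assumes "admissible_noise \<xi> \<zeta> l"
  shows cycle_noise_carrier: "cycle_noise \<xi> \<zeta> l \<in> carrier_vec (n l)"
    and cycle_affine: "f \<in> carrier_vec (n l) \<Longrightarrow> \<theta> \<in> carrier_vec (n l) \<Longrightarrow>
      cycle \<xi> \<zeta> l f \<theta> = Ai l *\<^sub>v f + X l *\<^sub>v (\<theta> - Ai l *\<^sub>v f) + cycle_noise \<xi> \<zeta> l"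
  using cycle_affine_carrier[OF assms] by blast+

text \<open>Displays the noise as successive affine steps: pre-smoothing noise is pushed through B,
  coarse noise is added, the sum is pushed through post-smoothing and fresh noise is added. The
  covariance computation follows this shape.\<close>

lemma cycle_noise_Suc:
  assumes "admissible_noise \<xi> \<zeta> (Suc l)"
  shows "cycle_noise \<xi> \<zeta> (Suc l)
    = S (Suc l) ^\<^sub>m \<nu>2 *\<^sub>v (B l *\<^sub>v smoothing_noise (Suc l) \<nu>1 (\<xi> (Suc l)) + P (Suc l) *\<^sub>v cycle_noise \<xi> \<zeta> l)
      + smoothing_noise (Suc l) \<nu>2 (\<lambda>j. \<xi> (Suc l) (\<nu>1 + j))" (is "_ = ?R")
proof -
  have adm: "admissible_noise \<xi> \<zeta> l" and \<xi>: "\<And>j. j < \<nu>1 + \<nu>2 \<Longrightarrow> \<xi> (Suc l) j \<in> carrier_vec (n (Suc l))"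
    using assms by (auto simp: admissible_noise_def)
  interpret sm: smoother "n (Suc l)" "A (Suc l)" "M (Suc l)" by (rule smoother)
  have E: "smoothing_noise (Suc l) \<nu>1 (\<xi> (Suc l)) \<in> carrier_vec (n (Suc l))"
    "smoothing_noise (Suc l) \<nu>2 (\<lambda>j. \<xi> (Suc l) (\<nu>1 + j)) \<in> carrier_vec (n (Suc l))"
    using \<xi> by (auto intro!: sm.smooth_iter_carrier)
  have "?R \<in> carrier_vec (n (Suc l))" using E cycle_noise_carrier[OF adm]
    by (intro add_carrier_vec vec_carriers(8) vec_carriers(9) vec_carriers(6)) auto
  moreover have "cycle_noise \<xi> \<zeta> (Suc l) = Ai (Suc l) *\<^sub>v 0\<^sub>v (n (Suc l)) +
      X (Suc l) *\<^sub>v (0\<^sub>v (n (Suc l)) - Ai (Suc l) *\<^sub>v 0\<^sub>v (n (Suc l))) + ?R"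
    by (rule cycle_Suc_affine[OF cycle_affine[OF adm] cycle_noise_carrier[OF adm] \<xi>]) auto
  ultimately show ?thesis
    by (simp add: mat_vec_zero[OF Ai_carrier] mat_vec_zero[OF X_carrier] del: iteration_mat.simps mgmc.simps)
qed

end

section \<open>Covariances along the chain\<close>

context uncorrelated_vectors
begin

text \<open>Adding such a \<open>Z\<close> to a linear iteration with matrix \<open>Y\<close> leaves the covariance \<open>K\<close> invariant.\<close>
definition invariant_noise :: "'d set \<Rightarrow> nat \<Rightarrow> real mat \<Rightarrow> real mat \<Rightarrow> ('w \<Rightarrow> real Matrix.vec) \<Rightarrow> bool" where
  "invariant_noise D m K Y Z \<longleftrightarrow> affine_vec_in D m Z \<and>
     (\<forall>a\<in>carrier_vec m. \<forall>b\<in>carrier_vec m. cov M (\<lambda>w. a \<bullet> Z w) (\<lambda>w. b \<bullet> Z w)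
        = a \<bullet> (K *\<^sub>v b) - (transpose_mat Y *\<^sub>v a) \<bullet> (K *\<^sub>v (transpose_mat Y *\<^sub>v b)))"

lemma invariant_noise_cong:
  assumes "invariant_noise D m K Y Z" "\<And>w. w \<in> space M \<Longrightarrow> Z' w = Z w"
  shows "invariant_noise D m K Y Z'"
proof -
  have "cov M (\<lambda>w. a \<bullet> Z' w) (\<lambda>w. b \<bullet> Z' w) = cov M (\<lambda>w. a \<bullet> Z w) (\<lambda>w. b \<bullet> Z w)" for a b
    using assms(2) by (intro cov_cong) auto
  then show ?thesis using assms affine_vec_in_cong[OF _ assms(2)] unfolding invariant_noise_def by auto
qed

text \<open>State and noise depend on disjoint sets of draws, so the mixed covariances vanish, and
  the constant drops out.\<close>

lemma cov_affine_step:
  assumes D: "affine_vec_in D m Z" and E: "affine_vec_in E m' N" and DE: "D \<inter> E = {}"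
    and Y: "Y \<in> carrier_mat m' m" and c: "c \<in> carrier_vec m'"
    and a: "a \<in> carrier_vec m'" and b: "b \<in> carrier_vec m'"
  shows "cov M (\<lambda>w. a \<bullet> (c + Y *\<^sub>v Z w + N w)) (\<lambda>w. b \<bullet> (c + Y *\<^sub>v Z w + N w))
    = cov M (\<lambda>w. (transpose_mat Y *\<^sub>v a) \<bullet> Z w) (\<lambda>w. (transpose_mat Y *\<^sub>v b) \<bullet> Z w)
      + cov M (\<lambda>w. a \<bullet> N w) (\<lambda>w. b \<bullet> N w)"
proof -
  let ?T = "transpose_mat Y"
  have cT: "?T *\<^sub>v v \<in> carrier_vec m" if "v \<in> carrier_vec m'" for v
    using that Y by (intro mult_mat_vec_carrier[of _ m m']) auto
  define U where "U v w = v \<bullet> c + (?T *\<^sub>v v) \<bullet> Z w" for v w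
  have Uin: "affine_in D (U v)" if "v \<in> carrier_vec m'" for v
    unfolding U_def using D cT[OF that] by (intro affine_in.add affine_in.const) (auto simp: affine_vec_in_def)
  have Zin: "affine_in D (\<lambda>w. (?T *\<^sub>v v) \<bullet> Z w)" if "v \<in> carrier_vec m'" for v
    using D cT[OF that] by (auto simp: affine_vec_in_def)
  have Nin: "affine_in E (\<lambda>w. v \<bullet> N w)" if "v \<in> carrier_vec m'" for v
    using E that by (auto simp: affine_vec_in_def)
  note sq = affine_in_sq_integrable[OF Uin] affine_in_sq_integrable[OF Nin] affine_in_sq_integrable[OF Zin]
  have eq: "v \<bullet> (c + Y *\<^sub>v Z w + N w) = U v w + v \<bullet> N w" if "w \<in> space M" "v \<in> carrier_vec m'" for v w
  proof -
    have Zw: "Z w \<in> carrier_vec m" "N w \<in> carrier_vec m'" using D E that(1) by (auto simp: affine_vec_in_def)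
    then have YZ: "Y *\<^sub>v Z w \<in> carrier_vec m'" using Y by (intro mult_mat_vec_carrier)
    show ?thesis unfolding U_def scalar_prod_mat_transpose[OF Y that(2) Zw(1), symmetric]
      using scalar_prod_add_distrib[OF that(2) add_carrier_vec[OF c YZ] Zw(2)] scalar_prod_add_distrib[OF that(2) c YZ]
      by simp
  qed
  have sqc: "sq_integrable M (\<lambda>_. r)" for r by (rule sq_integrable_const)
  have UU: "cov M (U a) (U b) = cov M (\<lambda>w. (?T *\<^sub>v a) \<bullet> Z w) (\<lambda>w. (?T *\<^sub>v b) \<bullet> Z w)"
    unfolding U_def using a b sq sqc sq_integrable_add[OF sqc sq(3)[OF b]]
    by (simp add: cov_add_left cov_add_right cov_const cov_const_right)
  have "cov M (\<lambda>w. a \<bullet> (c + Y *\<^sub>v Z w + N w)) (\<lambda>w. b \<bullet> (c + Y *\<^sub>v Z w + N w))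
      = cov M (\<lambda>w. U a w + a \<bullet> N w) (\<lambda>w. U b w + b \<bullet> N w)"
    using eq a b by (intro cov_cong) auto
  also have "\<dots> = cov M (U a) (U b) + cov M (U a) (\<lambda>w. b \<bullet> N w) + (cov M (\<lambda>w. a \<bullet> N w) (U b) + cov M (\<lambda>w. a \<bullet> N w) (\<lambda>w. b \<bullet> N w))"
    using sq a b sq_integrable_add[OF sq(1)[OF b] sq(2)[OF b]]
    by (simp add: cov_add_left cov_add_right)
  also have "cov M (U a) (\<lambda>w. b \<bullet> N w) = 0" using affine_in_uncorrelated[OF Uin[OF a] Nin[OF b] DE] .
  also have "cov M (\<lambda>w. a \<bullet> N w) (U b) = 0" using affine_in_uncorrelated[OF Nin[OF a] Uin[OF b]] DE by blast
  finally show ?thesis using UU by simp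
qed

lemma affine_vec_in_step:
  assumes "affine_vec_in D m Z" "affine_vec_in E m' N" "Y \<in> carrier_mat m' m" "c \<in> carrier_vec m'"
  shows "affine_vec_in (D \<union> E) m' (\<lambda>w. c + Y *\<^sub>v Z w + N w)"
  using assms affine_vec_in_mono[of D m Z "D \<union> E"] affine_vec_in_mono[of E m' N "D \<union> E"]
  by (intro affine_vec_in_add affine_vec_in_mat[of _ m] affine_vec_in_const) auto

text \<open>The defects telescope: Y' (K - Y K Y^T) Y'^T + (K - Y' K Y'^T) = K - (Y' Y) K (Y'
  Y)^T.\<close>

lemma invariant_noise_compose:
  assumes Z: "invariant_noise D m K Y Z" and N: "invariant_noise E m K Y' N" and DE: "D \<inter> E = {}"
    and Y: "Y \<in> carrier_mat m m" and Y': "Y' \<in> carrier_mat m m"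
  shows "invariant_noise (D \<union> E) m K (Y' * Y) (\<lambda>w. Y' *\<^sub>v Z w + N w)"
proof -
  have aff: "affine_vec_in D m Z" "affine_vec_in E m N" using Z N by (auto simp: invariant_noise_def)
  have z: "0\<^sub>v m \<in> carrier_vec m" by simp
  have eq: "0\<^sub>v m + Y' *\<^sub>v Z w + N w = Y' *\<^sub>v Z w + N w" if "w \<in> space M" for w
    using aff that Y' by (auto simp: affine_vec_in_def)
  have T: "transpose_mat (Y' * Y) *\<^sub>v v = transpose_mat Y *\<^sub>v (transpose_mat Y' *\<^sub>v v)" if "v \<in> carrier_vec m" for v
    using transpose_mult[OF Y' Y] Y Y' that by (simp add: mat_mult_vec)
  have cT: "transpose_mat Y' *\<^sub>v v \<in> carrier_vec m" if "v \<in> carrier_vec m" for v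
    using that Y' by (intro mult_mat_vec_carrier[of _ m m]) auto
  show ?thesis unfolding invariant_noise_def
  proof (intro conjI ballI)
    show "affine_vec_in (D \<union> E) m (\<lambda>w. Y' *\<^sub>v Z w + N w)"
      by (rule affine_vec_in_cong[OF affine_vec_in_step[OF aff Y' z]]) (simp add: eq)
    fix a b :: "real Matrix.vec" assume ab: "a \<in> carrier_vec m" "b \<in> carrier_vec m"
    have "cov M (\<lambda>w. a \<bullet> (Y' *\<^sub>v Z w + N w)) (\<lambda>w. b \<bullet> (Y' *\<^sub>v Z w + N w))
        = cov M (\<lambda>w. a \<bullet> (0\<^sub>v m + Y' *\<^sub>v Z w + N w)) (\<lambda>w. b \<bullet> (0\<^sub>v m + Y' *\<^sub>v Z w + N w))"
      using eq by (intro cov_cong) auto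
    also have "\<dots> = cov M (\<lambda>w. (transpose_mat Y' *\<^sub>v a) \<bullet> Z w) (\<lambda>w. (transpose_mat Y' *\<^sub>v b) \<bullet> Z w)
      + cov M (\<lambda>w. a \<bullet> N w) (\<lambda>w. b \<bullet> N w)" by (rule cov_affine_step[OF aff DE Y' z ab])
    finally show "cov M (\<lambda>w. a \<bullet> (Y' *\<^sub>v Z w + N w)) (\<lambda>w. b \<bullet> (Y' *\<^sub>v Z w + N w)) = a \<bullet> (K *\<^sub>v b) -
        (transpose_mat (Y' * Y) *\<^sub>v a) \<bullet> (K *\<^sub>v (transpose_mat (Y' * Y) *\<^sub>v b))"
      using Z N ab cT unfolding invariant_noise_def T[OF ab(1)] T[OF ab(2)] by simp
  qed
qed

lemma invariant_noise_zero:
  assumes "K \<in> carrier_mat m m"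
  shows "invariant_noise {} m K (1\<^sub>m m) (\<lambda>_. 0\<^sub>v m)"
  unfolding invariant_noise_def using affine_vec_in_const[of "0\<^sub>v m" m]
  by (auto simp: cov_const)

text \<open>Handles noise injected through a matrix, namely the inverse splitting matrix for a
  smoother and the prolongation for a coarse level. The covariance identity is asked for only after
  transposition, because the source may live in another dimension.\<close>

lemma invariant_noise_mat:
  assumes "affine_vec_in D m Z" "L \<in> carrier_mat m' m"
    and "\<And>a b. a \<in> carrier_vec m' \<Longrightarrow> b \<in> carrier_vec m' \<Longrightarrow>
      cov M (\<lambda>w. (transpose_mat L *\<^sub>v a) \<bullet> Z w) (\<lambda>w. (transpose_mat L *\<^sub>v b) \<bullet> Z w)
        = a \<bullet> (K *\<^sub>v b) - (transpose_mat Y *\<^sub>v a) \<bullet> (K *\<^sub>v (transpose_mat Y *\<^sub>v b))"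
  shows "invariant_noise D m' K Y (\<lambda>w. L *\<^sub>v Z w)"
  unfolding invariant_noise_def
proof (intro conjI ballI)
  show "affine_vec_in D m' (\<lambda>w. L *\<^sub>v Z w)" using affine_vec_in_mat assms by blast
  fix a b :: "real Matrix.vec" assume ab: "a \<in> carrier_vec m'" "b \<in> carrier_vec m'"
  have "cov M (\<lambda>w. a \<bullet> (L *\<^sub>v Z w)) (\<lambda>w. b \<bullet> (L *\<^sub>v Z w))
      = cov M (\<lambda>w. (transpose_mat L *\<^sub>v a) \<bullet> Z w) (\<lambda>w. (transpose_mat L *\<^sub>v b) \<bullet> Z w)"
    using assms(1,2) ab by (intro cov_cong scalar_prod_mat_transpose) (auto simp: affine_vec_in_def)
  then show "cov M (\<lambda>w. a \<bullet> (L *\<^sub>v Z w)) (\<lambda>w. b \<bullet> (L *\<^sub>v Z w))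
      = a \<bullet> (K *\<^sub>v b) - (transpose_mat Y *\<^sub>v a) \<bullet> (K *\<^sub>v (transpose_mat Y *\<^sub>v b))"
    using assms(3)[OF ab] by simp
qed

text \<open>This is where the prescribed noise covariance originates: A^{-1} - S A^{-1} S^T = N^{-1}
  (N + N^T - A) N^{-T} for S = I - N^{-1} A.\<close>

lemma invariant_noise_smoothing_step:
  assumes "smoother m A N" and "d \<in> I" "dim d = m"
    and cv: "\<And>a b. a \<in> carrier_vec m \<Longrightarrow> b \<in> carrier_vec m \<Longrightarrow>
      cov M (\<lambda>w. a \<bullet> W d w) (\<lambda>w. b \<bullet> W d w) = a \<bullet> ((N + transpose_mat N - A) *\<^sub>v b)"
  shows "invariant_noise {d} m (mat_inv A) (smoother_mat A N) (\<lambda>w. mat_inv N *\<^sub>v W d w)"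
proof -
  interpret sm: smoother m A N by fact
  have Ni: "sym_mat m (mat_inv N)" using mat_inv_sym[OF sm.M_sym sm.M_det] .
  then have NiT: "transpose_mat (mat_inv N) = mat_inv N" by (simp add: sym_mat_def)
  have NT: "transpose_mat N = N" using sm.M_sym by (simp add: sym_mat_def)
  have AT: "transpose_mat A = A" using sm.A_sym by (simp add: sym_mat_def)
  show ?thesis
  proof (rule invariant_noise_mat)
    show "affine_vec_in {d} m (W d)" using affine_vec_in_vector[of d "{d}"] assms by simp
    show "mat_inv N \<in> carrier_mat m m" by simp
    fix a b :: "real Matrix.vec" assume ab: "a \<in> carrier_vec m" "b \<in> carrier_vec m"
    \<comment> \<open>Writing a = N p and b = N q clears the inverses of N; both sides become 2 (p .
      N q) - p . A q.\<close>
    define p q where "p = mat_inv N *\<^sub>v a" and "q = mat_inv N *\<^sub>v b"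
    have pq: "p \<in> carrier_vec m" "q \<in> carrier_vec m" unfolding p_def q_def using ab by (auto intro!: mult_mat_vec_carrier[of _ m m])
    have a: "a = N *\<^sub>v p" "b = N *\<^sub>v q" unfolding p_def q_def
      using mat_inv_vec_right[OF sm.M_carrier sm.M_det] ab by auto
    have c: "A *\<^sub>v p \<in> carrier_vec m" "A *\<^sub>v q \<in> carrier_vec m" "N *\<^sub>v p \<in> carrier_vec m" "N *\<^sub>v q \<in> carrier_vec m"
      using pq by (auto intro!: mult_mat_vec_carrier[of _ m m])
    have ST: "transpose_mat (smoother_mat A N) = 1\<^sub>m m - A * mat_inv N"
      unfolding smoother_mat_def using transpose_mult[OF sm.Mi_carrier sm.A_carrier] NiT AT
      by (subst transpose_minus[of _ m m]) auto
    have STv: "transpose_mat (smoother_mat A N) *\<^sub>v v = v - A *\<^sub>v (mat_inv N *\<^sub>v v)" if "v \<in> carrier_vec m" for v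
      unfolding ST using that by (simp add: mat_minus_vec mat_mult_vec)
    have S: "transpose_mat (smoother_mat A N) *\<^sub>v a = N *\<^sub>v p - A *\<^sub>v p"
      "transpose_mat (smoother_mat A N) *\<^sub>v b = N *\<^sub>v q - A *\<^sub>v q"
      using STv[OF ab(1)] STv[OF ab(2)] unfolding p_def[symmetric] q_def[symmetric] a(1)[symmetric] a(2)[symmetric] .
    have i: "mat_inv A *\<^sub>v (A *\<^sub>v q) = q" using mat_inv_vec_left[OF sm.A_carrier sm.A_det pq(2)] .
    have Ai: "sym_mat m (mat_inv A)" using mat_inv_sym[OF sm.A_sym sm.A_det] .
    have j: "(A *\<^sub>v p) \<bullet> (mat_inv A *\<^sub>v (N *\<^sub>v q)) = p \<bullet> (N *\<^sub>v q)"
      using sym_mat_scalar_prod[OF Ai c(1,4)] mat_inv_vec_left[OF sm.A_carrier sm.A_det pq(1)] by simp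
    have k: "(N *\<^sub>v p) \<bullet> q = p \<bullet> (N *\<^sub>v q)" using sym_mat_scalar_prod[OF sm.M_sym pq] .
    have l: "(A *\<^sub>v p) \<bullet> q = p \<bullet> (A *\<^sub>v q)" using sym_mat_scalar_prod[OF sm.A_sym pq] .
    have "a \<bullet> (mat_inv A *\<^sub>v b) - (transpose_mat (smoother_mat A N) *\<^sub>v a) \<bullet> (mat_inv A *\<^sub>v (transpose_mat (smoother_mat A N) *\<^sub>v b))
        = 2 * (p \<bullet> (N *\<^sub>v q)) - p \<bullet> (A *\<^sub>v q)"
      unfolding S unfolding a using pq by (simp add: mat_vec_minus scalar_prod_minus_left scalar_prod_minus_right i j k l)
    also have "\<dots> = p \<bullet> ((N + transpose_mat N - A) *\<^sub>v q)"
      unfolding NT using pq by (simp add: mat_minus_vec mat_add_vec scalar_prod_minus_right scalar_prod_add_right)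
    finally show "cov M (\<lambda>w. (transpose_mat (mat_inv N) *\<^sub>v a) \<bullet> W d w) (\<lambda>w. (transpose_mat (mat_inv N) *\<^sub>v b) \<bullet> W d w)
      = a \<bullet> (mat_inv A *\<^sub>v b) - (transpose_mat (smoother_mat A N) *\<^sub>v a) \<bullet> (mat_inv A *\<^sub>v (transpose_mat (smoother_mat A N) *\<^sub>v b))"
      unfolding NiT p_def[symmetric] q_def[symmetric] using cv[OF pq] by simp
  qed
qed

text \<open>The injective indexing \<open>d\<close> guarantees a fresh draw at each step, as
  composition requires. It also covers post-smoothing, whose draws are offset by the number of
  pre-smoothing steps.\<close>

lemma invariant_noise_smoothing:
  assumes sm: "smoother m A N" and d: "\<And>j. j < k \<Longrightarrow> d j \<in> I" "\<And>j. j < k \<Longrightarrow> dim (d j) = m" and inj: "inj_on d {..<k}"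
    and cv: "\<And>j a b. j < k \<Longrightarrow> a \<in> carrier_vec m \<Longrightarrow> b \<in> carrier_vec m \<Longrightarrow>
      cov M (\<lambda>w. a \<bullet> W (d j) w) (\<lambda>w. b \<bullet> W (d j) w) = a \<bullet> ((N + transpose_mat N - A) *\<^sub>v b)"
  shows "invariant_noise (d ` {..<k}) m (mat_inv A) (smoother_mat A N ^\<^sub>m k)
    (\<lambda>w. smooth_iter A N (0\<^sub>v m) (\<lambda>j. W (d j) w) k (0\<^sub>v m))"
  using d inj cv
proof (induction k)
  case 0
  interpret sm: smoother m A N by fact
  show ?case using invariant_noise_zero[of "mat_inv A" m] by simp
next
  case (Suc k)
  interpret sm: smoother m A N by fact
  have "invariant_noise (d ` {..<k}) m (mat_inv A) (sm.S ^\<^sub>m k)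
      (\<lambda>w. smooth_iter A N (0\<^sub>v m) (\<lambda>j. W (d j) w) k (0\<^sub>v m))"
    using Suc.prems by (intro Suc.IH) (auto simp: inj_on_def)
  moreover have "invariant_noise {d k} m (mat_inv A) sm.S (\<lambda>w. mat_inv N *\<^sub>v W (d k) w)"
    using Suc.prems by (intro invariant_noise_smoothing_step sm) auto
  moreover have "d ` {..<k} \<inter> {d k} = {}" using Suc.prems(3) by (fastforce dest: inj_onD)
  ultimately have *: "invariant_noise (d ` {..<k} \<union> {d k}) m (mat_inv A) (sm.S * sm.S ^\<^sub>m k)
      (\<lambda>w. sm.S *\<^sub>v smooth_iter A N (0\<^sub>v m) (\<lambda>j. W (d j) w) k (0\<^sub>v m) + mat_inv N *\<^sub>v W (d k) w)"
    by (rule invariant_noise_compose) auto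
  have eq: "smooth_iter A N (0\<^sub>v m) (\<lambda>j. W (d j) w) (Suc k) (0\<^sub>v m)
      = sm.S *\<^sub>v smooth_iter A N (0\<^sub>v m) (\<lambda>j. W (d j) w) k (0\<^sub>v m) + mat_inv N *\<^sub>v W (d k) w" if "w \<in> space M" for w
    using Suc.prems W_carrier that by (intro sm.smooth_iter_0_Suc) metis
  have set: "d ` {..<Suc k} = d ` {..<k} \<union> {d k}" by (auto simp: lessThan_Suc)
  show ?case unfolding set pow_mat_Suc_left[OF sm.S_carrier] invariant_noise_def
    using * eq unfolding invariant_noise_def
    by (auto intro: affine_vec_in_cong simp del: smooth_iter.simps cong: cov_cong)
qed

end

section \<open>Covariance of prolonged coarse noise\<close>

context multigrid
begin

text \<open>Obtained by duality: pairing with an arbitrary v lets the known action of B on v be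
  moved factor by factor to the other side.\<close>

lemma transpose_B_vec:
  assumes a: "a \<in> carrier_vec (n (Suc l))"
  defines "p \<equiv> transpose_mat (P (Suc l)) *\<^sub>v a"
  shows "transpose_mat (B l) *\<^sub>v a
    = a - A (Suc l) *\<^sub>v (P (Suc l) *\<^sub>v (Ai l *\<^sub>v (p - transpose_mat (X l) *\<^sub>v p)))"
proof (rule vec_eq_if_scalar_prod_eq)
  have p: "p \<in> carrier_vec (n l)" unfolding p_def using a by (rule vec_carriers)
  define r where "r = p - transpose_mat (X l) *\<^sub>v p"
  have Xp: "transpose_mat (X l) *\<^sub>v p \<in> carrier_vec (n l)" using p by (rule vec_carriers)
  then have r: "r \<in> carrier_vec (n l)" unfolding r_def using p by simp
  define y where "y = Ai l *\<^sub>v r"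
  have y: "y \<in> carrier_vec (n l)" unfolding y_def using r by (rule vec_carriers)
  have Py: "P (Suc l) *\<^sub>v y \<in> carrier_vec (n (Suc l))" using y by (rule vec_carriers)
  then have APy: "A (Suc l) *\<^sub>v (P (Suc l) *\<^sub>v y) \<in> carrier_vec (n (Suc l))" by (rule vec_carriers)
  show "transpose_mat (B l) *\<^sub>v a \<in> carrier_vec (n (Suc l))"
    using a by (intro mult_mat_vec_carrier[of _ "n (Suc l)" "n (Suc l)"]) simp_all
  show "a - A (Suc l) *\<^sub>v (P (Suc l) *\<^sub>v (Ai l *\<^sub>v (p - transpose_mat (X l) *\<^sub>v p))) \<in> carrier_vec (n (Suc l))"
    using a APy by (simp add: r_def y_def)
  fix v :: "real Matrix.vec" assume v: "v \<in> carrier_vec (n (Suc l))"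
  let ?w = "coarse l v"
  have w: "?w \<in> carrier_vec (n l)" using coarse_carrier[OF v] .
  have Xw: "X l *\<^sub>v ?w \<in> carrier_vec (n l)" using w by (rule vec_carriers)
  have c: "P (Suc l) *\<^sub>v ?w \<in> carrier_vec (n (Suc l))" "P (Suc l) *\<^sub>v (X l *\<^sub>v ?w) \<in> carrier_vec (n (Suc l))"
    using w Xw by (auto intro!: vec_carriers)
  have "(transpose_mat (B l) *\<^sub>v a) \<bullet> v = a \<bullet> (B l *\<^sub>v v)"
    using transpose_vec_mult_scalar[OF B_carrier v a] .
  also have "\<dots> = a \<bullet> v - a \<bullet> (P (Suc l) *\<^sub>v ?w) + a \<bullet> (P (Suc l) *\<^sub>v (X l *\<^sub>v ?w))"
    unfolding B_vec[OF v] using a v c by (simp add: scalar_prod_add_right scalar_prod_minus_right)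
  also have "a \<bullet> (P (Suc l) *\<^sub>v ?w) = p \<bullet> ?w" unfolding p_def using scalar_prod_mat_transpose[OF P_carrier a w] .
  also have "a \<bullet> (P (Suc l) *\<^sub>v (X l *\<^sub>v ?w)) = p \<bullet> (X l *\<^sub>v ?w)"
    unfolding p_def using scalar_prod_mat_transpose[OF P_carrier a Xw] .
  also have "\<dots> = (transpose_mat (X l) *\<^sub>v p) \<bullet> ?w" using scalar_prod_mat_transpose[OF X_carrier p w] .
  also have "a \<bullet> v - p \<bullet> ?w + (transpose_mat (X l) *\<^sub>v p) \<bullet> ?w = a \<bullet> v - r \<bullet> ?w"
    unfolding r_def using minus_scalar_prod_distrib[OF p Xp w] by simp
  also have "r \<bullet> ?w = y \<bullet> (A l *\<^sub>v ?w)"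
    using sym_mat_scalar_prod[OF A_sym y w] mat_inv_vec_right[OF A_carrier A_det r] by (simp add: y_def)
  also have "\<dots> = (P (Suc l) *\<^sub>v y) \<bullet> (A (Suc l) *\<^sub>v v)" using prolong_scalar_prod(1)[OF y v] by simp
  also have "\<dots> = (A (Suc l) *\<^sub>v (P (Suc l) *\<^sub>v y)) \<bullet> v" using sym_mat_scalar_prod[OF A_sym Py v] by simp
  also have "a \<bullet> v - \<dots> = (a - A (Suc l) *\<^sub>v (P (Suc l) *\<^sub>v y)) \<bullet> v"
    using minus_scalar_prod_distrib[OF a APy v] by simp
  finally show "(transpose_mat (B l) *\<^sub>v a) \<bullet> v
    = (a - A (Suc l) *\<^sub>v (P (Suc l) *\<^sub>v (Ai l *\<^sub>v (p - transpose_mat (X l) *\<^sub>v p)))) \<bullet> v"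
    by (simp add: y_def r_def)
qed

text \<open>In matrix form, A^{-1} - B A^{-1} B^T = P (A_c^{-1} - X A_c^{-1} X^T) P^T with A_c the
  coarse matrix. Thus coarse noise that preserves A_c^{-1} under X becomes, once prolonged, noise
  that preserves A^{-1} under B.\<close>

lemma coarse_noise_covariance:
  assumes a: "a \<in> carrier_vec (n (Suc l))" and b: "b \<in> carrier_vec (n (Suc l))"
  defines "p \<equiv> transpose_mat (P (Suc l)) *\<^sub>v a" and "q \<equiv> transpose_mat (P (Suc l)) *\<^sub>v b"
  shows "a \<bullet> (Ai (Suc l) *\<^sub>v b)
      - (transpose_mat (B l) *\<^sub>v a) \<bullet> (Ai (Suc l) *\<^sub>v (transpose_mat (B l) *\<^sub>v b))
    = p \<bullet> (Ai l *\<^sub>v q) - (transpose_mat (X l) *\<^sub>v p) \<bullet> (Ai l *\<^sub>v (transpose_mat (X l) *\<^sub>v q))"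
proof -
  let ?A = "A (Suc l)" and ?P = "P (Suc l)" and ?K = "Ai (Suc l)"
  define p2 q2 where "p2 = transpose_mat (X l) *\<^sub>v p" and "q2 = transpose_mat (X l) *\<^sub>v q"
  have pq: "p \<in> carrier_vec (n l)" "q \<in> carrier_vec (n l)" "p2 \<in> carrier_vec (n l)" "q2 \<in> carrier_vec (n l)"
    unfolding p2_def q2_def p_def q_def using a b by (auto intro!: vec_carriers)
  define y z where "y = Ai l *\<^sub>v (p - p2)" and "z = Ai l *\<^sub>v (q - q2)"
  have yz: "y \<in> carrier_vec (n l)" "z \<in> carrier_vec (n l)" unfolding y_def z_def using pq by (auto intro!: vec_carriers)
  have c: "?P *\<^sub>v y \<in> carrier_vec (n (Suc l))" "?P *\<^sub>v z \<in> carrier_vec (n (Suc l))"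
    "?A *\<^sub>v (?P *\<^sub>v y) \<in> carrier_vec (n (Suc l))" "?A *\<^sub>v (?P *\<^sub>v z) \<in> carrier_vec (n (Suc l))"
    "?K *\<^sub>v b \<in> carrier_vec (n (Suc l))"
    using yz b by (auto intro!: vec_carriers)
  have Ai: "sym_mat (n l) (Ai l)" using mat_inv_sym[OF A_sym A_det] .
  have Kb: "?K *\<^sub>v (b - ?A *\<^sub>v (?P *\<^sub>v z)) = ?K *\<^sub>v b - ?P *\<^sub>v z"
  proof -
    have "?K *\<^sub>v (b - ?A *\<^sub>v (?P *\<^sub>v z)) = ?K *\<^sub>v b - ?K *\<^sub>v (?A *\<^sub>v (?P *\<^sub>v z))"
      using b c by (intro mat_vec_minus) simp_all
    then show ?thesis unfolding mat_inv_vec_left[OF A_carrier A_det c(2)] .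
  qed
  have B: "transpose_mat (B l) *\<^sub>v a = a - ?A *\<^sub>v (?P *\<^sub>v y)" "transpose_mat (B l) *\<^sub>v b = b - ?A *\<^sub>v (?P *\<^sub>v z)"
    using transpose_B_vec[OF a] transpose_B_vec[OF b] by (simp_all add: y_def z_def p2_def q2_def p_def q_def)
  have 1: "a \<bullet> (?P *\<^sub>v z) = p \<bullet> z" unfolding p_def using scalar_prod_mat_transpose[OF P_carrier a yz(2)] .
  have 2: "(?A *\<^sub>v (?P *\<^sub>v y)) \<bullet> (?K *\<^sub>v b) = y \<bullet> q"
  proof -
    have "(?A *\<^sub>v (?P *\<^sub>v y)) \<bullet> (?K *\<^sub>v b) = (?P *\<^sub>v y) \<bullet> b"
      using sym_mat_scalar_prod[OF A_sym c(1) c(5)] mat_inv_vec_right[OF A_carrier A_det b] by simp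
    also have "\<dots> = b \<bullet> (?P *\<^sub>v y)" using comm_scalar_prod[OF c(1) b] .
    also have "\<dots> = q \<bullet> y" unfolding q_def using scalar_prod_mat_transpose[OF P_carrier b yz(1)] .
    finally show ?thesis using comm_scalar_prod[OF yz(1) pq(2)] by simp
  qed
  \<comment> \<open>The Galerkin relation enters here: the fine energy product of prolonged vectors
    is the coarse one.\<close>
  have 3: "(?A *\<^sub>v (?P *\<^sub>v y)) \<bullet> (?P *\<^sub>v z) = y \<bullet> (q - q2)"
  proof -
    have "(?A *\<^sub>v (?P *\<^sub>v y)) \<bullet> (?P *\<^sub>v z) = (?P *\<^sub>v y) \<bullet> (?A *\<^sub>v (?P *\<^sub>v z))"
      using sym_mat_scalar_prod[OF A_sym c(1,2)] .
    also have "\<dots> = y \<bullet> (A l *\<^sub>v coarse l (?P *\<^sub>v z))" using prolong_scalar_prod(1)[OF yz(1) c(2)] .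
    also have "A l *\<^sub>v coarse l (?P *\<^sub>v z) = A l *\<^sub>v z" using restrict_eq[OF c(2)] galerkin_vec[OF yz(2)] by simp
    also have "\<dots> = q - q2" unfolding z_def using mat_inv_vec_right[OF A_carrier A_det, of "q - q2"] pq by simp
    finally show ?thesis .
  qed
  have yr: "y \<bullet> v = (p - p2) \<bullet> (Ai l *\<^sub>v v)" if "v \<in> carrier_vec (n l)" for v
    unfolding y_def using sym_mat_scalar_prod[OF Ai _ that, of "p - p2"] pq by simp
  have "(transpose_mat (B l) *\<^sub>v a) \<bullet> (?K *\<^sub>v (transpose_mat (B l) *\<^sub>v b))
      = a \<bullet> (?K *\<^sub>v b) - a \<bullet> (?P *\<^sub>v z) - ((?A *\<^sub>v (?P *\<^sub>v y)) \<bullet> (?K *\<^sub>v b) - (?A *\<^sub>v (?P *\<^sub>v y)) \<bullet> (?P *\<^sub>v z))"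
    unfolding B Kb
    using minus_scalar_prod_distrib[OF a c(3) minus_carrier_vec[OF c(5,2)]]
      scalar_prod_minus_distrib[OF a c(5,2)] scalar_prod_minus_distrib[OF c(3) c(5,2)] by simp
  also have "\<dots> = a \<bullet> (?K *\<^sub>v b) - p \<bullet> z - y \<bullet> q2"
    unfolding 1 2 3 using scalar_prod_minus_distrib[OF yz(1) pq(2,4)] by simp
  \<comment> \<open>Expanding y and z, the mixed terms p . A_c^{-1} q2 cancel and only the two pure
    terms remain.\<close>
  also have "\<dots> = a \<bullet> (?K *\<^sub>v b) - (p \<bullet> (Ai l *\<^sub>v q) - p2 \<bullet> (Ai l *\<^sub>v q2))"
    unfolding yr[OF pq(4)] z_def using pq by (simp add: mat_vec_minus scalar_prod_minus_left scalar_prod_minus_right)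
  finally show ?thesis by (simp add: p2_def q2_def)
qed

end

section \<open>Second moments of the chain driven by its draws\<close>

locale mgmc_run = multigrid n A P M \<nu>1 \<nu>2 + uncorrelated_vectors Q W "draw_dim n L" "draws L (\<nu>1 + \<nu>2)"
  for n A P M \<nu>1 \<nu>2 and Q :: "'w measure" and W L +
  assumes cov_coarse: "a \<in> carrier_vec (n 0) \<Longrightarrow> b \<in> carrier_vec (n 0) \<Longrightarrow>
      cov Q (\<lambda>w. a \<bullet> W (Coarse m) w) (\<lambda>w. b \<bullet> W (Coarse m) w) = a \<bullet> (mat_inv (A 0) *\<^sub>v b)"
    and cov_smooth: "1 \<le> l \<Longrightarrow> l \<le> L \<Longrightarrow> j < \<nu>1 + \<nu>2 \<Longrightarrow> a \<in> carrier_vec (n l) \<Longrightarrow> b \<in> carrier_vec (n l) \<Longrightarrow>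
      cov Q (\<lambda>w. a \<bullet> W (Smooth m l j) w) (\<lambda>w. b \<bullet> W (Smooth m l j) w)
        = a \<bullet> ((M l + transpose_mat (M l) - A l) *\<^sub>v b)"
begin

definition cycle_draws :: "nat \<Rightarrow> nat \<Rightarrow> draw set" where
  "cycle_draws m l = insert (Coarse m) {Smooth m l' j | l' j. 1 \<le> l' \<and> l' \<le> l \<and> j < \<nu>1 + \<nu>2}"

definition noise :: "nat \<Rightarrow> nat \<Rightarrow> 'w \<Rightarrow> real Matrix.vec" where
  "noise m l w = cycle_noise (\<lambda>l j. W (Smooth m l j) w) (W (Coarse m) w) l"

lemma admissible_draws:
  assumes "l \<le> L" "w \<in> space Q"
  shows "admissible_noise (\<lambda>l j. W (Smooth m l j) w) (W (Coarse m) w) l"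
  unfolding admissible_noise_def
proof (intro conjI allI impI)
  show "W (Coarse m) w \<in> carrier_vec (n 0)" using W_carrier[of "Coarse m" w] assms by (simp add: draws_def)
  fix l' j assume "1 \<le> l'" "l' \<le> l" "j < \<nu>1 + \<nu>2"
  then show "W (Smooth m l' j) w \<in> carrier_vec (n l')"
    using W_carrier[of "Smooth m l' j" w] assms by (simp add: draws_def)
qed

text \<open>On level 0 the iteration matrix is zero, so the invariant covariance is that of the
  exact coarse sample. Each further level composes pre-smoothing, prolonged coarse noise and
  post-smoothing, which use disjoint draws.\<close>

lemma invariant_noise_cycle:
  assumes "l \<le> L"
  shows "invariant_noise (cycle_draws m l) (n l) (Ai l) (X l) (noise m l)"
  using assms
proof (induction l)
  case 0
  have I: "Coarse m \<in> draws L (\<nu>1 + \<nu>2)" by (simp add: draws_def)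
  have "affine_vec_in {Coarse m} (n 0) (W (Coarse m))"
    using affine_vec_in_vector[of "Coarse m" "{Coarse m}"] I by simp
  moreover have "transpose_mat (X 0) *\<^sub>v v = 0\<^sub>v (n 0)" if "v \<in> carrier_vec (n 0)" for v
    using that by (intro eq_vecI) auto
  ultimately have "invariant_noise {Coarse m} (n 0) (Ai 0) (X 0) (W (Coarse m))"
    unfolding invariant_noise_def using cov_coarse vec_carriers(2)[of _ 0]
    by (simp add: mat_vec_zero[OF Ai_carrier] del: iteration_mat.simps)
  moreover have "cycle_draws m 0 = {Coarse m}" by (auto simp: cycle_draws_def)
  moreover have "noise m 0 w = W (Coarse m) w" if "w \<in> space Q" for w
    using W_carrier[OF I that] by (simp add: noise_def mat_vec_zero[OF Ai_carrier])
  ultimately show ?case by (metis (no_types, lifting) invariant_noise_cong)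
next
  case (Suc l)
  let ?n = "n (Suc l)" and ?K = "Ai (Suc l)"
  have IH: "invariant_noise (cycle_draws m l) (n l) (Ai l) (X l) (noise m l)" using Suc by simp
  let ?d1 = "\<lambda>j. Smooth m (Suc l) j" and ?d2 = "\<lambda>j. Smooth m (Suc l) (\<nu>1 + j)"
  have E1: "invariant_noise (?d1 ` {..<\<nu>1}) ?n ?K (S (Suc l) ^\<^sub>m \<nu>1) (\<lambda>w. smoothing_noise (Suc l) \<nu>1 (\<lambda>j. W (?d1 j) w))"
    by (rule invariant_noise_smoothing[OF smoother])
      (use Suc.prems cov_smooth in \<open>auto simp: draws_def inj_on_def\<close>)
  have E2: "invariant_noise (?d2 ` {..<\<nu>2}) ?n ?K (S (Suc l) ^\<^sub>m \<nu>2) (\<lambda>w. smoothing_noise (Suc l) \<nu>2 (\<lambda>j. W (?d2 j) w))"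
    by (rule invariant_noise_smoothing[OF smoother])
      (use Suc.prems cov_smooth in \<open>auto simp: draws_def inj_on_def\<close>)
  have PN: "invariant_noise (cycle_draws m l) ?n ?K (B l) (\<lambda>w. P (Suc l) *\<^sub>v noise m l w)"
  proof (rule invariant_noise_mat[OF _ P_carrier])
    show "affine_vec_in (cycle_draws m l) (n l) (noise m l)" using IH by (simp add: invariant_noise_def)
    fix a b :: "real Matrix.vec" assume ab: "a \<in> carrier_vec ?n" "b \<in> carrier_vec ?n"
    show "cov Q (\<lambda>w. (transpose_mat (P (Suc l)) *\<^sub>v a) \<bullet> noise m l w) (\<lambda>w. (transpose_mat (P (Suc l)) *\<^sub>v b) \<bullet> noise m l w)
      = a \<bullet> (?K *\<^sub>v b) - (transpose_mat (B l) *\<^sub>v a) \<bullet> (?K *\<^sub>v (transpose_mat (B l) *\<^sub>v b))"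
      unfolding coarse_noise_covariance[OF ab] using IH vec_carriers(5)[OF ab(1)] vec_carriers(5)[OF ab(2)]
      by (simp add: invariant_noise_def)
  qed
  have d1: "?d1 ` {..<\<nu>1} \<inter> cycle_draws m l = {}" by (auto simp: cycle_draws_def)
  have Sk: "S (Suc l) ^\<^sub>m k \<in> carrier_mat ?n ?n" for k by simp
  have C: "invariant_noise (?d1 ` {..<\<nu>1} \<union> cycle_draws m l) ?n ?K (B l * S (Suc l) ^\<^sub>m \<nu>1)
      (\<lambda>w. B l *\<^sub>v smoothing_noise (Suc l) \<nu>1 (\<lambda>j. W (?d1 j) w) + P (Suc l) *\<^sub>v noise m l w)"
    by (rule invariant_noise_compose[OF E1 PN d1 Sk B_carrier])
  have d2: "(?d1 ` {..<\<nu>1} \<union> cycle_draws m l) \<inter> ?d2 ` {..<\<nu>2} = {}" by (auto simp: cycle_draws_def)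
  have inv: "invariant_noise (?d1 ` {..<\<nu>1} \<union> cycle_draws m l \<union> ?d2 ` {..<\<nu>2}) ?n ?K (S (Suc l) ^\<^sub>m \<nu>2 * (B l * S (Suc l) ^\<^sub>m \<nu>1))
      (\<lambda>w. S (Suc l) ^\<^sub>m \<nu>2 *\<^sub>v (B l *\<^sub>v smoothing_noise (Suc l) \<nu>1 (\<lambda>j. W (?d1 j) w) + P (Suc l) *\<^sub>v noise m l w)
        + smoothing_noise (Suc l) \<nu>2 (\<lambda>j. W (?d2 j) w))"
    by (rule invariant_noise_compose[OF C E2 d2 mult_carrier_mat[OF B_carrier Sk] Sk])
  have mat: "S (Suc l) ^\<^sub>m \<nu>2 * (B l * S (Suc l) ^\<^sub>m \<nu>1) = X (Suc l)"
    unfolding X_Suc by (rule assoc_mult_mat[symmetric, OF Sk B_carrier Sk])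
  have set: "?d1 ` {..<\<nu>1} \<union> cycle_draws m l \<union> ?d2 ` {..<\<nu>2} = cycle_draws m (Suc l)" (is "?L = ?R")
  proof
    show "?L \<subseteq> ?R" by (auto simp: cycle_draws_def)
    show "?R \<subseteq> ?L"
    proof
      fix d assume d: "d \<in> ?R"
      show "d \<in> ?L"
      proof (cases "d \<in> cycle_draws m l")
        case False
        then obtain j where j: "d = Smooth m (Suc l) j" "j < \<nu>1 + \<nu>2" using d by (auto simp: cycle_draws_def le_Suc_eq)
        show ?thesis
        proof (cases "j < \<nu>1")
          case False
          then have "d = ?d2 (j - \<nu>1)" "j - \<nu>1 < \<nu>2" using j by auto
          then show ?thesis by blast
        qed (use j in blast)
      qed simp
    qed
  qed
  have eq: "noise m (Suc l) w = S (Suc l) ^\<^sub>m \<nu>2 *\<^sub>v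
      (B l *\<^sub>v smoothing_noise (Suc l) \<nu>1 (\<lambda>j. W (?d1 j) w) + P (Suc l) *\<^sub>v noise m l w)
        + smoothing_noise (Suc l) \<nu>2 (\<lambda>j. W (?d2 j) w)" if "w \<in> space Q" for w
    unfolding noise_def using cycle_noise_Suc[OF admissible_draws[OF Suc.prems that]] by simp
  show ?case by (rule invariant_noise_cong[OF inv[unfolded mat set] eq])
qed

definition past_draws :: "nat \<Rightarrow> draw set" where
  "past_draws m = insert Initial (\<Union>m'<m. cycle_draws m' L)"

lemma past_draws_Suc: "past_draws (Suc m) = past_draws m \<union> cycle_draws m L"
  by (auto simp: past_draws_def lessThan_Suc)

text \<open>The state at time m consumes updates 0 to m - 1, so update k is fresh for it already
  when k = m.\<close>

lemma past_draws_disjoint: "m \<le> k \<Longrightarrow> past_draws m \<inter> cycle_draws k L = {}"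
  by (auto simp: past_draws_def cycle_draws_def)

context
  fixes f :: "real Matrix.vec"
  assumes f: "f \<in> carrier_vec (n L)"
begin

abbreviation chain :: "nat \<Rightarrow> 'w \<Rightarrow> real Matrix.vec" where
  "chain \<equiv> mgmc_chain A P M \<nu>1 \<nu>2 W L f"

text \<open>The constant term (I - X) A^{-1} f of the affine recursion; it moves means and leaves
  covariances unchanged.\<close>

abbreviation shift :: "real Matrix.vec" where
  "shift \<equiv> Ai L *\<^sub>v f - X L *\<^sub>v (Ai L *\<^sub>v f)"

lemma shift_carrier: "shift \<in> carrier_vec (n L)"
  using f by (intro minus_carrier_vec vec_carriers)

lemma noise_affine: "affine_vec_in (cycle_draws m L) (n L) (noise m L)"
  using invariant_noise_cycle[OF order_refl] by (simp add: invariant_noise_def)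

lemma chain_Suc:
  assumes "w \<in> space Q" "chain m w \<in> carrier_vec (n L)"
  shows "chain (Suc m) w = shift + X L *\<^sub>v chain m w + noise m L w"
proof -
  let ?N = "noise m L w" and ?u = "Ai L *\<^sub>v f"
  have u: "?u \<in> carrier_vec (n L)" using f by (rule vec_carriers)
  have c: "X L *\<^sub>v ?u \<in> carrier_vec (n L)" "X L *\<^sub>v chain m w \<in> carrier_vec (n L)"
    using u assms by (auto intro!: vec_carriers)
  have N: "?N \<in> carrier_vec (n L)" unfolding noise_def using cycle_noise_carrier[OF admissible_draws[OF order_refl assms(1)]] .
  have "chain (Suc m) w = ?u + X L *\<^sub>v (chain m w - ?u) + ?N"
    using cycle_affine[OF admissible_draws[OF order_refl assms(1)] f assms(2)] by (simp add: noise_def)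
  also have "X L *\<^sub>v (chain m w - ?u) = X L *\<^sub>v chain m w - X L *\<^sub>v ?u" using u assms by (intro mat_vec_minus) auto
  also have "?u + (X L *\<^sub>v chain m w - X L *\<^sub>v ?u) + ?N = shift + X L *\<^sub>v chain m w + ?N"
    using u c N by (intro eq_vecI) (simp_all del: index_mult_mat_vec)
  finally show ?thesis .
qed

lemma chain_affine: "affine_vec_in (past_draws m) (n L) (chain m)"
proof (induction m)
  case 0
  have "Initial \<in> past_draws 0" "Initial \<in> draws L (\<nu>1 + \<nu>2)" by (auto simp: past_draws_def draws_def)
  from affine_vec_in_vector[OF this] show ?case by simp
next
  case (Suc m)
  show ?case unfolding past_draws_Suc
    by (rule affine_vec_in_cong[OF affine_vec_in_step[OF Suc noise_affine X_carrier shift_carrier]])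
      (use Suc chain_Suc in \<open>auto simp: affine_vec_in_def simp del: mgmc_chain.simps\<close>)
qed

lemma chain_carrier: "w \<in> space Q \<Longrightarrow> chain m w \<in> carrier_vec (n L)"
  using chain_affine by (simp add: affine_vec_in_def)

lemma XT_carrier: "transpose_mat (X L) ^\<^sub>m m \<in> carrier_mat (n L) (n L)" "transpose_mat (X L) \<in> carrier_mat (n L) (n L)"
  by (auto intro!: pow_carrier_mat)

text \<open>One update sends a covariance K to X K X^T + A^{-1} - X A^{-1} X^T, so the deviation K -
  A^{-1} is merely conjugated by X. The functionals vary in the induction because each step
  transposes X onto them.\<close>

lemma chain_cov:
  assumes \<Sigma>: "\<Sigma> \<in> carrier_mat (n L) (n L)"
    and init: "\<And>a b. a \<in> carrier_vec (n L) \<Longrightarrow> b \<in> carrier_vec (n L) \<Longrightarrow>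
      cov Q (\<lambda>w. a \<bullet> W Initial w) (\<lambda>w. b \<bullet> W Initial w) = a \<bullet> (\<Sigma> *\<^sub>v b)"
    and "a \<in> carrier_vec (n L)" "b \<in> carrier_vec (n L)"
  shows "cov Q (\<lambda>w. a \<bullet> chain m w) (\<lambda>w. b \<bullet> chain m w)
    = a \<bullet> (Ai L *\<^sub>v b) + (transpose_mat (X L) ^\<^sub>m m *\<^sub>v a) \<bullet> ((\<Sigma> - Ai L) *\<^sub>v (transpose_mat (X L) ^\<^sub>m m *\<^sub>v b))"
  using assms(3,4)
proof (induction m arbitrary: a b)
  case 0
  have "a \<bullet> (\<Sigma> *\<^sub>v b) = a \<bullet> (Ai L *\<^sub>v b) + a \<bullet> ((\<Sigma> - Ai L) *\<^sub>v b)"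
    using 0 \<Sigma> by (simp add: mat_minus_vec scalar_prod_minus_right)
  then show ?case using 0 init by simp
next
  case (Suc m)
  let ?T = "transpose_mat (X L)"
  have T: "?T *\<^sub>v a \<in> carrier_vec (n L)" "?T *\<^sub>v b \<in> carrier_vec (n L)" using Suc.prems by (auto intro!: vec_carriers)
  have "cov Q (\<lambda>w. a \<bullet> chain (Suc m) w) (\<lambda>w. b \<bullet> chain (Suc m) w)
      = cov Q (\<lambda>w. a \<bullet> (shift + X L *\<^sub>v chain m w + noise m L w)) (\<lambda>w. b \<bullet> (shift + X L *\<^sub>v chain m w + noise m L w))"
    using chain_Suc chain_carrier by (intro cov_cong) (auto simp del: mgmc_chain.simps)
  also have "\<dots> = cov Q (\<lambda>w. (?T *\<^sub>v a) \<bullet> chain m w) (\<lambda>w. (?T *\<^sub>v b) \<bullet> chain m w)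
      + cov Q (\<lambda>w. a \<bullet> noise m L w) (\<lambda>w. b \<bullet> noise m L w)"
    by (rule cov_affine_step[OF chain_affine noise_affine past_draws_disjoint[OF order_refl] X_carrier shift_carrier Suc.prems])
  also have "cov Q (\<lambda>w. a \<bullet> noise m L w) (\<lambda>w. b \<bullet> noise m L w) = a \<bullet> (Ai L *\<^sub>v b) - (?T *\<^sub>v a) \<bullet> (Ai L *\<^sub>v (?T *\<^sub>v b))"
    using invariant_noise_cycle[OF order_refl] Suc.prems by (simp add: invariant_noise_def)
  finally show ?case
    unfolding Suc.IH[OF T] pow_mat_vec_Suc_right[OF XT_carrier(2) Suc.prems(1)] pow_mat_vec_Suc_right[OF XT_carrier(2) Suc.prems(2)]
    by simp
qed

text \<open>Noise of updates from time m on is uncorrelated with the state at time m, so peeling off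
  the last update leaves only X, which is transposed onto the functional.\<close>

lemma chain_cov_lag:
  assumes "a \<in> carrier_vec (n L)" "b \<in> carrier_vec (n L)"
  shows "cov Q (\<lambda>w. a \<bullet> chain (m + s) w) (\<lambda>w. b \<bullet> chain m w)
    = cov Q (\<lambda>w. (transpose_mat (X L) ^\<^sub>m s *\<^sub>v a) \<bullet> chain m w) (\<lambda>w. b \<bullet> chain m w)"
  using assms(1)
proof (induction s arbitrary: a)
  case (Suc s)
  let ?T = "transpose_mat (X L)" and ?k = "m + s"
  let ?V = "\<lambda>w. b \<bullet> chain m w" and ?U = "\<lambda>w. (?T *\<^sub>v a) \<bullet> chain ?k w" and ?N = "\<lambda>w. a \<bullet> noise ?k L w"
  have T: "?T *\<^sub>v a \<in> carrier_vec (n L)" using Suc.prems by (rule vec_carriers)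
  have V: "affine_in (past_draws m) ?V" and U: "affine_in (past_draws ?k) ?U" and N: "affine_in (cycle_draws ?k L) ?N"
    using chain_affine noise_affine T assms(2) Suc.prems by (auto simp: affine_vec_in_def)
  note sq = affine_in_sq_integrable[OF V] affine_in_sq_integrable[OF U] affine_in_sq_integrable[OF N]
  have eq: "a \<bullet> chain (Suc ?k) w = (a \<bullet> shift + ?U w) + ?N w" if "w \<in> space Q" for w
  proof -
    have c: "chain ?k w \<in> carrier_vec (n L)" using chain_carrier[OF that] .
    have N: "noise ?k L w \<in> carrier_vec (n L)" using noise_affine that by (simp add: affine_vec_in_def)
    have Xc: "X L *\<^sub>v chain ?k w \<in> carrier_vec (n L)" using c by (rule vec_carriers)
    show ?thesis unfolding chain_Suc[OF that c] scalar_prod_mat_transpose[OF X_carrier Suc.prems c, symmetric]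
      using scalar_prod_add_distrib[OF Suc.prems add_carrier_vec[OF shift_carrier Xc] N]
        scalar_prod_add_distrib[OF Suc.prems shift_carrier Xc] by simp
  qed
  have "cov Q (\<lambda>w. a \<bullet> chain (Suc ?k) w) ?V = cov Q (\<lambda>w. (a \<bullet> shift + ?U w) + ?N w) ?V"
    using eq by (intro cov_cong) auto
  also have "\<dots> = cov Q (\<lambda>w. a \<bullet> shift + ?U w) ?V + cov Q ?N ?V"
    by (rule cov_add_left[OF sq_integrable_add[OF sq_integrable_const sq(2)] sq(3,1)])
  also have "cov Q (\<lambda>w. a \<bullet> shift + ?U w) ?V = cov Q (\<lambda>_. a \<bullet> shift) ?V + cov Q ?U ?V"
    by (rule cov_add_left[OF sq_integrable_const sq(2,1)])
  also have "cov Q (\<lambda>_. a \<bullet> shift) ?V = 0" by (rule cov_const)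
  also have "cov Q ?N ?V = 0"
    using affine_in_uncorrelated[OF N V] past_draws_disjoint[of m ?k] by (simp add: Int_commute)
  finally have "cov Q (\<lambda>w. a \<bullet> chain (Suc ?k) w) ?V = cov Q ?U ?V" by simp
  then show ?case unfolding pow_mat_vec_Suc_right[OF XT_carrier(2) Suc.prems] Suc.IH[OF T, symmetric] by simp
qed simp

end

end

section \<open>Integrated autocorrelation times\<close>

text \<open>The series starts at lag one, whence the factor r in the numerator.\<close>

lemma shifted_geometric_series:
  fixes x :: "nat \<Rightarrow> real"
  assumes "0 \<le> r" "r < 1" and x: "\<And>s. \<bar>x s\<bar> \<le> K * r ^ s"
  shows "summable (\<lambda>s. x (Suc s))" "\<bar>\<Sum>s. x (Suc s)\<bar> \<le> K * r / (1 - r)"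
proof -
  have g: "summable (\<lambda>s. K * r * r ^ s)" using assms by (intro summable_mult summable_geometric) simp
  have le: "norm (x (Suc s)) \<le> K * r * r ^ s" for s using x[of "Suc s"] by (simp add: mult.assoc)
  show s: "summable (\<lambda>s. x (Suc s))" using le by (intro summable_comparison_test[OF _ g]) auto
  have "\<bar>\<Sum>s. x (Suc s)\<bar> \<le> (\<Sum>s. K * r * r ^ s)" using norm_suminf_le[OF le g] by simp
  also have "\<dots> = K * r / (1 - r)" using assms by (subst suminf_mult) (auto simp: suminf_geometric intro: summable_geometric)
  finally show "\<bar>\<Sum>s. x (Suc s)\<bar> \<le> K * r / (1 - r)" .
qed

text \<open>Here \<open>a\<close> holds the limiting covariances and \<open>b\<close> the remainder
  due to the initial state. Put q = r^(2m), which is below 1 because m \<ge> 1. The one-sided bound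
  on b 0 keeps the variance above (1 - q) a 0, and the difference of the two quotients has numerator
  b s * a 0 - a s * b 0, at most 2 K q r^s (a 0)^2. Summation over lags and the factor 2 in front of
  the series give 4 K.\<close>

lemma autocorrelation_perturbation:
  fixes a b :: "nat \<Rightarrow> real"
  assumes r: "0 \<le> r" "r < 1" and a0: "0 < a 0" and m: "1 \<le> m" and "0 \<le> K"
    and a: "\<And>s. \<bar>a s\<bar> \<le> r ^ s * a 0"
    and b: "\<And>s. \<bar>b s\<bar> \<le> K * r ^ (2 * m + s) * a 0" and b0: "- (r ^ (2 * m)) * a 0 \<le> b 0"
  shows "0 < a 0 + b 0" "summable (\<lambda>s. (a (Suc s) + b (Suc s)) / (a 0 + b 0))"
    "\<bar>(1 + 2 * (\<Sum>s. (a (Suc s) + b (Suc s)) / (a 0 + b 0))) - (1 + 2 * (\<Sum>s. a (Suc s) / a 0))\<bar>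
      \<le> 4 * K * (r ^ (2 * m + 1) / ((1 - r) * (1 - r ^ (2 * m))))"
proof -
  define q where "q = r ^ (2 * m)"
  have q: "0 \<le> q" "q < 1" unfolding q_def using r m power_Suc_less_one[of r "2 * m - 1"]
    by (auto simp: power_le_one_iff power_less_one_iff)
  have low: "(1 - q) * a 0 \<le> a 0 + b 0" using b0 unfolding q_def by (simp add: algebra_simps)
  moreover have "0 < (1 - q) * a 0" using q a0 by simp
  ultimately show pos: "0 < a 0 + b 0" by linarith
  have sa: "summable (\<lambda>s. a (Suc s) / a 0)"
  proof (rule shifted_geometric_series(1)[OF r, where x = "\<lambda>s. a s / a 0" and K = 1])
    show "\<bar>a s / a 0\<bar> \<le> 1 * r ^ s" for s using a[of s] a0 by (simp add: field_simps)
  qed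
  define d where "d s = (a s + b s) / (a 0 + b 0) - a s / a 0" for s
  have d: "\<bar>d s\<bar> \<le> (2 * K * q / (1 - q)) * r ^ s" for s
  proof -
    have eq: "d s = (b s * a 0 - a s * b 0) / (a 0 * (a 0 + b 0))"
      unfolding d_def using a0 pos by (simp add: field_simps)
    have "\<bar>b s * a 0 - a s * b 0\<bar> \<le> \<bar>b s\<bar> * a 0 + \<bar>a s\<bar> * \<bar>b 0\<bar>"
      using a0 by (intro order_trans[OF abs_triangle_ineq4]) (simp add: abs_mult)
    also have "\<dots> \<le> (K * r ^ (2 * m + s) * a 0) * a 0 + (r ^ s * a 0) * (K * r ^ (2 * m + 0) * a 0)"
    proof (rule add_mono)
      show "\<bar>b s\<bar> * a 0 \<le> (K * r ^ (2 * m + s) * a 0) * a 0" using b a0 by (intro mult_right_mono) auto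
      show "\<bar>a s\<bar> * \<bar>b 0\<bar> \<le> (r ^ s * a 0) * (K * r ^ (2 * m + 0) * a 0)"
        using a0 r by (intro mult_mono[OF a b]) auto
    qed
    also have "\<dots> = 2 * K * q * r ^ s * a 0 * a 0" by (simp add: q_def power_add algebra_simps)
    finally have num: "\<bar>b s * a 0 - a s * b 0\<bar> \<le> 2 * K * q * r ^ s * a 0 * a 0" .
    have den: "a 0 * ((1 - q) * a 0) \<le> a 0 * (a 0 + b 0)" using low a0 by (intro mult_left_mono) auto
    have "\<bar>d s\<bar> = \<bar>b s * a 0 - a s * b 0\<bar> / (a 0 * (a 0 + b 0))" unfolding eq using a0 pos by (simp add: abs_mult)
    also have "\<dots> \<le> (2 * K * q * r ^ s * a 0 * a 0) / (a 0 * ((1 - q) * a 0))"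
      using num den q a0 r \<open>0 \<le> K\<close> by (intro frac_le) auto
    also have "\<dots> = (2 * K * q / (1 - q)) * r ^ s" using a0 q by (simp add: field_simps)
    finally show ?thesis .
  qed
  note D = shifted_geometric_series[OF r d]
  have "summable (\<lambda>s. d (Suc s) + a (Suc s) / a 0)" using summable_add[OF D(1) sa] .
  then show S: "summable (\<lambda>s. (a (Suc s) + b (Suc s)) / (a 0 + b 0))" by (simp add: d_def)
  have "(\<Sum>s. (a (Suc s) + b (Suc s)) / (a 0 + b 0)) - (\<Sum>s. a (Suc s) / a 0) = (\<Sum>s. d (Suc s))"
    unfolding d_def using suminf_diff[OF S sa] .
  then have "\<bar>(1 + 2 * (\<Sum>s. (a (Suc s) + b (Suc s)) / (a 0 + b 0))) - (1 + 2 * (\<Sum>s. a (Suc s) / a 0))\<bar>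
      = 2 * \<bar>\<Sum>s. d (Suc s)\<bar>" by (simp add: algebra_simps abs_mult flip: right_diff_distrib)
  also have "\<dots> \<le> 2 * ((2 * K * q / (1 - q)) * r / (1 - r))" using D(2) by simp
  also have "\<dots> = 4 * K * (r ^ (2 * m + 1) / ((1 - r) * (1 - r ^ (2 * m))))"
    by (simp add: q_def mult_ac)
  finally show "\<bar>(1 + 2 * (\<Sum>s. (a (Suc s) + b (Suc s)) / (a 0 + b 0))) - (1 + 2 * (\<Sum>s. a (Suc s) / a 0))\<bar>
      \<le> 4 * K * (r ^ (2 * m + 1) / ((1 - r) * (1 - r ^ (2 * m))))" .
qed

section \<open>Energy decay of the symmetric cycle and the limiting autocorrelations\<close>

locale symmetric_multigrid = multigrid n A P M k k for n A P M and k :: nat +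
  assumes k: "0 < k"
    and loewner: "loewner_le (n (Suc l)) (A (Suc l)) (M (Suc l))"
begin

abbreviation rate :: "nat \<Rightarrow> real" where "rate l \<equiv> energy_norm (A l) (X l)"

lemma rate_nonneg: "0 \<le> rate l"
  by (simp add: energy_norm_def norm2_mat_nonneg)

lemma rate_less_1:
  assumes "1 \<le> l" "0 < n l"
  shows "rate l < 1"
proof -
  obtain l' where l: "l = Suc l'" using assms by (cases l) auto
  show ?thesis
  proof (rule energy_norm_less_1[OF A_spd X_carrier assms(2)])
    fix v :: "real Matrix.vec" assume v: "v \<in> carrier_vec (n l)" "v \<noteq> 0\<^sub>v (n l)"
    have "contractive (n l) (A l) (X l)" unfolding l by (rule contractive_X_Suc[OF loewner k])
    then show "energy_vec (A l) (X l *\<^sub>v v) < energy_vec (A l) v"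
      using v unfolding contractive_def energy_vec_def by (intro real_sqrt_less_mono) blast
  qed
qed

lemma energy_vec_nonneg: "v \<in> carrier_vec (n l) \<Longrightarrow> 0 \<le> energy_vec (A l) v"
  unfolding energy_vec_def using spd_mat_nonneg[OF A_spd] by simp

lemma energy_vec_square: "v \<in> carrier_vec (n l) \<Longrightarrow> energy_vec (A l) v * energy_vec (A l) v = v \<bullet> (A l *\<^sub>v v)"
  unfolding energy_vec_def using spd_mat_nonneg[OF A_spd] by simp

lemma X_pow_carrier: "v \<in> carrier_vec (n l) \<Longrightarrow> X l ^\<^sub>m s *\<^sub>v v \<in> carrier_vec (n l)"
  by (intro mult_mat_vec_carrier[of _ "n l" "n l"] pow_carrier_mat X_carrier)

lemma energy_vec_X_pow:
  assumes v: "v \<in> carrier_vec (n l)"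
  shows "energy_vec (A l) (X l ^\<^sub>m s *\<^sub>v v) \<le> rate l ^ s * energy_vec (A l) v"
proof (induction s)
  case 0
  then show ?case using v by simp
next
  case (Suc s)
  have "energy_vec (A l) (X l *\<^sub>v (X l ^\<^sub>m s *\<^sub>v v)) \<le> rate l * energy_vec (A l) (X l ^\<^sub>m s *\<^sub>v v)"
    by (rule energy_norm_vec_le[OF A_spd X_carrier X_pow_carrier[OF v]])
  also have "\<dots> \<le> rate l * (rate l ^ s * energy_vec (A l) v)" using Suc rate_nonneg by (intro mult_left_mono) auto
  finally show ?case unfolding pow_mat_vec_Suc_left[OF X_carrier v] by (simp add: mult.assoc)
qed

lemma energy_autocorrelation_le:
  assumes v: "v \<in> carrier_vec (n l)"
  shows "\<bar>v \<bullet> (A l *\<^sub>v (X l ^\<^sub>m s *\<^sub>v v))\<bar> \<le> rate l ^ s * (v \<bullet> (A l *\<^sub>v v))"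
proof -
  have "\<bar>v \<bullet> (A l *\<^sub>v (X l ^\<^sub>m s *\<^sub>v v))\<bar> \<le> energy_vec (A l) v * energy_vec (A l) (X l ^\<^sub>m s *\<^sub>v v)"
    by (rule energy_Cauchy_Schwarz[OF spd_mat_psd[OF A_spd] v X_pow_carrier[OF v]])
  also have "\<dots> \<le> energy_vec (A l) v * (rate l ^ s * energy_vec (A l) v)"
    using energy_vec_X_pow[OF v] energy_vec_nonneg[OF v] by (intro mult_left_mono) auto
  also have "\<dots> = rate l ^ s * (v \<bullet> (A l *\<^sub>v v))" by (simp add: mult_ac flip: energy_vec_square[OF v])
  finally show ?thesis .
qed

text \<open>Self-adjointness in the energy product means X^T A = A X. Thus functionals moved by
  transposed iterates stay of the form A v, with v moved by X itself.\<close>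

lemma transpose_X_pow_vec:
  assumes v: "v \<in> carrier_vec (n l)"
  shows "transpose_mat (X l) ^\<^sub>m s *\<^sub>v (A l *\<^sub>v v) = A l *\<^sub>v (X l ^\<^sub>m s *\<^sub>v v)"
  using v
proof (induction s arbitrary: v)
  case 0
  then show ?case using vec_carriers(1)[OF 0] by simp
next
  case (Suc s)
  have Av: "A l *\<^sub>v v \<in> carrier_vec (n l)" and Xv: "X l *\<^sub>v v \<in> carrier_vec (n l)"
    using Suc.prems by (auto intro!: vec_carriers)
  have "transpose_mat (X l) *\<^sub>v (A l *\<^sub>v v) = A l *\<^sub>v (X l *\<^sub>v v)"
  proof (rule vec_eq_if_scalar_prod_eq)
    show "transpose_mat (X l) *\<^sub>v (A l *\<^sub>v v) \<in> carrier_vec (n l)" "A l *\<^sub>v (X l *\<^sub>v v) \<in> carrier_vec (n l)"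
      using Av Xv by (auto intro!: vec_carriers)
    fix u :: "real Matrix.vec" assume u: "u \<in> carrier_vec (n l)"
    have Xu: "X l *\<^sub>v u \<in> carrier_vec (n l)" using u by (rule vec_carriers)
    have "(transpose_mat (X l) *\<^sub>v (A l *\<^sub>v v)) \<bullet> u = (A l *\<^sub>v v) \<bullet> (X l *\<^sub>v u)"
      by (rule transpose_vec_mult_scalar[OF X_carrier u Av])
    also have "\<dots> = v \<bullet> (A l *\<^sub>v (X l *\<^sub>v u))" using sym_mat_scalar_prod[OF A_sym Suc.prems Xu] .
    also have "\<dots> = (X l *\<^sub>v v) \<bullet> (A l *\<^sub>v u)"
      using self_adjoint_X[OF refl] Suc.prems u by (simp add: self_adjoint_def)
    also have "\<dots> = (A l *\<^sub>v (X l *\<^sub>v v)) \<bullet> u" using sym_mat_scalar_prod[OF A_sym Xv u] by simp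
    finally show "(transpose_mat (X l) *\<^sub>v (A l *\<^sub>v v)) \<bullet> u = (A l *\<^sub>v (X l *\<^sub>v v)) \<bullet> u" .
  qed
  moreover have "transpose_mat (X l) \<in> carrier_mat (n l) (n l)" by simp
  ultimately show ?case
    using Suc.IH[OF Xv] pow_mat_vec_Suc_right[OF _ Av, of "transpose_mat (X l)" s] pow_mat_vec_Suc_right[OF X_carrier Suc.prems]
    by (simp del: pow_mat.simps)
qed

context
  fixes L :: nat and F :: "real Matrix.vec"
  assumes L: "1 \<le> L" and F: "F \<in> carrier_vec (n L)" "F \<noteq> 0\<^sub>v (n L)"
begin

text \<open>The Riesz representer of the functional F in the energy inner product; the limiting
  covariances become energy products of g with its iterates.\<close>

abbreviation "g \<equiv> Ai L *\<^sub>v F"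

lemma g_carrier: "g \<in> carrier_vec (n L)"
  using F by (intro vec_carriers)

lemma A_g: "A L *\<^sub>v g = F"
  using mat_inv_vec_right[OF A_carrier A_det F(1)] .

lemma g_energy_pos: "0 < g \<bullet> (A L *\<^sub>v g)"
proof (rule spd_mat_pos[OF A_spd g_carrier])
  show "g \<noteq> 0\<^sub>v (n L)" using A_g F mat_vec_zero[OF A_carrier] by metis
qed

lemma rate_less_1': "rate L < 1"
proof (rule rate_less_1[OF L])
  show "0 < n L"
  proof (rule ccontr)
    assume "\<not> 0 < n L"
    then have "F = 0\<^sub>v (n L)" using F(1) by (intro eq_vecI) auto
    then show False using F(2) by simp
  qed
qed

lemma autocorr_lim_eq: "autocorr_lim (A L) (X L) F s = g \<bullet> (A L *\<^sub>v (X L ^\<^sub>m s *\<^sub>v g)) / (g \<bullet> (A L *\<^sub>v g))"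
proof -
  have *: "F \<bullet> v = g \<bullet> (A L *\<^sub>v v)" if "v \<in> carrier_vec (n L)" for v
    using sym_mat_scalar_prod[OF A_sym g_carrier that] A_g by simp
  show ?thesis unfolding autocorr_lim_def *[OF X_pow_carrier[OF g_carrier]] *[OF g_carrier] ..
qed

lemma autocorr_lim_le: "\<bar>autocorr_lim (A L) (X L) F s\<bar> \<le> 1 * rate L ^ s"
  unfolding autocorr_lim_eq using energy_autocorrelation_le[OF g_carrier, of s] g_energy_pos by (simp add: field_simps)

lemma summable_autocorr_lim: "summable (\<lambda>s. autocorr_lim (A L) (X L) F (Suc s))"
  by (rule shifted_geometric_series(1)[OF rate_nonneg rate_less_1' autocorr_lim_le])

lemma iact_lim_le: "iact_lim (A L) (X L) F \<le> (1 + rate L) / (1 - rate L)"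
proof -
  have "(\<Sum>s. autocorr_lim (A L) (X L) F (Suc s)) \<le> 1 * rate L / (1 - rate L)"
    using shifted_geometric_series(2)[OF rate_nonneg rate_less_1' autocorr_lim_le] by linarith
  then have "iact_lim (A L) (X L) F \<le> 1 + 2 * (rate L / (1 - rate L))" by (simp add: iact_lim_def)
  also have "\<dots> = (1 + rate L) / (1 - rate L)" using rate_less_1' by (simp add: field_simps)
  finally show ?thesis .
qed

end

end

text \<open>Every draw is normal, hence has square integrable functionals, and measurable functions
  of independent draws are independent, hence uncorrelated.\<close>

lemma uncorrelated_vectors_mgmc:
  assumes "mgmc_draws n A M \<nu> L Q W"
  shows "uncorrelated_vectors Q W (draw_dim n L) (draws L \<nu>)"
proof -
  interpret prob_space Q using assms by (simp add: mgmc_draws_def)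
  have "\<exists>\<mu> \<Sigma>. mv_normal Q (draw_dim n L d) (W d) \<mu> \<Sigma>" if "d \<in> draws L \<nu>" for d
  proof (cases d)
    case (Smooth m l j)
    then have "mv_normal Q (n l) (W (Smooth m l j)) (0\<^sub>v (n l)) (M l + transpose_mat (M l) - A l)"
      using that assms by (auto simp: draws_def mgmc_draws_def)
    then show ?thesis unfolding Smooth draw_dim.simps by blast
  qed (use that assms in \<open>auto simp: mgmc_draws_def\<close>)
  then have N: "\<And>d. d \<in> draws L \<nu> \<Longrightarrow> \<exists>\<mu> \<Sigma>. mv_normal Q (draw_dim n L d) (W d) \<mu> \<Sigma>" .
  have ind: "indep_vars (\<lambda>d. vec_borel (draw_dim n L d)) W (draws L \<nu>)" using assms by (simp add: mgmc_draws_def)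
  show ?thesis
  proof unfold_locales
    fix d w assume "d \<in> draws L \<nu>" "w \<in> space Q"
    then show "W d w \<in> carrier_vec (draw_dim n L d)" using N mv_normal_carrier by blast
  next
    fix d and a :: "real Matrix.vec" assume "d \<in> draws L \<nu>" "a \<in> carrier_vec (draw_dim n L d)"
    then show "sq_integrable Q (\<lambda>w. a \<bullet> W d w)" using N mv_normal_sq_integrable(1) by blast
  next
    fix d e and a b :: "real Matrix.vec"
    assume de: "d \<in> draws L \<nu>" "e \<in> draws L \<nu>" "d \<noteq> e"
      and a: "a \<in> carrier_vec (draw_dim n L d)" and b: "b \<in> carrier_vec (draw_dim n L e)"
    \<comment> \<open>Choosing the functional by index packs the pair into one independent family
      over {d, e}, to which the product rule for expectations applies.\<close>
    define c where "c i = (if i = d then a else b)" for i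
    define U where "U i w = c i \<bullet> W i w" for i w
    have sq: "sq_integrable Q (U i)" if "i \<in> {d, e}" for i
      unfolding U_def using that de a b N mv_normal_sq_integrable(1) by (auto simp: c_def) blast+
    have "indep_vars (\<lambda>d. vec_borel (draw_dim n L d)) W {d, e}" using indep_vars_subset[OF ind] de by simp
    then have iv: "indep_vars (\<lambda>_. borel) U {d, e}" unfolding U_def
      by (rule indep_vars_compose2[where Y = "\<lambda>i v. c i \<bullet> v"])
        (use de a b in \<open>auto simp: c_def intro: measurable_scalar_prod_vec_borel\<close>)
    have "expectation (\<lambda>w. \<Prod>i\<in>{d, e}. U i w) = (\<Prod>i\<in>{d, e}. expectation (U i))"
      by (rule indep_vars_lebesgue_integral[OF _ iv]) (use sq sq_integrable_integrable in auto)
    then have "cov Q (U d) (U e) = 0" using sq de(3) by (simp add: cov_eq)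
    then show "cov Q (\<lambda>w. a \<bullet> W d w) (\<lambda>w. b \<bullet> W e w) = 0" using de(3) unfolding U_def c_def by simp
  qed
qed

section \<open>Autocorrelation times of a single run\<close>

locale symmetric_mgmc_run = symmetric_multigrid n A P M k + mgmc_run n A P M k k Q W L
  for n A P M and k :: nat and Q :: "'w measure" and W L +
  fixes F f :: "real Matrix.vec" and \<Sigma> :: "real mat"
  assumes L: "1 \<le> L" and F: "F \<in> carrier_vec (n L)" "F \<noteq> 0\<^sub>v (n L)" and f: "f \<in> carrier_vec (n L)"
    and \<Sigma>: "psd_mat (n L) \<Sigma>"
    and cov_Initial: "a \<in> carrier_vec (n L) \<Longrightarrow> b \<in> carrier_vec (n L) \<Longrightarrow>
      cov Q (\<lambda>w. a \<bullet> W Initial w) (\<lambda>w. b \<bullet> W Initial w) = a \<bullet> (\<Sigma> *\<^sub>v b)"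
begin

abbreviation Y :: "nat \<Rightarrow> 'w \<Rightarrow> real" where "Y m w \<equiv> F \<bullet> mgmc_chain A P M k k W L f m w"

lemma \<Sigma>_carrier: "\<Sigma> \<in> carrier_mat (n L) (n L)"
  using \<Sigma> by (simp add: psd_mat_def sym_mat_def)

abbreviation (input) "u \<equiv> Ai L *\<^sub>v F"

definition limit_cov :: "nat \<Rightarrow> real" where
  "limit_cov s = u \<bullet> (A L *\<^sub>v (X L ^\<^sub>m s *\<^sub>v u))"

text \<open>The memory of the initial covariance: \<Sigma> - A^{-1} paired with (X^T)^(m+s) F and
  (X^T)^m F, both rewritten through self-adjointness as A applied to iterates of the representer
  \<open>u\<close> of F.\<close>

definition initial_cov :: "nat \<Rightarrow> nat \<Rightarrow> real" where
  "initial_cov m s = (A L *\<^sub>v (X L ^\<^sub>m m *\<^sub>v (X L ^\<^sub>m s *\<^sub>v u))) \<bullet> ((\<Sigma> - Ai L) *\<^sub>v (A L *\<^sub>v (X L ^\<^sub>m m *\<^sub>v u)))"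

lemma u_carrier: "u \<in> carrier_vec (n L)"
  using F by (intro vec_carriers)

lemma cov_Y: "cov Q (Y (m + s)) (Y m) = limit_cov s + initial_cov m s"
proof -
  let ?T = "transpose_mat (X L)"
  have TF: "?T ^\<^sub>m s *\<^sub>v F = A L *\<^sub>v (X L ^\<^sub>m s *\<^sub>v u)" for s
    using transpose_X_pow_vec[OF u_carrier, of s] A_g[OF L F] by simp
  have Xu: "X L ^\<^sub>m s *\<^sub>v u \<in> carrier_vec (n L)" using X_pow_carrier[OF u_carrier] .
  have AXu: "A L *\<^sub>v (X L ^\<^sub>m s *\<^sub>v u) \<in> carrier_vec (n L)" using Xu by (rule vec_carriers)
  have "cov Q (Y (m + s)) (Y m) = cov Q (\<lambda>w. (?T ^\<^sub>m s *\<^sub>v F) \<bullet> mgmc_chain A P M k k W L f m w) (Y m)"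
    by (rule chain_cov_lag[OF f F(1) F(1)])
  also have "\<dots> = (?T ^\<^sub>m s *\<^sub>v F) \<bullet> u + (?T ^\<^sub>m m *\<^sub>v (?T ^\<^sub>m s *\<^sub>v F)) \<bullet> ((\<Sigma> - Ai L) *\<^sub>v (?T ^\<^sub>m m *\<^sub>v F))"
    by (rule chain_cov[OF f \<Sigma>_carrier cov_Initial]) (use AXu F TF in simp_all)
  also have "\<dots> = (A L *\<^sub>v (X L ^\<^sub>m s *\<^sub>v u)) \<bullet> u + initial_cov m s"
    unfolding TF initial_cov_def transpose_X_pow_vec[OF Xu] ..
  also have "(A L *\<^sub>v (X L ^\<^sub>m s *\<^sub>v u)) \<bullet> u = limit_cov s"
    unfolding limit_cov_def using comm_scalar_prod[OF AXu u_carrier] .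
  finally show ?thesis .
qed

lemma limit_cov_0: "limit_cov 0 = u \<bullet> (A L *\<^sub>v u)"
  unfolding limit_cov_def using u_carrier by simp

lemma autocorr_Y: "autocorr Q Y m s = (limit_cov s + initial_cov m s) / (limit_cov 0 + initial_cov m 0)"
  unfolding autocorr_def cov_Y using cov_Y[of m 0] by simp

lemma autocorr_lim_limit_cov: "autocorr_lim (A L) (X L) F s = limit_cov s / limit_cov 0"
  unfolding autocorr_lim_eq[OF L F] limit_cov_0 by (simp add: limit_cov_def)

text \<open>Separates the part with \<Sigma>, controlled by the norm hypothesis and nonnegative on
  the diagonal, from an energy product controlled by Cauchy-Schwarz.\<close>

lemma initial_cov_eq:
  assumes x: "x \<in> carrier_vec (n L)" and y: "y \<in> carrier_vec (n L)"
  shows "(A L *\<^sub>v x) \<bullet> ((\<Sigma> - Ai L) *\<^sub>v (A L *\<^sub>v y)) = (A L *\<^sub>v x) \<bullet> (\<Sigma> *\<^sub>v (A L *\<^sub>v y)) - x \<bullet> (A L *\<^sub>v y)"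
proof -
  have c: "A L *\<^sub>v x \<in> carrier_vec (n L)" "A L *\<^sub>v y \<in> carrier_vec (n L)" using x y by (auto intro!: vec_carriers)
  have "(\<Sigma> - Ai L) *\<^sub>v (A L *\<^sub>v y) = \<Sigma> *\<^sub>v (A L *\<^sub>v y) - y"
    using minus_mult_distrib_mat_vec[OF \<Sigma>_carrier Ai_carrier c(2)] mat_inv_vec_left[OF A_carrier A_det y] by simp
  then show ?thesis
    using scalar_prod_minus_distrib[OF c(1) mult_mat_vec_carrier[OF \<Sigma>_carrier c(2)] y] sym_mat_scalar_prod[OF A_sym x y] by simp
qed

text \<open>The two parts of the initial deviation contribute C and 1, and the energies of X^(m+s) u
  and X^m u contribute the power 2 m + s of the rate. The perturbation estimate then applies with K
  = C + 1.\<close>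

lemma iact_bound:
  assumes C: "norm2_mat (mat_sqrt (A L) * \<Sigma> * mat_sqrt (A L)) \<le> C" and m: "1 \<le> m"
  shows "iact_exists Q Y m"
    "\<bar>iact Q Y m - iact_lim (A L) (X L) F\<bar>
      \<le> 4 * (C + 1) * (rate L ^ (2 * m + 1) / ((1 - rate L) * (1 - rate L ^ (2 * m))))"
proof -
  let ?e = "energy_vec (A L)" and ?r = "rate L"
  have psd: "psd_mat (n L) (A L)" using spd_mat_psd[OF A_spd] .
  have C0: "0 \<le> C" using C norm2_mat_nonneg order_trans by blast
  note en = energy_vec_nonneg[where l = L]
  have eu: "0 \<le> ?e u" using en[OF u_carrier] .
  have e0: "limit_cov 0 = ?e u * ?e u" using limit_cov_0 energy_vec_square[OF u_carrier] by simp
  have pow: "?e (X L ^\<^sub>m m *\<^sub>v u) \<le> ?r ^ m * ?e u" using energy_vec_X_pow[OF u_carrier] .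
  have y: "X L ^\<^sub>m m *\<^sub>v u \<in> carrier_vec (n L)" using X_pow_carrier[OF u_carrier] .
  have ip: "\<bar>initial_cov m s\<bar> \<le> (C + 1) * ?r ^ (2 * m + s) * limit_cov 0" for s
  proof -
    let ?x = "X L ^\<^sub>m m *\<^sub>v (X L ^\<^sub>m s *\<^sub>v u)" and ?y = "X L ^\<^sub>m m *\<^sub>v u"
    have Xs: "X L ^\<^sub>m s *\<^sub>v u \<in> carrier_vec (n L)" using X_pow_carrier[OF u_carrier] .
    have x: "?x \<in> carrier_vec (n L)" using X_pow_carrier[OF Xs] .
    have "?e ?x \<le> ?r ^ m * ?e (X L ^\<^sub>m s *\<^sub>v u)" using energy_vec_X_pow[OF Xs] .
    also have "\<dots> \<le> ?r ^ m * (?r ^ s * ?e u)" using energy_vec_X_pow[OF u_carrier] rate_nonneg by (intro mult_left_mono) auto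
    finally have ex: "?e ?x \<le> ?r ^ (m + s) * ?e u" by (simp add: power_add mult.assoc)
    have "\<bar>initial_cov m s\<bar> \<le> \<bar>(A L *\<^sub>v ?x) \<bullet> (\<Sigma> *\<^sub>v (A L *\<^sub>v ?y))\<bar> + \<bar>?x \<bullet> (A L *\<^sub>v ?y)\<bar>"
      unfolding initial_cov_def initial_cov_eq[OF x y] by (rule abs_triangle_ineq4)
    also have "\<dots> \<le> norm2_mat (mat_sqrt (A L) * \<Sigma> * mat_sqrt (A L)) * ?e ?x * ?e ?y + ?e ?x * ?e ?y"
      using norm2_mat_sqrt_conj_bound[OF psd \<Sigma>_carrier x y] energy_Cauchy_Schwarz[OF psd x y] by (rule add_mono)
    also have "\<dots> \<le> C * ?e ?x * ?e ?y + ?e ?x * ?e ?y"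
      using C en[OF x] en[OF y] by (intro add_right_mono mult_right_mono) auto
    also have "\<dots> = (C + 1) * (?e ?x * ?e ?y)" by (simp add: algebra_simps)
    also have "\<dots> \<le> (C + 1) * ((?r ^ (m + s) * ?e u) * (?r ^ m * ?e u))"
      using ex pow C0 en[OF x] en[OF y] eu rate_nonneg by (intro mult_left_mono mult_mono) auto
    also have "\<dots> = (C + 1) * ?r ^ (2 * m + s) * limit_cov 0"
    proof -
      have "?r ^ (2 * m + s) = ?r ^ (m + s) * ?r ^ m" by (simp add: mult_2 add.commute add.left_commute flip: power_add)
      then show ?thesis unfolding e0 by (simp add: mult_ac)
    qed
    finally show ?thesis .
  qed
  \<comment> \<open>As \<Sigma> is positive semidefinite, dropping its term leaves minus the squared
    energy of X^m u. This bound is free of C and keeps the variance positive for every m \<ge>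
    1.\<close>
  have lo: "- (?r ^ (2 * m)) * limit_cov 0 \<le> initial_cov m 0"
  proof -
    let ?y = "X L ^\<^sub>m m *\<^sub>v u"
    have "0 \<le> (A L *\<^sub>v ?y) \<bullet> (\<Sigma> *\<^sub>v (A L *\<^sub>v ?y))" using \<Sigma> vec_carriers(1)[OF y] by (simp add: psd_mat_def)
    then have "- (?e ?y * ?e ?y) \<le> initial_cov m 0"
      unfolding initial_cov_def energy_vec_square[OF y] using initial_cov_eq[OF y y] u_carrier by simp
    moreover have "?e ?y * ?e ?y \<le> (?r ^ m * ?e u) * (?r ^ m * ?e u)"
      using pow en[OF y] eu rate_nonneg by (intro mult_mono) auto
    moreover have "?r ^ (2 * m) = ?r ^ m * ?r ^ m" by (simp add: mult_2 power_add)
    ultimately show ?thesis unfolding e0 by (simp add: mult_ac)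
  qed
  have a: "\<bar>limit_cov s\<bar> \<le> ?r ^ s * limit_cov 0" for s
    using energy_autocorrelation_le[OF u_carrier] unfolding limit_cov_0 unfolding limit_cov_def .
  have a0: "0 < limit_cov 0" unfolding limit_cov_0 using g_energy_pos[OF L F] .
  note P = autocorrelation_perturbation[where a = limit_cov and b = "initial_cov m", OF rate_nonneg rate_less_1'[OF L F] a0 m _ a ip lo]
  show "iact_exists Q Y m" unfolding iact_exists_def autocorr_Y
    using P(1,2) C0 cov_Y[of m 0] by simp
  show "\<bar>iact Q Y m - iact_lim (A L) (X L) F\<bar>
      \<le> 4 * (C + 1) * (rate L ^ (2 * m + 1) / ((1 - rate L) * (1 - rate L ^ (2 * m))))"
    unfolding iact_def iact_lim_def autocorr_Y autocorr_lim_limit_cov using P(3) C0 by simp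
qed

text \<open>The deviation \<Sigma> - A^{-1} vanishes, so the autocorrelations agree with their
  limits term by term, already at m = 0.\<close>

lemma iact_stationary:
  assumes "\<Sigma> = Ai L"
  shows "iact_exists Q Y m" "iact Q Y m = iact_lim (A L) (X L) F"
proof -
  have z: "initial_cov m s = 0" for m s
  proof -
    let ?x = "X L ^\<^sub>m m *\<^sub>v (X L ^\<^sub>m s *\<^sub>v u)" and ?y = "X L ^\<^sub>m m *\<^sub>v u"
    have c: "?x \<in> carrier_vec (n L)" "?y \<in> carrier_vec (n L)" using X_pow_carrier u_carrier by blast+
    show ?thesis unfolding initial_cov_def initial_cov_eq[OF c] unfolding assms
      using mat_inv_vec_left[OF A_carrier A_det c(2)] sym_mat_scalar_prod[OF A_sym c] by simp
  qed
  have eq: "autocorr Q Y m s = autocorr_lim (A L) (X L) F s" for m s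
    unfolding autocorr_Y autocorr_lim_limit_cov z by simp
  show "iact Q Y m = iact_lim (A L) (X L) F" unfolding iact_def iact_lim_def eq ..
  have "0 < cov Q (Y m) (Y m)" using cov_Y[of m 0] z limit_cov_0 g_energy_pos[OF L F] by simp
  then show "iact_exists Q Y m" unfolding iact_exists_def eq using summable_autocorr_lim[OF L F] by simp
qed

end


theorem theorem4p14:
  fixes n :: "nat \<Rightarrow> nat" and A P M :: "nat \<Rightarrow> real mat" and \<nu> :: nat and C\<^sub>A C\<^sub>0 :: real
    and V :: "nat \<Rightarrow> 'h::{real_inner, polish_space} set" and \<phi> :: "nat \<Rightarrow> nat \<Rightarrow> 'h" and \<chi> :: 'h
    and F :: "nat \<Rightarrow> real Matrix.vec" and X :: "nat \<Rightarrow> real mat" and \<rho> :: "nat \<Rightarrow> real"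
    and Y :: "(draw \<Rightarrow> 'w \<Rightarrow> real Matrix.vec) \<Rightarrow> nat \<Rightarrow> real Matrix.vec \<Rightarrow> nat \<Rightarrow> 'w \<Rightarrow> real"
  assumes F_def: "F = (\<lambda>L. qoi_vec (n L) (\<phi> L) \<chi>)"
    and X_def: "X = iteration_mat A P M (\<nu> div 2) (\<nu> div 2)"
    and rho_def: "\<rho> = (\<lambda>L. energy_norm (A L) (X L))"
    and Y_def: "Y = (\<lambda>W L f m w. F L \<bullet> mgmc_chain A P M (\<nu> div 2) (\<nu> div 2) W L f m w)"
    and "0 < \<nu>" and "even \<nu>"
    and "multigrid_hierarchy n A P"
    and "\<And>l. 1 \<le> l \<Longrightarrow> sym_mat (n l) (M l) \<and> invertible_mat (M l)"
    and "\<And>l. 1 \<le> l \<Longrightarrow> loewner_le (n l) (A l) (M l)"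
    and "0 < C\<^sub>A"
    and "\<And>l. 1 \<le> l \<Longrightarrow>
           norm2_mat (mat_sqrt (M l) *
             (mat_inv (A l) - P l * mat_inv (A (l - 1)) * transpose_mat (P l)) *
             mat_sqrt (M l)) \<le> C\<^sub>A"
  shows
    "(\<forall>L\<ge>1. indexed_basis (n L) (\<phi> L) (V L) \<and> F L \<noteq> 0\<^sub>v (n L) \<longrightarrow>
        \<rho> L < 1 \<and> summable (\<lambda>s. autocorr_lim (A L) (X L) (F L) (Suc s)) \<and>
        iact_lim (A L) (X L) (F L) \<le> (1 + \<rho> L) / (1 - \<rho> L)) \<and>
     (\<exists>C. \<forall>L\<ge>1. indexed_basis (n L) (\<phi> L) (V L) \<and> F L \<noteq> 0\<^sub>v (n L) \<longrightarrow>
        (\<forall>f\<in>carrier_vec (n L). \<forall>Q W. mgmc_draws n A M \<nu> L Q W \<and>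
           norm2_mat (mat_sqrt (A L) * cov_mat Q (n L) (W Initial) * mat_sqrt (A L)) < C\<^sub>0 \<longrightarrow>
           (\<forall>m\<ge>1. iact_exists Q (Y W L f) m \<and>
              \<bar>iact Q (Y W L f) m - iact_lim (A L) (X L) (F L)\<bar>
                \<le> C * (\<rho> L ^ (2 * m + 1) / ((1 - \<rho> L) * (1 - \<rho> L ^ (2 * m))))))) \<and>
     (\<forall>L\<ge>1. indexed_basis (n L) (\<phi> L) (V L) \<and> F L \<noteq> 0\<^sub>v (n L) \<longrightarrow>
        (\<forall>f\<in>carrier_vec (n L). \<forall>Q W. mgmc_draws n A M \<nu> L Q W \<and>
           mv_normal Q (n L) (W Initial) (mat_inv (A L) *\<^sub>v f) (mat_inv (A L)) \<longrightarrow>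
           (\<forall>m. iact_exists Q (Y W L f) m \<and>
              iact Q (Y W L f) m = iact_lim (A L) (X L) (F L))))"
proof -
  define k where "k = \<nu> div 2"
  have kk: "k + k = \<nu>" and k: "0 < k" using assms(5,6) by (auto simp: k_def elim!: evenE)
  note X = X_def[folded k_def] and Y = Y_def[folded k_def]
  have H: "spd_mat (n l) (A l)" "P (Suc l) \<in> carrier_mat (n (Suc l)) (n l)"
    "A l = transpose_mat (P (Suc l)) * A (Suc l) * P (Suc l)" for l
    using assms(7) unfolding multigrid_hierarchy_def by (auto dest!: spec[of _ "Suc l"])
  have le: "loewner_le (n (Suc l)) (A (Suc l)) (M (Suc l))" for l using assms(9) by simp
  have M_sym: "sym_mat (n (Suc l)) (M (Suc l))" for l using assms(8) by simp
  \<comment> \<open>The splitting matrix dominates a positive definite matrix and is therefore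
    positive definite; this yields the nonzero determinant that the smoother locale asks
    for.\<close>
  have M_spd: "spd_mat (n (Suc l)) (M (Suc l))" for l
    unfolding spd_mat_def
  proof (intro conjI ballI impI M_sym)
    fix v :: "real Matrix.vec" assume v: "v \<in> carrier_vec (n (Suc l))" "v \<noteq> 0\<^sub>v (n (Suc l))"
    have c: "A (Suc l) \<in> carrier_mat (n (Suc l)) (n (Suc l))" "M (Suc l) \<in> carrier_mat (n (Suc l)) (n (Suc l))"
      using le[of l] by (auto simp: loewner_le_def)
    have "0 \<le> v \<bullet> ((M (Suc l) - A (Suc l)) *\<^sub>v v)" using le[of l] v by (simp add: loewner_le_def psd_mat_def)
    then have "v \<bullet> (A (Suc l) *\<^sub>v v) \<le> v \<bullet> (M (Suc l) *\<^sub>v v)"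
      using c v carrier_matD[OF c(1)] carrier_matD[OF c(2)] by (simp add: mat_minus_vec scalar_prod_minus_right)
    then show "0 < v \<bullet> (M (Suc l) *\<^sub>v v)" using spd_mat_pos[OF H(1) v] by linarith
  qed
  interpret mg: symmetric_multigrid n A P M k
    by (intro symmetric_multigrid.intro multigrid.intro symmetric_multigrid_axioms.intro smoother.intro
        H k le M_sym spd_mat_det[OF M_spd])
  have F_carrier: "F L \<in> carrier_vec (n L)" for L unfolding F_def qoi_vec_def by simp
  \<comment> \<open>Stated for an arbitrary normal initial law, so that it serves both for the law
    supplied by \<open>mgmc_draws\<close> and for the target law with covariance A^{-1}.\<close>
  have run: "symmetric_mgmc_run n A P M k Q W L (F L) f \<Sigma>"
    if "1 \<le> L" "F L \<noteq> 0\<^sub>v (n L)" "f \<in> carrier_vec (n L)" and draws: "mgmc_draws n A M \<nu> L Q W"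
      and init: "mv_normal Q (n L) (W Initial) \<mu> \<Sigma>"
    for L f Q and W :: "draw \<Rightarrow> 'w \<Rightarrow> real Matrix.vec" and \<mu> \<Sigma>
  proof -
    interpret uncorrelated_vectors Q W "draw_dim n L" "draws L (k + k)"
      using uncorrelated_vectors_mgmc[OF draws] unfolding kk .
    show ?thesis
    proof unfold_locales
      show "psd_mat (n L) \<Sigma>" using init by (simp add: mv_normal_def)
      show "cov Q (\<lambda>w. a \<bullet> W (Coarse m) w) (\<lambda>w. b \<bullet> W (Coarse m) w) = a \<bullet> (mat_inv (A 0) *\<^sub>v b)"
        if "a \<in> carrier_vec (n 0)" "b \<in> carrier_vec (n 0)" for a b m
        using draws that by (intro mv_normal_cov) (auto simp: mgmc_draws_def)
      show "cov Q (\<lambda>w. a \<bullet> W (Smooth m l j) w) (\<lambda>w. b \<bullet> W (Smooth m l j) w)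
        = a \<bullet> ((M l + transpose_mat (M l) - A l) *\<^sub>v b)"
        if "1 \<le> l" "l \<le> L" "j < k + k" "a \<in> carrier_vec (n l)" "b \<in> carrier_vec (n l)" for l j a b m
        using draws that unfolding kk by (intro mv_normal_cov[where \<mu> = "0\<^sub>v (n l)"]) (auto simp: mgmc_draws_def)
      show "cov Q (\<lambda>w. a \<bullet> W Initial w) (\<lambda>w. b \<bullet> W Initial w) = a \<bullet> (\<Sigma> *\<^sub>v b)"
        if "a \<in> carrier_vec (n L)" "b \<in> carrier_vec (n L)" for a b
        by (rule mv_normal_cov[OF init that])
    qed (use that F_carrier in auto)
  qed
  \<comment> \<open>The witness \<open>4 * (C\<^sub>0 + 1)\<close> comes from
    \<open>iact_bound\<close> with C0 for C; it mentions neither the level nor the run.\<close>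
  show ?thesis
  proof (intro conjI exI[of _ "4 * (C\<^sub>0 + 1)"] allI impI ballI; (elim conjE)?)
    fix L assume L: "1 \<le> L" "F L \<noteq> 0\<^sub>v (n L)"
    show "\<rho> L < 1" unfolding rho_def X using mg.rate_less_1'[OF L(1) F_carrier L(2)] .
    show "summable (\<lambda>s. autocorr_lim (A L) (X L) (F L) (Suc s))"
      unfolding X using mg.summable_autocorr_lim[OF L(1) F_carrier L(2)] .
    show "iact_lim (A L) (X L) (F L) \<le> (1 + \<rho> L) / (1 - \<rho> L)"
      unfolding rho_def X using mg.iact_lim_le[OF L(1) F_carrier L(2)] .
    fix f :: "real Matrix.vec" and Q and W :: "draw \<Rightarrow> 'w \<Rightarrow> real Matrix.vec" and m :: nat
    assume f: "f \<in> carrier_vec (n L)" and draws: "mgmc_draws n A M \<nu> L Q W"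
    show "iact_exists Q (Y W L f) m"
      "\<bar>iact Q (Y W L f) m - iact_lim (A L) (X L) (F L)\<bar>
          \<le> 4 * (C\<^sub>0 + 1) * (\<rho> L ^ (2 * m + 1) / ((1 - \<rho> L) * (1 - \<rho> L ^ (2 * m))))"
      if C: "norm2_mat (mat_sqrt (A L) * cov_mat Q (n L) (W Initial) * mat_sqrt (A L)) < C\<^sub>0" and m: "1 \<le> m"
    proof -
      obtain \<mu> \<Sigma> where init: "mv_normal Q (n L) (W Initial) \<mu> \<Sigma>" using draws by (auto simp: mgmc_draws_def)
      interpret symmetric_mgmc_run n A P M k Q W L "F L" f \<Sigma>
        by (rule run[OF L f draws init])
      have "norm2_mat (mat_sqrt (A L) * \<Sigma> * mat_sqrt (A L)) \<le> C\<^sub>0"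
        using C unfolding mv_normal_cov_mat[OF init] by simp
      from iact_bound[OF this m]
      show "iact_exists Q (Y W L f) m"
        "\<bar>iact Q (Y W L f) m - iact_lim (A L) (X L) (F L)\<bar>
          \<le> 4 * (C\<^sub>0 + 1) * (\<rho> L ^ (2 * m + 1) / ((1 - \<rho> L) * (1 - \<rho> L ^ (2 * m))))"
        unfolding rho_def X Y .
    qed
    show "iact_exists Q (Y W L f) m" "iact Q (Y W L f) m = iact_lim (A L) (X L) (F L)"
      if init: "mv_normal Q (n L) (W Initial) (mat_inv (A L) *\<^sub>v f) (mat_inv (A L))"
    proof -
      interpret symmetric_mgmc_run n A P M k Q W L "F L" f "mat_inv (A L)"
        by (rule run[OF L f draws init])
      show "iact_exists Q (Y W L f) m" "iact Q (Y W L f) m = iact_lim (A L) (X L) (F L)"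
        unfolding X Y using iact_stationary[OF refl] .
    qed
  qed
qed

end
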